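(* Suppose that $M\subset\mathbb{C}^N$ is a connected real-analytic generic submanifold of real codimension $2$ through $0$, and $M$ is almost minimal at $0$. Then $M$ has the modulus uniqueness property at $0$.
   Context: A real-analytic submanifold $M\subset\mathbb{C}^N$ is a CR submanifold if the space of vectors $\sum_j a_j\,\partial/\partial\bar z_j$ tangent to $M$ has constant complex dimension (the CR dimension); it is generic if it is moreover not (locally) contained in a proper complex analytic subvariety. The CR orbit $\operatorname{Orb}_p$ is the germ at $p$ of a CR submanifold of $M$ through $p$ of smallest dimension having the same CR dimension as $M$. $M$ is almost minimal at $0$ if for every connected neighbourhood $U$ of $0$ there is a point $p\in M\cap U$ such that $\operatorname{Orb}_p$ is not contained (as a germ at $p$) in any proper complex analytic subvariety of $U$. $M$ has the modulus uniqueness property at $p\in M$ if for every connected neighbourhood $U$ of $p$ in $\mathbb{C}^N$ and all holomorphic functions $f,g$ on $U$ with $|f|=|g|$ on $M\cap U$, one has $f=cg$ for some constant $c$ with $|c|=1$. *)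

theory Defs
  imports "HOL-Analysis.Analysis"
begin

text \<open>
  The space \<open>\<complex>\<^sup>N\<close> is \<open>complex ^ 'n\<close>, also viewed as a real Euclidean space of
  dimension \<open>2 * CARD('n)\<close>.
\<close>

text \<open>
  The multi-indices are the extensional functions from the coordinate basis to \<open>nat\<close>;
  \<open>has_sum\<close> is unconditional convergence.
\<close>
definition real_analytic_at :: "('a::euclidean_space \<Rightarrow> real) \<Rightarrow> 'a \<Rightarrow> bool" where
  "real_analytic_at f x \<longleftrightarrow>
     (\<exists>c :: ('a \<Rightarrow> nat) \<Rightarrow> real. \<exists>r>0. \<forall>y\<in>ball x r.
        ((\<lambda>\<alpha>. c \<alpha> * (\<Prod>b\<in>Basis. ((y - x) \<bullet> b) ^ \<alpha> b)) has_sum f y)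
          (Basis \<rightarrow>\<^sub>E (UNIV :: nat set)))"

text \<open>
  Embedded (locally closed) submanifolds of real dimension \<open>m\<close>, given locally by
  \<open>k\<close> equations with independent differentials, where \<open>k\<close> is the real codimension.
\<close>
definition real_analytic_submanifold :: "nat \<Rightarrow> 'a::euclidean_space set \<Rightarrow> bool" where
  "real_analytic_submanifold m M \<longleftrightarrow>
     (\<forall>p\<in>M. \<exists>V k. \<exists>\<rho> :: nat \<Rightarrow> 'a \<Rightarrow> real.
        open V \<and> p \<in> V \<and> m + k = DIM('a) \<and>
        (\<forall>i<k. \<forall>q\<in>V. real_analytic_at (\<rho> i) q) \<and>
        M \<inter> V = {q \<in> V. \<forall>i<k. \<rho> i q = 0} \<and>
        (\<forall>q\<in>M \<inter> V. \<forall>t :: nat \<Rightarrow> real.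
           (\<forall>v. (\<Sum>i<k. t i * frechet_derivative (\<rho> i) (at q) v) = 0) \<longrightarrow> (\<forall>i<k. t i = 0)))"

definition holomorphic_cn_on :: "(complex ^ 'n \<Rightarrow> complex) \<Rightarrow> (complex ^ 'n) set \<Rightarrow> bool" where
  "holomorphic_cn_on f U \<longleftrightarrow>
     (\<forall>z\<in>U. \<exists>D. (f has_derivative D) (at z) \<and> (\<forall>c v. D (c *s v) = c * D v))"

text \<open>The local equations are required at every point of \<open>U\<close>, so \<open>A\<close> is closed in \<open>U\<close>.\<close>
definition analytic_subvariety :: "(complex ^ 'n) set \<Rightarrow> (complex ^ 'n) set \<Rightarrow> bool" where
  "analytic_subvariety U A \<longleftrightarrow>
     A \<subseteq> U \<and>
     (\<forall>z\<in>U. \<exists>V F. open V \<and> z \<in> V \<and> V \<subseteq> U \<and> finite F \<and>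
        (\<forall>f\<in>F. holomorphic_cn_on f V) \<and> A \<inter> V = {w \<in> V. \<forall>f\<in>F. f w = 0})"

text \<open>Only used for connected open \<open>U\<close>, where proper subvarieties are nowhere dense.\<close>
definition proper_analytic_subvariety :: "(complex ^ 'n) set \<Rightarrow> (complex ^ 'n) set \<Rightarrow> bool" where
  "proper_analytic_subvariety U A \<longleftrightarrow> analytic_subvariety U A \<and> A \<noteq> U"

text \<open>
  \<open>\<partial>r/\<partial>z\<^bsub>j\<^esub>-bar = (\<partial>r/\<partial>x\<^bsub>j\<^esub> + i \<partial>r/\<partial>y\<^bsub>j\<^esub>) / 2\<close>, where \<open>z\<^bsub>j\<^esub> = x\<^bsub>j\<^esub> + i y\<^bsub>j\<^esub>\<close>.
\<close>
definition dbar :: "(complex ^ 'n \<Rightarrow> real) \<Rightarrow> complex ^ 'n \<Rightarrow> 'n \<Rightarrow> complex" where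
  "dbar r p j =
     (of_real (frechet_derivative r (at p) (axis j 1)) +
      \<i> * of_real (frechet_derivative r (at p) (axis j \<i>))) / 2"

text \<open>
  The vector \<open>a\<close> stands for \<open>\<Sum>\<^bsub>j\<^esub> a\<^bsub>j\<^esub> \<partial>/\<partial>z\<^bsub>j\<^esub>-bar\<close> at \<open>p\<close>; it is tangent to \<open>M\<close> (lies in the
  complexified tangent space) iff it annihilates the germs of real-valued functions vanishing on \<open>M\<close>.
\<close>
definition T01 :: "(complex ^ 'n) set \<Rightarrow> complex ^ 'n \<Rightarrow> (complex ^ 'n) set" where
  "T01 M p =
     {a. \<forall>r. real_analytic_at r p \<and> (\<forall>\<^sub>F q in nhds p. q \<in> M \<longrightarrow> r q = 0) \<longrightarrow>
           (\<Sum>j\<in>UNIV. a $ j * dbar r p j) = 0}"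

definition CR_dim_at :: "(complex ^ 'n) set \<Rightarrow> complex ^ 'n \<Rightarrow> nat" where
  "CR_dim_at M p = vec.dim (T01 M p)"

text \<open>Real dimension \<open>m\<close>, CR dimension \<open>n\<close>.\<close>
definition CR_submanifold :: "nat \<Rightarrow> nat \<Rightarrow> (complex ^ 'n) set \<Rightarrow> bool" where
  "CR_submanifold m n M \<longleftrightarrow>
     real_analytic_submanifold m M \<and> (\<forall>p\<in>M. CR_dim_at M p = n)"

definition generic_submanifold :: "nat \<Rightarrow> (complex ^ 'n) set \<Rightarrow> bool" where
  "generic_submanifold m M \<longleftrightarrow>
     (\<exists>n. CR_submanifold m n M) \<and>
     (\<forall>p\<in>M. \<forall>U. open U \<and> connected U \<and> p \<in> U \<longrightarrow>
        \<not> (\<exists>A. proper_analytic_subvariety U A \<and> M \<inter> U \<subseteq> A))"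

text \<open>
  \<open>CR_orbit M p S\<close>: the set \<open>S\<close> is a representative of the germ \<open>Orb\<^bsub>p\<^esub>\<close>, for a CR submanifold \<open>M\<close>.
  By Nagano's theorem representatives exist and any two of them agree near \<open>p\<close>.
\<close>
definition CR_orbit ::
  "(complex ^ 'n) set \<Rightarrow> complex ^ 'n \<Rightarrow> (complex ^ 'n) set \<Rightarrow> bool" where
  "CR_orbit M p S \<longleftrightarrow>
     (\<exists>m. CR_submanifold m (CR_dim_at M p) S \<and> p \<in> S \<and> S \<subseteq> M \<and>
        (\<forall>m' S'. CR_submanifold m' (CR_dim_at M p) S' \<and> p \<in> S' \<and> S' \<subseteq> M \<longrightarrow> m \<le> m'))"

definition almost_minimal_at :: "(complex ^ 'n) set \<Rightarrow> complex ^ 'n \<Rightarrow> bool" where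
  "almost_minimal_at M a \<longleftrightarrow>
     (\<forall>U. open U \<and> connected U \<and> a \<in> U \<longrightarrow>
        (\<exists>p\<in>M \<inter> U. \<exists>S. CR_orbit M p S \<and>
           \<not> (\<exists>A. proper_analytic_subvariety U A \<and> (\<forall>\<^sub>F q in nhds p. q \<in> S \<longrightarrow> q \<in> A))))"

definition modulus_uniqueness_at :: "(complex ^ 'n) set \<Rightarrow> complex ^ 'n \<Rightarrow> bool" where
  "modulus_uniqueness_at M p \<longleftrightarrow>
     (\<forall>U f g. open U \<and> connected U \<and> p \<in> U \<and>
        holomorphic_cn_on f U \<and> holomorphic_cn_on g U \<and> (\<forall>z\<in>M \<inter> U. cmod (f z) = cmod (g z)) \<longrightarrow>
        (\<exists>c. cmod c = 1 \<and> (\<forall>z\<in>U. f z = c * g z)))"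

end

theory Submission
  imports Defs "HOL-Complex_Analysis.Complex_Analysis"
begin

text \<open>
  Let \<open>|f| = |g|\<close> on \<open>M\<close>, let \<open>p\<close> be the point supplied by almost minimality and \<open>S\<close> its CR orbit.
  Differentiating \<open>|f|\<^sup>2 = |g|\<^sup>2\<close> in the complex tangent directions of \<open>S\<close> shows that \<open>f / g\<close> is
  constant along all of them, and hence along the Lie algebra of real-analytic vector fields that are
  tangent to \<open>S\<close> and along which \<open>f / g\<close> is constant. By Nagano's theorem this Lie algebra has an
  integral manifold through \<open>p\<close>. It is a CR submanifold of \<open>S\<close> with the same CR dimension, so the
  minimality of the orbit makes it a neighbourhood of \<open>p\<close> in \<open>S\<close>, and \<open>f - c g\<close> vanishes on \<open>S\<close>
  near \<open>p\<close>. As \<open>S\<close> lies in no proper subvariety of \<open>U\<close>, it vanishes on \<open>U\<close>.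

  Real-analytic functions on a Euclidean space \<open>E\<close> are handled as restrictions to \<open>E \<times> {0}\<close> of
  holomorphic functions on the complexification \<open>E \<times> E\<close>, in which \<open>(x, y)\<close> stands for \<open>x + \<i> y\<close>.
\<close>

section \<open>Complexification and holomorphic functions of several variables\<close>

text \<open>Analyticity replaces constant rank: a field of the Lie algebra that stays orthogonal to
  the space \<open>W\<close> of values at \<open>p\<close> vanishes at \<open>p\<close> together
  with all its derivatives along the flow, hence on the whole leaf. Smooth fields do not have this
  property. The comparison with the orbit needs a leaf that is analytic in the sense of convergent
  power series, because minimality of the orbit ranges over such submanifolds only. Composition,
  differentiation and the solution of differential equations are awkward for multi-index series but
  easy for functions with complex-linear derivative; series enter only where the two notions are
  compared. The base point may be a zero of \<open>g\<close>. Constancy of \<open>f / g\<close> is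
  therefore a Wronskian condition, and the constant is read off at some point of the leaf where
  \<open>g\<close> is nonzero; if there is none, then \<open>f\<close> and \<open>g\<close> vanish
  on \<open>U\<close>.\<close>

definition cscale :: "complex \<Rightarrow> 'a::real_vector \<times> 'a \<Rightarrow> 'a \<times> 'a" where
  "cscale c v = (Re c *\<^sub>R fst v - Im c *\<^sub>R snd v, Im c *\<^sub>R fst v + Re c *\<^sub>R snd v)"

text \<open>Holomorphy as real differentiability with a derivative that commutes with
  \<open>cscale\<close>. Sums, products and compositions then follow from the rules for real
  derivatives; series are derived later from Cauchy estimates.\<close>

definition chol_on :: "('a::euclidean_space \<times> 'a \<Rightarrow> complex) \<Rightarrow> ('a \<times> 'a) set \<Rightarrow> bool" where
  "chol_on F U \<longleftrightarrow> (\<forall>z\<in>U. \<exists>D. (F has_derivative D) (at z) \<and> (\<forall>c v. D (cscale c v) = c * D v))"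

lemma cscale_simps [simp]:
  "cscale 0 v = 0" "cscale 1 v = v" "cscale c 0 = 0"
  "cscale (of_real r) v = r *\<^sub>R v" "cscale (-c) v = - cscale c v"
  by (auto simp: cscale_def prod_eq_iff)

lemma cscale_cscale: "cscale a (cscale b v) = cscale (a * b) v"
  by (auto simp: cscale_def prod_eq_iff algebra_simps)

lemma cscale_add_left: "cscale (a + b) v = cscale a v + cscale b v"
  and cscale_diff_left: "cscale (a - b) v = cscale a v - cscale b v"
  and cscale_add_right: "cscale a (v + w) = cscale a v + cscale a w"
  and cscale_diff_right: "cscale a (v - w) = cscale a v - cscale a w"
  by (auto simp: cscale_def prod_eq_iff algebra_simps)

lemma cscale_scaleR_left: "cscale (r *\<^sub>R c) v = r *\<^sub>R cscale c v"
  and cscale_scaleR_right: "cscale c (r *\<^sub>R v) = r *\<^sub>R cscale c v"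
  by (auto simp: cscale_def prod_eq_iff algebra_simps)

lemma norm_cscale: "norm (cscale c v) = cmod c * norm (v :: 'a::euclidean_space \<times> 'a)"
proof -
  have "(norm (a *\<^sub>R x - b *\<^sub>R y))\<^sup>2 + (norm (b *\<^sub>R x + a *\<^sub>R y))\<^sup>2
      = (a\<^sup>2 + b\<^sup>2) * ((norm x)\<^sup>2 + (norm y)\<^sup>2)" for a b :: real and x y :: 'a
    unfolding power2_norm_eq_inner
    by (simp add: inner_left_distrib inner_right_distrib inner_diff_left
        inner_diff_right inner_commute[of y x]) (simp add: algebra_simps power2_eq_square)
  then have "(norm (cscale c v))\<^sup>2 = (cmod c * norm v)\<^sup>2"
    by (simp add: cscale_def norm_Pair norm_prod_def power_mult_distrib cmod_power2)
  then show ?thesis by simp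
qed

lemma bounded_linear_cscale_left: "bounded_linear (\<lambda>c. cscale c (v :: 'a::euclidean_space \<times> 'a))"
  by (rule bounded_linear_intro[where K = "norm v"])
    (simp_all add: cscale_add_left norm_cscale mult.commute cscale_scaleR_left)

lemma bounded_linear_cscale_right: "bounded_linear (\<lambda>v. cscale c (v :: 'a::euclidean_space \<times> 'a))"
  by (rule bounded_linear_intro[where K = "cmod c"])
    (simp_all add: cscale_add_right norm_cscale mult.commute cscale_scaleR_right)

lemma chol_onD:
  assumes "chol_on F U" "z \<in> U"
  shows "(F has_derivative frechet_derivative F (at z)) (at z)"
    and "frechet_derivative F (at z) (cscale c v) = c * frechet_derivative F (at z) v"
  using assms unfolding chol_on_def by (metis frechet_derivative_at)+

lemma chol_on_subset: "chol_on F U \<Longrightarrow> V \<subseteq> U \<Longrightarrow> chol_on F V"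
  unfolding chol_on_def by blast

lemma chol_on_continuous: "chol_on F U \<Longrightarrow> continuous_on U F"
  by (meson chol_onD(1) continuous_at_imp_continuous_on has_derivative_continuous)

lemma chol_on_cong:
  assumes "open U" "\<And>z. z \<in> U \<Longrightarrow> F z = G z" "chol_on F U"
  shows "chol_on G U"
  unfolding chol_on_def
proof
  fix z assume z: "z \<in> U"
  obtain D where D: "(F has_derivative D) (at z)" "\<forall>c v. D (cscale c v) = c * D v"
    using assms(3) z unfolding chol_on_def by blast
  then have "(G has_derivative D) (at z)"
    using has_derivative_transform_within_open[OF D(1) assms(1) z] assms(2) by auto
  with D(2) show "\<exists>D. (G has_derivative D) (at z) \<and> (\<forall>c v. D (cscale c v) = c * D v)" by blast
qed

lemma chol_on_const [intro]: "chol_on (\<lambda>z. c) U"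
  unfolding chol_on_def by (auto intro!: exI[of _ "\<lambda>_. 0"])

lemma chol_on_add [intro]: "chol_on F U \<Longrightarrow> chol_on G U \<Longrightarrow> chol_on (\<lambda>z. F z + G z) U"
  unfolding chol_on_def
proof
  fix z assume "z \<in> U" and H: "\<forall>z\<in>U. \<exists>D. (F has_derivative D) (at z) \<and> (\<forall>c v. D (cscale c v) = c * D v)"
    "\<forall>z\<in>U. \<exists>D. (G has_derivative D) (at z) \<and> (\<forall>c v. D (cscale c v) = c * D v)"
  then obtain D E where "(F has_derivative D) (at z)" "\<forall>c v. D (cscale c v) = c * D v"
    "(G has_derivative E) (at z)" "\<forall>c v. E (cscale c v) = c * E v" by meson
  then show "\<exists>D. ((\<lambda>z. F z + G z) has_derivative D) (at z) \<and> (\<forall>c v. D (cscale c v) = c * D v)"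
    by (intro exI[of _ "\<lambda>v. D v + E v"]) (auto intro!: derivative_eq_intros simp: algebra_simps)
qed

lemma chol_on_mult [intro]: "chol_on F U \<Longrightarrow> chol_on G U \<Longrightarrow> chol_on (\<lambda>z. F z * G z) U"
  unfolding chol_on_def
proof
  fix z assume "z \<in> U" and H: "\<forall>z\<in>U. \<exists>D. (F has_derivative D) (at z) \<and> (\<forall>c v. D (cscale c v) = c * D v)"
    "\<forall>z\<in>U. \<exists>D. (G has_derivative D) (at z) \<and> (\<forall>c v. D (cscale c v) = c * D v)"
  then obtain D E where "(F has_derivative D) (at z)" "\<forall>c v. D (cscale c v) = c * D v"
    "(G has_derivative E) (at z)" "\<forall>c v. E (cscale c v) = c * E v" by meson
  then show "\<exists>D. ((\<lambda>z. F z * G z) has_derivative D) (at z) \<and> (\<forall>c v. D (cscale c v) = c * D v)"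
    by (intro exI[of _ "\<lambda>v. F z * E v + D v * G z"]) (auto intro!: derivative_eq_intros simp: algebra_simps)
qed

lemma chol_on_inverse [intro]:
  assumes "chol_on F U" "\<And>z. z \<in> U \<Longrightarrow> F z \<noteq> 0"
  shows "chol_on (\<lambda>z. inverse (F z)) U"
  unfolding chol_on_def
proof
  fix z assume z: "z \<in> U"
  with assms obtain D where D: "(F has_derivative D) (at z)" "\<forall>c v. D (cscale c v) = c * D v"
    unfolding chol_on_def by meson
  then show "\<exists>D. ((\<lambda>z. inverse (F z)) has_derivative D) (at z) \<and> (\<forall>c v. D (cscale c v) = c * D v)"
    by (intro exI[of _ "\<lambda>v. - (inverse (F z) * D v * inverse (F z))"])
      (auto intro!: derivative_eq_intros assms(2) z simp: algebra_simps)
qed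

lemma chol_on_sum [intro]:
  "(\<And>i. i \<in> A \<Longrightarrow> chol_on (F i) U) \<Longrightarrow> chol_on (\<lambda>z. \<Sum>i\<in>A. F i z) U"
  by (induction A rule: infinite_finite_induct) auto

lemma chol_on_prod [intro]:
  "(\<And>i. i \<in> A \<Longrightarrow> chol_on (F i) U) \<Longrightarrow> chol_on (\<lambda>z. \<Prod>i\<in>A. F i z) U"
  by (induction A rule: infinite_finite_induct) auto

lemma chol_on_power [intro]: "chol_on F U \<Longrightarrow> chol_on (\<lambda>z. F z ^ n) U"
  by (induction n) auto

definition ccoord :: "'a::euclidean_space \<Rightarrow> 'a \<times> 'a \<Rightarrow> complex" where
  "ccoord b v = Complex (fst v \<bullet> b) (snd v \<bullet> b)"

lemma bounded_linear_ccoord: "bounded_linear (ccoord b)"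
  unfolding ccoord_def Complex_eq
  by (intro bounded_linear_intros bounded_linear_const_mult
    bounded_linear_compose[OF bounded_linear_of_real])

lemma ccoord_cscale: "ccoord b (cscale c v) = c * ccoord b v"
  by (simp add: ccoord_def cscale_def complex_eq_iff inner_left_distrib inner_diff_left)

lemma ccoord_real [simp]: "ccoord b (x, 0) = of_real (x \<bullet> b)"
  by (simp add: ccoord_def complex_eq_iff)

lemma chol_on_ccoord [intro]: "chol_on (ccoord b) U"
  unfolding chol_on_def
  by (intro ballI exI[of _ "ccoord b"]) (auto simp: ccoord_cscale intro: bounded_linear.has_derivative bounded_linear_ccoord bounded_linear_imp_has_derivative)

text \<open>Restriction to the complex line through \<open>z\<close> in direction \<open>v\<close>.
  The estimates in several variables below are one-variable Cauchy theory on such lines.\<close>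

lemma chol_line:
  assumes "chol_on F U" "z + cscale c v \<in> U"
  shows "((\<lambda>c. F (z + cscale c v)) has_field_derivative frechet_derivative F (at (z + cscale c v)) v) (at c)"
proof -
  have "((\<lambda>c. z + cscale c v) has_derivative (\<lambda>h. cscale h v)) (at c)"
    by (auto intro!: derivative_eq_intros bounded_linear.has_derivative[OF bounded_linear_cscale_left])
  from has_derivative_compose[OF this chol_onD(1)[OF assms]]
  have *: "((\<lambda>c. F (z + cscale c v)) has_derivative
      (\<lambda>h. h * frechet_derivative F (at (z + cscale c v)) v)) (at c)"
    by (simp add: chol_onD(2)[OF assms])
  show ?thesis
    unfolding has_field_derivative_def
    by (rule has_derivative_eq_rhs[OF *]) (simp add: fun_eq_iff)
qed

lemma chol_line_holomorphic:
  assumes "chol_on F U" "\<And>c. c \<in> S \<Longrightarrow> z + cscale c v \<in> U" "open S"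
  shows "(\<lambda>c. F (z + cscale c v)) holomorphic_on S"
  unfolding holomorphic_on_open[OF assms(3)]
  by (intro ballI exI, rule chol_line[OF assms(1,2)])

text \<open>Cauchy inequality on the complex line through \<open>z\<close>. The circle has half of
  the admissible radius, so that its closed disc stays inside the open ball; this is the factor
  2.\<close>

lemma chol_deriv_bound:
  assumes F: "chol_on F (ball z R)" and R: "R > 0" and B: "\<And>w. w \<in> ball z R \<Longrightarrow> cmod (F w) \<le> B"
  shows "cmod (frechet_derivative F (at z) v) \<le> 2 * B * norm v / R"
proof (cases "v = 0")
  case True
  then show ?thesis
    using chol_onD(2)[OF F, of z 0 v] R by simp
next
  case False
  define f where "f c = F (z + cscale c v)" for c
  define r where "r = R / (2 * norm v)"
  have r: "r > 0" using R False by (simp add: r_def)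
  have sub: "z + cscale c v \<in> ball z R" if "c \<in> ball 0 (2 * r)" for c
    using that False R by (simp add: dist_norm norm_cscale r_def field_simps)
  have hol: "f holomorphic_on ball 0 (2 * r)"
    unfolding f_def by (rule chol_line_holomorphic[OF F sub]) auto
  have "norm ((deriv ^^ 1) f 0) \<le> fact 1 * B / r ^ 1"
  proof (rule Cauchy_inequality)
    show "f holomorphic_on ball 0 r" by (rule holomorphic_on_subset[OF hol]) (use r in auto)
    show "continuous_on (cball 0 r) f"
      by (rule continuous_on_subset[OF holomorphic_on_imp_continuous_on[OF hol]]) (use r in auto)
    show "cmod (f x) \<le> B" if "cmod (0 - x) = r" for x
      unfolding f_def by (rule B, rule sub) (use that r in auto)
  qed (use r in auto)
  moreover have "deriv f 0 = frechet_derivative F (at z) v"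
    using chol_line[OF F, of z 0 v] R by (auto intro!: DERIV_imp_deriv simp: f_def[abs_def])
  ultimately show ?thesis by (simp add: r_def field_simps)
qed

text \<open>One-variable Taylor expansion of order 1 from 0 to 1 on the line in direction
  \<open>h\<close>. The constant depends only on \<open>B\<close> and \<open>R\<close>, and this
  uniformity is what limits and integrals use later.\<close>

lemma chol_taylor_bound:
  assumes F: "chol_on F (ball z R)" and R: "R > 0" and B: "\<And>w. w \<in> ball z R \<Longrightarrow> cmod (F w) \<le> B"
    and h: "norm h < R / 2"
  shows "cmod (F (z + h) - F z - frechet_derivative F (at z) h) \<le> 8 * B / R\<^sup>2 * (norm h)\<^sup>2"
proof (cases "h = 0")
  case True
  then show ?thesis
    using chol_onD(2)[OF F, of z 0 h] R by simp
next
  case False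
  define f where "f c = F (z + cscale c h)" for c
  \<comment> \<open>\<open>norm h < R / 2\<close> gives \<open>r > 1\<close>, so circles of radius
    \<open>r\<close> about points of the unit disc stay in the disc of radius \<open>2 * r\<close>.
    Cauchy there bounds the second derivative by \<open>2 * B / r ^ 2\<close>, which is the constant
    of the claim times \<open>(norm h)\<^sup>2\<close>.\<close>
  define r where "r = R / (2 * norm h)"
  have r: "r > 1" using h False by (simp add: r_def field_simps)
  have sub: "z + cscale c h \<in> ball z R" if "c \<in> ball 0 (2 * r)" for c
    using that False R by (simp add: dist_norm norm_cscale r_def field_simps)
  have hol: "f holomorphic_on ball 0 (2 * r)"
    unfolding f_def by (rule chol_line_holomorphic[OF F sub]) auto
  have bd: "cmod ((deriv ^^ 2) f x) \<le> 2 * B / r ^ 2" if x: "x \<in> cball 0 1" for x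
  proof -
    have "norm ((deriv ^^ 2) f x) \<le> fact 2 * B / r ^ 2"
    proof (rule Cauchy_inequality)
      have s: "cball x r \<subseteq> ball 0 (2 * r)"
      proof
        fix y assume "y \<in> cball x r"
        then have "norm y \<le> norm x + r"
          using norm_triangle_ineq[of x "y - x"] by (simp add: dist_norm norm_minus_commute)
        then show "y \<in> ball 0 (2 * r)" using x r by simp
      qed
      show "f holomorphic_on ball x r"
        by (rule holomorphic_on_subset[OF hol]) (use s in auto)
      show "continuous_on (cball x r) f"
        by (rule continuous_on_subset[OF holomorphic_on_imp_continuous_on[OF hol]]) (use s in auto)
      show "cmod (f y) \<le> B" if "cmod (x - y) = r" for y
        unfolding f_def by (rule B, rule sub) (use that s in \<open>auto simp: dist_norm\<close>)
    qed (use r in auto)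
    then show ?thesis by simp
  qed
  have "cmod ((\<lambda>i. (deriv ^^ i) f) 0 1 - (\<Sum>i\<le>1. (\<lambda>i. (deriv ^^ i) f) i 0 * (1-0) ^ i / (fact i)))
      \<le> (2 * B / r ^ 2) * cmod(1 - 0)^(Suc 1) / fact 1"
  proof (rule complex_Taylor[where S = "cball 0 1"])
    show "((deriv ^^ i) f has_field_derivative (deriv ^^ Suc i) f x) (at x within cball 0 1)"
      if "x \<in> cball 0 1" for i x
    proof -
      have "x \<in> ball 0 (2 * r)" using that r by auto
      moreover have "(deriv ^^ i) f holomorphic_on ball 0 (2 * r)"
        by (rule holomorphic_higher_deriv[OF hol]) auto
      ultimately show ?thesis
        using has_field_derivative_at_within holomorphic_derivI[of "(deriv ^^ i) f" "ball 0 (2*r)" x]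
        by auto
    qed
    show "cmod ((deriv ^^ Suc 1) f x) \<le> 2 * B / r\<^sup>2" if "x \<in> cball 0 1" for x
      using bd[OF that] by (simp add: numeral_2_eq_2)
  qed auto
  moreover have "deriv f 0 = frechet_derivative F (at z) h"
    using chol_line[OF F, of z 0 h] R by (auto intro!: DERIV_imp_deriv simp: f_def[abs_def])
  ultimately show ?thesis using False R
    by (simp add: f_def r_def field_simps power2_eq_square diff_diff_eq)
qed

text \<open>A remainder that is merely small compared with \<open>norm h\<close> need not survive a
  pointwise limit or an integral; a bound \<open>C * (norm h)\<^sup>2\<close> with fixed
  \<open>C\<close> does.\<close>

lemma has_derivativeI_quadratic:
  fixes G :: "'a::real_normed_vector \<Rightarrow> 'b::real_normed_vector"
  assumes "bounded_linear D" "\<delta> > 0"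
    and le: "\<And>h. norm h < \<delta> \<Longrightarrow> norm (G (z + h) - G z - D h) \<le> C * (norm h)\<^sup>2"
  shows "(G has_derivative D) (at z)"
  unfolding has_derivative_at
proof (intro conjI assms(1))
  have lim: "(\<lambda>h. C * norm h) \<midarrow>(0 :: 'a)\<rightarrow> 0"
    by (rule tendsto_mult_right_zero[OF tendsto_norm_zero[OF tendsto_ident_at]])
  have "\<forall>\<^sub>F h in at (0 :: 'a). dist h 0 < \<delta>"
    using eventually_at_ball[of \<delta> "0::'a" UNIV] assms(2) by simp
  then have "\<forall>\<^sub>F h in at 0. norm (norm (G (z + h) - G z - D h) / norm h) \<le> C * norm h"
  proof eventually_elim
    case (elim h)
    then show ?case
      using le[of h] by (cases "h = 0") (auto simp: dist_norm field_simps power2_eq_square)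
  qed
  then show "(\<lambda>h. norm (G (z + h) - G z - D h) / norm h) \<midarrow>0\<rightarrow> 0"
    by (rule Lim_null_comparison[OF _ lim])
qed

text \<open>The quadratic Taylor bound is uniform along the filter and survives the limit.\<close>
proposition chol_uniform_limit:
  assumes U: "open U" and F: "\<forall>\<^sub>F n in Fil. chol_on (F n) U"
    and lim: "\<And>K. compact K \<Longrightarrow> K \<subseteq> U \<Longrightarrow> uniform_limit K F G Fil" and nt: "Fil \<noteq> bot"
  shows "chol_on G U"
    and "z \<in> U \<Longrightarrow> ((\<lambda>n. frechet_derivative (F n) (at z) v) \<longlongrightarrow> frechet_derivative G (at z) v) Fil"
proof -
  have *: "\<exists>D. (G has_derivative D) (at z) \<and> (\<forall>c v. D (cscale c v) = c * D v) \<and>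
      (\<forall>v. ((\<lambda>n. frechet_derivative (F n) (at z) v) \<longlongrightarrow> D v) Fil)" if z: "z \<in> U" for z
  proof -
    obtain R where R: "R > 0" and KU: "cball z R \<subseteq> U" using open_contains_cball[of U] U z by blast
    have ulim: "uniform_limit (cball z R) F G Fil" by (rule lim[OF _ KU]) auto
    \<comment> \<open>One member \<open>F n0\<close> of the family is bounded on the compact ball;
      all members within 1 of \<open>G\<close> stay within 2 of it.\<close>
    have bd: "\<exists>B. \<forall>\<^sub>F n in Fil. \<forall>w\<in>cball z R. cmod (F n w) \<le> B"
    proof -
      have 1: "\<forall>\<^sub>F n in Fil. \<forall>w\<in>cball z R. dist (F n w) (G w) < 1"
        using ulim by (auto simp: uniform_limit_iff)
      then obtain n0 where n0: "\<forall>w\<in>cball z R. dist (F n0 w) (G w) < 1" "chol_on (F n0) U"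
        using eventually_happens[OF eventually_conj[OF 1 F]] nt by auto
      have "compact (F n0 ` cball z R)"
        by (intro compact_continuous_image continuous_on_subset[OF chol_on_continuous[OF n0(2)] KU]) auto
      then obtain B0 where B0: "\<forall>w\<in>cball z R. cmod (F n0 w) \<le> B0"
        using compact_imp_bounded bounded_iff by (metis imageI)
      show ?thesis
      proof (intro exI[of _ "B0 + 2"], rule eventually_mono[OF 1], intro ballI)
        fix n w assume w: "w \<in> cball z R" and n: "\<forall>w\<in>cball z R. dist (F n w) (G w) < 1"
        have "dist (F n w) (F n0 w) < 2"
          using n n0(1) w dist_triangle[of "F n w" "F n0 w" "G w"] by (fastforce simp: dist_commute)
        then show "cmod (F n w) \<le> B0 + 2"
          using B0 w norm_triangle_sub[of "F n w" "F n0 w"] by (fastforce simp: dist_norm)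
      qed
    qed
    then obtain B where B: "\<forall>\<^sub>F n in Fil. \<forall>w\<in>cball z R. cmod (F n w) \<le> B" by blast
    \<comment> \<open>On each complex line the one-variable theorem on uniform limits gives
      convergence of the directional derivatives; the limits are assembled into the derivative
      \<open>D\<close> of \<open>G\<close>.\<close>
    have "\<exists>d. ((\<lambda>n. frechet_derivative (F n) (at z) v) \<longlongrightarrow> d) Fil" for v
    proof -
      define r where "r = R / (norm v + 1)"
      have r: "r > 0" using R by (auto simp: r_def intro!: divide_pos_pos add_nonneg_pos)
      have "norm v + 1 > 0" by (simp add: add_nonneg_pos)
      then have "r * norm v \<le> R" using R by (simp add: r_def pos_divide_le_eq)
      then have sub: "z + cscale c v \<in> cball z R" if "c \<in> cball 0 r" for c
        using that mult_right_mono[of "cmod c" r "norm v"] by (auto simp: dist_norm norm_cscale)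
      obtain g' where g': "\<And>w. w \<in> ball 0 r \<Longrightarrow>
          ((\<lambda>c. G (z + cscale c v)) has_field_derivative (g' w)) (at w) \<and>
          ((\<lambda>n. frechet_derivative (F n) (at (z + cscale w v)) v) \<longlongrightarrow> g' w) Fil"
      proof (rule has_complex_derivative_uniform_limit[where z = 0 and r = r and F = Fil
          and f = "\<lambda>n c. F n (z + cscale c v)" and f' = "\<lambda>n w. frechet_derivative (F n) (at (z + cscale w v)) v"
          and g = "\<lambda>c. G (z + cscale c v)"])
        show "\<forall>\<^sub>F n in Fil. continuous_on (cball 0 r) (\<lambda>c. F n (z + cscale c v)) \<and>
         (\<forall>w\<in>ball 0 r. ((\<lambda>c. F n (z + cscale c v)) has_field_derivative
             frechet_derivative (F n) (at (z + cscale w v)) v) (at w))"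
        proof (rule eventually_mono[OF F], intro conjI ballI)
          fix n assume n: "chol_on (F n) U"
          show "continuous_on (cball 0 r) (\<lambda>c. F n (z + cscale c v))"
            by (intro continuous_on_compose2[OF chol_on_continuous[OF n]] continuous_intros
                linear_continuous_on bounded_linear_cscale_left) (use sub KU in blast)
          show "((\<lambda>c. F n (z + cscale c v)) has_field_derivative
             frechet_derivative (F n) (at (z + cscale w v)) v) (at w)" if "w \<in> ball 0 r" for w
            by (rule chol_line[OF n]) (use sub KU that in auto)
        qed
        show "uniform_limit (cball 0 r) (\<lambda>n c. F n (z + cscale c v)) (\<lambda>c. G (z + cscale c v)) Fil"
          using ulim sub unfolding uniform_limit_iff by (auto elim!: eventually_mono)
      qed (use r nt in auto)
      show ?thesis using g'[of 0] r by (intro exI[of _ "g' 0"]) simp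
    qed
    then obtain D where D: "\<And>v. ((\<lambda>n. frechet_derivative (F n) (at z) v) \<longlongrightarrow> D v) Fil" by metis
    have lin: "\<forall>\<^sub>F n in Fil. linear (frechet_derivative (F n) (at z))"
      using F by eventually_elim
        (use z chol_onD(1) has_derivative_bounded_linear bounded_linear.linear in blast)
    have add: "D (v + w) = D v + D w" for v w
    proof (rule tendsto_unique[OF nt D])
      show "((\<lambda>n. frechet_derivative (F n) (at z) (v + w)) \<longlongrightarrow> D v + D w) Fil"
        by (rule Lim_transform_eventually[OF tendsto_add[OF D D]])
          (use lin in eventually_elim, simp add: linear_add)
    qed
    have sc: "D (cscale c v) = c * D v" for c v
    proof (rule tendsto_unique[OF nt D])
      show "((\<lambda>n. frechet_derivative (F n) (at z) (cscale c v)) \<longlongrightarrow> c * D v) Fil"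
        by (rule Lim_transform_eventually[OF tendsto_mult_left[OF D]])
          (use F in eventually_elim, use z in \<open>simp add: chol_onD(2)\<close>)
    qed
    have bdl: "bounded_linear D"
    proof (rule bounded_linear_intro[where K = "2 * B / R"])
      show "D (r *\<^sub>R x) = r *\<^sub>R D x" for r x
        using sc[of "of_real r" x] by (simp add: scaleR_conv_of_real)
      show "cmod (D x) \<le> norm x * (2 * B / R)" for x
      proof (rule tendsto_upperbound[OF tendsto_norm[OF D] _ nt])
        show "\<forall>\<^sub>F n in Fil. cmod (frechet_derivative (F n) (at z) x) \<le> norm x * (2 * B / R)"
          using F B
        proof eventually_elim
          case (elim n)
          then have "cmod (frechet_derivative (F n) (at z) x) \<le> 2 * B * norm x / R"
            by (intro chol_deriv_bound R chol_on_subset[OF elim(1)]) (use KU in auto)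
          then show ?case by (simp add: mult_ac)
        qed
      qed
    qed (rule add)
    have "(G has_derivative D) (at z)"
    proof (rule has_derivativeI_quadratic[OF bdl, of "R / 2"])
      fix h :: "'a \<times> 'a" assume h: "norm h < R / 2"
      have pt: "((\<lambda>n. F n w) \<longlongrightarrow> G w) Fil" if "w \<in> cball z R" for w
        by (rule tendsto_uniform_limitI[OF ulim that])
      have "((\<lambda>n. cmod (F n (z + h) - F n z - frechet_derivative (F n) (at z) h)) \<longlongrightarrow>
          cmod (G (z + h) - G z - D h)) Fil"
        by (intro tendsto_intros pt D) (use h R in \<open>auto simp: dist_norm\<close>)
      then show "cmod (G (z + h) - G z - D h) \<le> 8 * B / R\<^sup>2 * (norm h)\<^sup>2"
      proof (rule tendsto_upperbound[OF _ _ nt])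
        show "\<forall>\<^sub>F n in Fil. cmod (F n (z + h) - F n z - frechet_derivative (F n) (at z) h)
            \<le> 8 * B / R\<^sup>2 * (norm h)\<^sup>2"
          using F B
        proof eventually_elim
          case (elim n)
          show ?case
            by (rule chol_taylor_bound[OF chol_on_subset[OF elim(1)] R _ h]) (use KU elim(2) in auto)
        qed
      qed
    qed (use R in auto)
    with sc D show ?thesis by blast
  qed
  then show "chol_on G U" unfolding chol_on_def by blast
  show "z \<in> U \<Longrightarrow> ((\<lambda>n. frechet_derivative (F n) (at z) v) \<longlongrightarrow> frechet_derivative G (at z) v) Fil"
    using * frechet_derivative_at by metis
qed

lemma chol_on_shift: "chol_on F U \<Longrightarrow> chol_on (\<lambda>z. F (z + a)) {z. z + a \<in> U}"
  unfolding chol_on_def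
proof
  fix z assume z: "z \<in> {z. z + a \<in> U}" and H: "\<forall>z\<in>U. \<exists>D. (F has_derivative D) (at z) \<and> (\<forall>c v. D (cscale c v) = c * D v)"
  then obtain D where D: "(F has_derivative D) (at (z + a))" "\<forall>c v. D (cscale c v) = c * D v" by blast
  have "((\<lambda>z. z + a) has_derivative (\<lambda>h. h)) (at z)" by (auto intro!: derivative_eq_intros)
  from has_derivative_compose[OF this D(1)] D(2)
  show "\<exists>D. ((\<lambda>z. F (z + a)) has_derivative D) (at z) \<and> (\<forall>c v. D (cscale c v) = c * D v)" by auto
qed

text \<open>The difference quotients in direction \<open>v\<close> are holomorphic and, by the
  uniform Taylor bound, converge uniformly near \<open>z\<close> to the derivative.
  \<open>chol_uniform_limit\<close> makes the limit holomorphic and also passes to derivatives: the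
  derivative of a quotient along \<open>w\<close> is the difference quotient of the derivative along
  \<open>w\<close>, which yields the symmetry of the second derivative.\<close>

proposition
  assumes U: "open U" and F: "chol_on F U"
  shows chol_on_frechet_derivative: "chol_on (\<lambda>z. frechet_derivative F (at z) v) U"
    and frechet_derivative_chol_commute: "z \<in> U \<Longrightarrow>
      frechet_derivative (\<lambda>z. frechet_derivative F (at z) v) (at z) w =
      frechet_derivative (\<lambda>z. frechet_derivative F (at z) w) (at z) v"
proof -
  have *: "\<exists>V. open V \<and> z \<in> V \<and> V \<subseteq> U \<and> chol_on (\<lambda>z. frechet_derivative F (at z) v) V \<and>
      (\<forall>w. ((\<lambda>t. (frechet_derivative F (at (z + t *\<^sub>R v)) w - frechet_derivative F (at z) w) /\<^sub>R t)
      \<longlongrightarrow> frechet_derivative (\<lambda>z. frechet_derivative F (at z) v) (at z) w) (at_right 0))"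
    if z: "z \<in> U" for z v
  proof -
    obtain R' where R': "R' > 0" and KU: "cball z R' \<subseteq> U" using open_contains_cball[of U] U z by blast
    \<comment> \<open>Half the radius, so that the Taylor balls about all points of
      \<open>ball z R\<close> lie in the compact ball where \<open>F\<close> is bounded.\<close>
    define R where "R = R' / 2"
    have R: "R > 0" "R + R = R'" using R' by (auto simp: R_def)
    have sub: "ball x R \<subseteq> cball z R'" if "x \<in> ball z R" for x
    proof
      fix y assume "y \<in> ball x R"
      then show "y \<in> cball z R'" using that dist_triangle[of z y x] R by auto
    qed
    have "compact (F ` cball z R')"
      by (intro compact_continuous_image continuous_on_subset[OF chol_on_continuous[OF F] KU]) auto
    then obtain B where B: "\<forall>w\<in>cball z R'. cmod (F w) \<le> B"
      using compact_imp_bounded bounded_iff by (metis imageI)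
    define G where "G t w = (F (w + t *\<^sub>R v) - F w) /\<^sub>R t" for t w
    define \<delta> where "\<delta> = R / (2 * (norm v + 1))"
    have nv: "norm v + 1 > 0" by (simp add: add_nonneg_pos)
    have \<delta>: "\<delta> > 0" using R nv by (simp add: \<delta>_def)
    have small: "norm (t *\<^sub>R v) < R / 2" if "0 < t" "t < \<delta>" for t
    proof -
      have "norm (t *\<^sub>R v) \<le> t * (norm v + 1)" using that by simp
      also have "\<dots> < \<delta> * (norm v + 1)" using that nv by (intro mult_strict_right_mono) auto
      also have "\<dots> = R / 2" using nv by (simp add: \<delta>_def field_simps)
      finally show ?thesis .
    qed
    have ev: "\<forall>\<^sub>F t in at_right 0. 0 < t \<and> t < \<delta>"
      using \<delta> by (auto simp: eventually_at_right_field)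
    have cholG: "chol_on (G t) (ball z R)" if "0 < t" "t < \<delta>" for t
    proof -
      have "x + t *\<^sub>R v \<in> U" if "x \<in> ball z R" for x
      proof -
        have "x + t *\<^sub>R v \<in> ball x R"
          using small[OF \<open>0 < t\<close> \<open>t < \<delta>\<close>] R by (simp add: dist_norm del: norm_scaleR)
        then show ?thesis using sub[OF that] KU by blast
      qed
      then have "chol_on (\<lambda>w. F (w + t *\<^sub>R v)) (ball z R)"
        by (intro chol_on_subset[OF chol_on_shift[OF F]]) auto
      moreover have "chol_on F (ball z R)"
        by (rule chol_on_subset[OF F]) (use KU R in auto)
      ultimately have "chol_on (\<lambda>w. (of_real (inverse t)) * (F (w + t *\<^sub>R v) + (-1) * F w)) (ball z R)"
        by (intro chol_on_mult chol_on_add chol_on_const)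
      then show ?thesis unfolding G_def by (simp add: scaleR_conv_of_real)
    qed
    have ul: "uniform_limit (ball z R) G (\<lambda>z. frechet_derivative F (at z) v) (at_right 0)"
    proof (rule uniform_limitI)
      fix e :: real assume e: "e > 0"
      define C where "C = 8 * B / R\<^sup>2 * (norm v)\<^sup>2"
      have "((\<lambda>t. C * t) \<longlongrightarrow> C * 0) (at_right 0)" by (intro tendsto_intros)
      then have "\<forall>\<^sub>F t in at_right 0. C * t < e" using e by (auto dest: order_tendstoD)
      with ev show "\<forall>\<^sub>F t in at_right 0. \<forall>x\<in>ball z R. dist (G t x) (frechet_derivative F (at x) v) < e"
      proof (eventually_elim, intro ballI)
        fix t x assume t: "0 < t \<and> t < \<delta>" "C * t < e" and x: "x \<in> ball z R"
        have cx: "chol_on F (ball x R)" by (rule chol_on_subset[OF F]) (use sub[OF x] KU in auto)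
        have 1: "cmod (F (x + t *\<^sub>R v) - F x - frechet_derivative F (at x) (t *\<^sub>R v)) \<le> 8 * B / R\<^sup>2 * (norm (t *\<^sub>R v))\<^sup>2"
          by (rule chol_taylor_bound[OF cx R(1)]) (use B sub[OF x] small t in auto)
        have lin: "frechet_derivative F (at x) (t *\<^sub>R v) = of_real t * frechet_derivative F (at x) v"
          using chol_onD(2)[OF cx, of x "of_real t" v] R by simp
        have "G t x - frechet_derivative F (at x) v
            = inverse t *\<^sub>R (F (x + t *\<^sub>R v) - F x - frechet_derivative F (at x) (t *\<^sub>R v))"
          unfolding lin G_def using t by (simp add: scaleR_conv_of_real algebra_simps)
        moreover have "norm (inverse t *\<^sub>R X) \<le> inverse t * Y" if "norm X \<le> Y" for X :: complex and Y
          using t that by (simp add: mult_left_mono)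
        ultimately have "dist (G t x) (frechet_derivative F (at x) v) \<le> inverse t * (8 * B / R\<^sup>2 * (norm (t *\<^sub>R v))\<^sup>2)"
          using 1 unfolding dist_norm by metis
        also have "\<dots> = C * t" using t by (simp add: C_def power2_eq_square field_simps)
        finally show "dist (G t x) (frechet_derivative F (at x) v) < e" using t by simp
      qed
    qed
    have ev': "\<forall>\<^sub>F t in at_right 0. chol_on (G t) (ball z R)"
      using ev by eventually_elim (use cholG in auto)
    have zz: "z \<in> ball z R" using R by simp
    note lims = chol_uniform_limit[OF open_ball ev' uniform_limit_on_subset[OF ul] trivial_limit_at_right_real]
    show ?thesis
    proof (intro exI[of _ "ball z R"] conjI allI)
      show "ball z R \<subseteq> U" using KU R by auto
      show "chol_on (\<lambda>z. frechet_derivative F (at z) v) (ball z R)" by (rule lims(1))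
      fix w
      show "((\<lambda>t. (frechet_derivative F (at (z + t *\<^sub>R v)) w - frechet_derivative F (at z) w) /\<^sub>R t)
        \<longlongrightarrow> frechet_derivative (\<lambda>z. frechet_derivative F (at z) v) (at z) w) (at_right 0)"
      proof (rule Lim_transform_eventually[OF lims(2)[OF _ zz]])
        show "\<forall>\<^sub>F t in at_right 0. frechet_derivative (G t) (at z) w =
            (frechet_derivative F (at (z + t *\<^sub>R v)) w - frechet_derivative F (at z) w) /\<^sub>R t"
          using ev
        proof eventually_elim
          case (elim t)
          have mem: "z + t *\<^sub>R v \<in> U"
          proof -
            have "z + t *\<^sub>R v \<in> cball z R'"
              using small[of t] elim R by (simp add: dist_norm del: norm_scaleR)
            then show ?thesis using KU by blast
          qed
          have "((\<lambda>z. z + t *\<^sub>R v) has_derivative (\<lambda>h. h)) (at z)" by (auto intro!: derivative_eq_intros)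
          note d1 = has_derivative_compose[OF this chol_onD(1)[OF F mem]]
          have "(G t has_derivative (\<lambda>w. (frechet_derivative F (at (z + t *\<^sub>R v)) w - frechet_derivative F (at z) w) /\<^sub>R t)) (at z)"
            unfolding G_def
            by (intro has_derivative_scaleR_right has_derivative_diff d1 chol_onD(1)[OF F z])
          then show ?case by (simp add: frechet_derivative_at[symmetric])
        qed
      qed auto
    qed (use R in auto)
  qed
  show c: "chol_on (\<lambda>z. frechet_derivative F (at z) v) U" for v
    using * unfolding chol_on_def by (meson subsetD)
  show "frechet_derivative (\<lambda>z. frechet_derivative F (at z) v) (at z) w =
      frechet_derivative (\<lambda>z. frechet_derivative F (at z) w) (at z) v" if z: "z \<in> U"
  proof -
    have 1: "((\<lambda>t. (frechet_derivative F (at (z + t *\<^sub>R v)) w - frechet_derivative F (at z) w) /\<^sub>R t)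
      \<longlongrightarrow> frechet_derivative (\<lambda>z. frechet_derivative F (at z) v) (at z) w) (at_right 0)"
      using *[OF z] by blast
    \<comment> \<open>The same quotient, read on the complex line in direction \<open>v\<close>,
      converges to the mixed derivative in the other order.\<close>
    have "((\<lambda>c. frechet_derivative F (at (z + cscale c v)) w) has_field_derivative
        frechet_derivative (\<lambda>z. frechet_derivative F (at z) w) (at z) v) (at 0)"
      using chol_line[OF c[of w], of z 0 v] z by simp
    then have "((\<lambda>h. (frechet_derivative F (at (z + cscale h v)) w - frechet_derivative F (at z) w) / h)
      \<longlongrightarrow> frechet_derivative (\<lambda>z. frechet_derivative F (at z) w) (at z) v) (at 0)"
      by (simp add: DERIV_def)
    moreover have "filterlim (of_real :: real \<Rightarrow> complex) (at 0) (at_right 0)"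
      unfolding filterlim_at
      by (auto intro!: tendsto_eq_intros simp: eventually_at_right_field intro: exI[of _ 1])
    ultimately have "((\<lambda>t. (frechet_derivative F (at (z + cscale (of_real t) v)) w - frechet_derivative F (at z) w) / of_real t)
      \<longlongrightarrow> frechet_derivative (\<lambda>z. frechet_derivative F (at z) w) (at z) v) (at_right 0)"
      by (rule filterlim_compose)
    then have "((\<lambda>t. (frechet_derivative F (at (z + t *\<^sub>R v)) w - frechet_derivative F (at z) w) /\<^sub>R t)
      \<longlongrightarrow> frechet_derivative (\<lambda>z. frechet_derivative F (at z) w) (at z) v) (at_right 0)"
      by (simp add: scaleR_conv_of_real divide_inverse mult.commute)
    from tendsto_unique[OF _ 1 this] show ?thesis by simp
  qed
qed

section \<open>Power series expansion\<close>

definition vhol_on :: "('a::euclidean_space \<times> 'a \<Rightarrow> 'b::euclidean_space \<times> 'b) \<Rightarrow> ('a \<times> 'a) set \<Rightarrow> bool" where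
  "vhol_on G U \<longleftrightarrow> (\<forall>z\<in>U. \<exists>D. (G has_derivative D) (at z) \<and> (\<forall>c v. D (cscale c v) = cscale c (D v)))"

lemma chol_on_compose:
  assumes "vhol_on G U" "chol_on F V" "\<And>z. z \<in> U \<Longrightarrow> G z \<in> V"
  shows "chol_on (\<lambda>z. F (G z)) U"
  unfolding chol_on_def
proof
  fix z assume z: "z \<in> U"
  obtain D where D: "(G has_derivative D) (at z)" "\<forall>c v. D (cscale c v) = cscale c (D v)"
    using assms(1) z unfolding vhol_on_def by blast
  obtain E where E: "(F has_derivative E) (at (G z))" "\<forall>c v. E (cscale c v) = c * (E v)"
    using assms(2,3) z unfolding chol_on_def by blast
  show "\<exists>D. ((\<lambda>z. F (G z)) has_derivative D) (at z) \<and> (\<forall>c v. D (cscale c v) = c * D v)"     by (intro exI[of _ "\<lambda>x. E (D x)"] conjI allI)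
      (rule has_derivative_compose[OF D(1) E(1)], simp only: D(2) E(2))
qed

lemma vhol_on_linear:
  assumes "bounded_linear L" "\<And>c v. L (cscale c v) = cscale c (L v)"
  shows "vhol_on (\<lambda>z. a + L z) U"
  unfolding vhol_on_def
  by (intro ballI exI[of _ L] conjI) (auto intro!: derivative_eq_intros bounded_linear.has_derivative[OF assms(1)] simp: assms(2))

text \<open>Polydiscs rather than balls, since multi-index series are dominated coordinate by
  coordinate. The centre is a real point.\<close>

definition polydisc :: "'a::euclidean_space \<Rightarrow> real \<Rightarrow> ('a \<times> 'a) set" where
  "polydisc p R = {z. \<forall>b\<in>Basis. cmod (ccoord b (z - (p, 0))) < R}"

lemma open_polydisc: "open (polydisc p R)"
proof -
  have "polydisc p R = (\<Inter>b\<in>Basis. {z. cmod (ccoord b (z - (p, 0))) < R})"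
    by (auto simp: polydisc_def)
  then show ?thesis
    by (auto intro!: open_INT open_Collect_less continuous_intros
        bounded_linear.continuous_on[OF bounded_linear_ccoord])
qed

lemma ccoord_linear:
  "ccoord b 0 = 0" "ccoord b (v + w) = ccoord b v + ccoord b w" "ccoord b (v - w) = ccoord b v - ccoord b w"
  by (auto simp: ccoord_def complex_eq_iff inner_left_distrib inner_diff_left)

lemma norm_le_ccoord: "norm z \<le> 2 * (\<Sum>b\<in>Basis. cmod (ccoord b z))"
proof -
  have "norm z \<le> norm (fst z) + norm (snd z)" using norm_Pair_le[of "fst z" "snd z"] by simp
  also have "\<dots> \<le> (\<Sum>b\<in>Basis. \<bar>fst z \<bullet> b\<bar>) + (\<Sum>b\<in>Basis. \<bar>snd z \<bullet> b\<bar>)"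
    by (intro add_mono norm_le_l1)
  also have "\<dots> \<le> (\<Sum>b\<in>Basis. cmod (ccoord b z)) + (\<Sum>b\<in>Basis. cmod (ccoord b z))"
    by (intro add_mono sum_mono)
      (use abs_Re_le_cmod abs_Im_le_cmod in \<open>auto simp: ccoord_def intro: order_trans[OF _ abs_Re_le_cmod]
       order_trans[OF _ abs_Im_le_cmod]\<close>)
  finally show ?thesis by simp
qed

lemma polydisc_subset_ball:
  fixes p :: "'a::euclidean_space" and R :: real
  shows "polydisc p R \<subseteq> ball (p, 0) (2 * DIM('a) * R)"
proof
  fix z assume z: "z \<in> polydisc p R"
  have "norm (z - (p, 0)) \<le> 2 * (\<Sum>b\<in>Basis. cmod (ccoord b (z - (p, 0))))"
    by (rule norm_le_ccoord)
  also have "\<dots> < 2 * (\<Sum>b\<in>(Basis :: 'a set). R)"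
    using z by (intro mult_strict_left_mono sum_strict_mono) (auto simp: polydisc_def)
  finally show "z \<in> ball (p, 0) (2 * DIM('a) * R)" by (simp add: dist_norm norm_minus_commute)
qed

text \<open>A finite set of multi-indices lies in a box
  \<open>J \<rightarrow>\<^sub>E {..N}\<close>, over which the sum of products is a product of
  geometric sums; this bounds all finite partial sums at once.\<close>

lemma summable_on_geometric_PiE:
  fixes q :: "'b \<Rightarrow> real"
  assumes "finite J" "\<And>b. b \<in> J \<Longrightarrow> 0 \<le> q b" "\<And>b. b \<in> J \<Longrightarrow> q b < 1"
  shows "(\<lambda>\<alpha>. \<Prod>b\<in>J. q b ^ \<alpha> b) summable_on (J \<rightarrow>\<^sub>E (UNIV :: nat set))"
proof (rule nonneg_bdd_above_summable_on)
  show "0 \<le> (\<Prod>b\<in>J. q b ^ \<alpha> b)" for \<alpha> :: "'b \<Rightarrow> nat"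
    using assms(2) by (intro prod_nonneg) auto
  show "bdd_above (sum (\<lambda>\<alpha>. \<Prod>b\<in>J. q b ^ \<alpha> b) ` {F. F \<subseteq> J \<rightarrow>\<^sub>E UNIV \<and> finite F})"
  proof (rule bdd_aboveI2)
    fix F :: "('b \<Rightarrow> nat) set" assume "F \<in> {F. F \<subseteq> J \<rightarrow>\<^sub>E UNIV \<and> finite F}"
    then have F: "F \<subseteq> J \<rightarrow>\<^sub>E UNIV" "finite F" by auto
    define N where "N = Max (insert 0 ((\<lambda>(\<alpha>, b). \<alpha> b) ` (F \<times> J)))"
    have N: "\<alpha> b \<le> N" if "\<alpha> \<in> F" "b \<in> J" for \<alpha> b
      unfolding N_def by (rule Max_ge) (use F assms(1) that in \<open>auto intro!: image_eqI[of _ _ "(\<alpha>, b)"]\<close>)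
    have "F \<subseteq> J \<rightarrow>\<^sub>E {..N}" using F(1) N by (auto simp: PiE_iff subset_iff)
    then have "(\<Sum>\<alpha>\<in>F. \<Prod>b\<in>J. q b ^ \<alpha> b) \<le> (\<Sum>\<alpha>\<in>J \<rightarrow>\<^sub>E {..N}. \<Prod>b\<in>J. q b ^ \<alpha> b)"
      by (intro sum_mono2 finite_PiE assms(1) prod_nonneg) (use assms(2) in auto)
    also have "\<dots> = (\<Prod>b\<in>J. \<Sum>k\<le>N. q b ^ k)"
      by (subst prod_sum_PiE) (auto simp: assms(1))
    also have "\<dots> \<le> (\<Prod>b\<in>J. 1 / (1 - q b))"
    proof (rule prod_mono, intro conjI)
      fix b assume b: "b \<in> J"
      then show "0 \<le> (\<Sum>k\<le>N. q b ^ k)" using assms(2) by (intro sum_nonneg) auto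
      have "(\<Sum>k\<le>N. q b ^ k) \<le> (\<Sum>k. q b ^ k)"
        by (rule sum_le_suminf) (use assms(2,3) b in \<open>auto intro!: summable_geometric\<close>)
      also have "\<dots> = 1 / (1 - q b)" by (rule suminf_geometric) (use assms(2,3) b in auto)
      finally show "(\<Sum>k\<le>N. q b ^ k) \<le> 1 / (1 - q b)" .
    qed
    finally show "(\<Sum>\<alpha>\<in>F. \<Prod>b\<in>J. q b ^ \<alpha> b) \<le> (\<Prod>b\<in>J. 1 / (1 - q b))" .
  qed
qed

text \<open>Induction on the set of active coordinates; the coefficients in one variable are again holomorphic.\<close>
lemma chol_power_series:
  fixes p :: "'a::euclidean_space"
  assumes "finite J" "J \<subseteq> Basis" and r: "0 < r" "r < R"
    and "chol_on F (polydisc p R)" and "\<And>z. z \<in> polydisc p R \<Longrightarrow> cmod (F z) \<le> B"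
  shows "\<exists>c :: ('a \<Rightarrow> nat) \<Rightarrow> complex. (\<forall>\<alpha>. cmod (c \<alpha>) \<le> B / r ^ (\<Sum>b\<in>J. \<alpha> b)) \<and>
    (\<forall>z\<in>polydisc p r. (\<forall>b\<in>Basis - J. ccoord b (z - (p, 0)) = 0) \<longrightarrow>
       ((\<lambda>\<alpha>. c \<alpha> * (\<Prod>b\<in>J. ccoord b (z - (p, 0)) ^ \<alpha> b)) has_sum F z) (J \<rightarrow>\<^sub>E (UNIV :: nat set)))"
  using assms(1,2,5,6)
proof (induction J arbitrary: F B rule: finite_induct)
  case empty
  have "(p, 0) \<in> polydisc p R" using r by (simp add: polydisc_def ccoord_linear)
  then have 1: "cmod (F (p, 0)) \<le> B" by (rule empty.prems)
  have "z = (p, 0)" if "\<forall>b\<in>Basis. ccoord b (z - (p, 0)) = 0" for z :: "'a \<times> 'a"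
    using that norm_le_ccoord[of "z - (p, 0)"] by simp
  then have "F z = F (p, 0)" if "\<forall>b\<in>Basis - {}. ccoord b (z - (p, 0)) = 0" for z
    using that by (metis Diff_empty)
  then show ?case
    using 1 by (intro exI[of _ "\<lambda>_. F (p, 0)"] conjI allI ballI impI)
      (simp_all add: PiE_empty_domain has_sum_finiteI)
next
  case (insert b J)
  have bB: "b \<in> Basis" and JB: "J \<subseteq> Basis" using insert.prems(1) by auto
  define e where "e = (b, 0 :: 'a)"
  \<comment> \<open>\<open>\<pi>\<close> resets the coordinate \<open>b\<close> to that of the
    centre. Functions of \<open>\<pi> z\<close> depend only on the other coordinates, to which the
    induction hypothesis applies.\<close>
  define \<pi> where "\<pi> z = z - cscale (ccoord b (z - (p, 0))) e" for z
  have cc_e: "ccoord b' e = (if b' = b then 1 else 0)" if "b' \<in> Basis" for b'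
    using that bB by (simp add: e_def inner_Basis)
  have cc_line: "ccoord b' (\<pi> z + cscale c e - (p, 0)) = (if b' = b then c else ccoord b' (z - (p, 0)))"
    if "b' \<in> Basis" for b' z c
  proof -
    have "\<pi> z + cscale c e - (p, 0) = (z - (p, 0)) + cscale (c - ccoord b (z - (p, 0))) e"
      by (simp add: \<pi>_def cscale_diff_left)
    then show ?thesis
      by (simp add: ccoord_linear ccoord_cscale cc_e that)
  qed
  have cc_pi: "ccoord b' (\<pi> z - (p, 0)) = (if b' = b then 0 else ccoord b' (z - (p, 0)))"
    if "b' \<in> Basis" for b' z
    using cc_line[OF that, of z 0] by simp
  have line_mem: "\<pi> z + cscale c e \<in> polydisc p \<rho>" if "z \<in> polydisc p \<rho>" "cmod c < \<rho>" for z c \<rho>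
    using that by (auto simp: polydisc_def cc_line)
  have pi_mem: "\<pi> z \<in> polydisc p \<rho>" if "z \<in> polydisc p \<rho>" "\<rho> > 0" for z \<rho>
    using line_mem[OF that(1), of 0] that(2) by simp
  have pi_pi: "\<pi> (\<pi> z) = \<pi> z" for z
    using cc_pi[OF bB, of z] by (simp add: \<pi>_def[of "\<pi> z"])
  have z_line: "\<pi> z + cscale (ccoord b (z - (p, 0))) e = z" for z by (simp add: \<pi>_def)
  have vpi: "vhol_on \<pi> (polydisc p R)"
  proof -
    have "vhol_on (\<lambda>z. cscale (ccoord b (p, 0)) e + (z - cscale (ccoord b z) e)) (polydisc p R)"
    proof (rule vhol_on_linear)
      show "bounded_linear (\<lambda>z. z - cscale (ccoord b z) e)"
        by (intro bounded_linear_sub bounded_linear_ident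
            bounded_linear_compose[OF bounded_linear_cscale_left bounded_linear_ccoord])
    qed (simp add: ccoord_cscale cscale_cscale cscale_diff_right)
    moreover have "\<pi> z = cscale (ccoord b (p, 0)) e + (z - cscale (ccoord b z) e)" for z
      by (simp add: \<pi>_def ccoord_linear cscale_diff_left)
    ultimately show ?thesis by presburger
  qed
  define Dn where "Dn n = ((\<lambda>F z. frechet_derivative F (at z) e) ^^ n) F" for n
  have Dn0: "Dn 0 = F" and DnS: "Dn (Suc n) = (\<lambda>z. frechet_derivative (Dn n) (at z) e)" for n
    by (auto simp: Dn_def)
  have Dn: "chol_on (Dn n) (polydisc p R)" for n
    by (induction n) (auto simp: Dn0 DnS insert.prems intro!: chol_on_frechet_derivative open_polydisc)
  define f where "f z c = F (\<pi> z + cscale c e)" for z c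
  have holf: "f z holomorphic_on ball 0 R" if "z \<in> polydisc p R" for z
    unfolding f_def by (rule chol_line_holomorphic[OF insert.prems(2)]) (use line_mem[OF that] in auto)
  have derf: "(deriv ^^ n) (f z) c = Dn n (\<pi> z + cscale c e)" if "z \<in> polydisc p R" "cmod c < R" for z n c
    using that(2)
  proof (induction n arbitrary: c)
    case 0
    then show ?case by (simp add: f_def Dn0)
  next
    case (Suc n)
    have "((\<lambda>c. Dn n (\<pi> z + cscale c e)) has_field_derivative Dn (Suc n) (\<pi> z + cscale c e)) (at c)"
      unfolding DnS by (rule chol_line[OF Dn line_mem[OF that(1) Suc.prems]])
    then have "((deriv ^^ n) (f z) has_field_derivative Dn (Suc n) (\<pi> z + cscale c e)) (at c)"
      by (rule has_field_derivative_transform_within_open[of _ _ _ "ball 0 R"])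
        (use Suc in auto)
    then show ?case by (simp add: DERIV_imp_deriv)
  qed
  \<comment> \<open>The \<open>n\<close>-th Taylor coefficient of \<open>F\<close> in the coordinate
    \<open>b\<close>, as a holomorphic function of the remaining coordinates.\<close>
  define Fn where "Fn n z = Dn n (\<pi> z) / fact n" for n z
  have cholFn: "chol_on (Fn n) (polydisc p R)" for n
  proof -
    have "chol_on (\<lambda>z. Dn n (\<pi> z) * (inverse (fact n))) (polydisc p R)"
      by (intro chol_on_mult chol_on_const chol_on_compose[OF vpi Dn]) (use pi_mem r in auto)
    then show ?thesis by (simp add: Fn_def[abs_def] divide_inverse)
  qed
  have bdFn: "cmod (Fn n z) \<le> B / r ^ n" if z: "z \<in> polydisc p R" for n z
  proof -
    have "norm ((deriv ^^ n) (f z) 0) \<le> (fact n) * B / r^n"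
    proof (rule Cauchy_inequality)
      show "f z holomorphic_on ball 0 r"
        by (rule holomorphic_on_subset[OF holf[OF z]]) (use r in auto)
      show "continuous_on (cball 0 r) (f z)"
        by (rule continuous_on_subset[OF holomorphic_on_imp_continuous_on[OF holf[OF z]]]) (use r in auto)
      show "cmod (f z x) \<le> B" if "cmod (0 - x) = r" for x
        unfolding f_def by (rule insert.prems(3), rule line_mem[OF z]) (use that r in auto)
    qed (use r in auto)
    then show ?thesis using derf[OF z, of 0 n] r
      by (simp add: Fn_def norm_divide divide_le_eq mult.commute)
  qed
  define Q where "Q n c \<longleftrightarrow> (\<forall>\<alpha>. cmod (c \<alpha>) \<le> (B / r ^ n) / r ^ (\<Sum>b\<in>J. \<alpha> b)) \<and>
    (\<forall>z\<in>polydisc p r. (\<forall>b\<in>Basis - J. ccoord b (z - (p, 0)) = 0) \<longrightarrow>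
       ((\<lambda>\<alpha>. c \<alpha> * (\<Prod>b\<in>J. ccoord b (z - (p, 0)) ^ \<alpha> b)) has_sum Fn n z) (J \<rightarrow>\<^sub>E (UNIV :: nat set)))"
    for n and c :: "('a \<Rightarrow> nat) \<Rightarrow> complex"
  have "\<exists>c. Q n c" for n
    unfolding Q_def by (rule insert.IH[OF JB cholFn bdFn])
  then obtain c where c: "\<And>n. Q n (c n)" by metis
  note cb = c[unfolded Q_def, THEN conjunct1, rule_format]
    and cs = c[unfolded Q_def, THEN conjunct2, rule_format]
  \<comment> \<open>A multi-index over \<open>insert b J\<close> splits into its entry at
    \<open>b\<close> and its restriction to \<open>J\<close>; extensional functions on
    \<open>J\<close> take the value \<open>undefined\<close> at \<open>b\<close>.\<close>
  define c' where "c' \<alpha> = c (\<alpha> b) (\<alpha>(b := undefined))" for \<alpha> :: "'a \<Rightarrow> nat"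
  show ?case
  proof (intro exI[of _ c'] conjI allI ballI impI)
    fix \<alpha> :: "'a \<Rightarrow> nat"
    have "(\<Sum>b'\<in>J. (\<alpha>(b := undefined)) b') = (\<Sum>b'\<in>J. \<alpha> b')"
      by (rule sum.cong) (use insert.hyps in auto)
    then show "cmod (c' \<alpha>) \<le> B / r ^ (\<Sum>b\<in>insert b J. \<alpha> b)"
      using cb[of "\<alpha> b" "\<alpha>(b := undefined)"] insert.hyps by (simp add: c'_def power_add)
  next
    fix z assume z: "z \<in> polydisc p r" and z0: "\<forall>b\<in>Basis - insert b J. ccoord b (z - (p, 0)) = 0"
    have zR: "z \<in> polydisc p R"
      using z r(2) unfolding polydisc_def mem_Collect_eq by (meson less_trans)
    define \<zeta> where "\<zeta> = ccoord b (z - (p, 0))"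
    define x where "x b' = ccoord b' (z - (p, 0))" for b'
    have \<zeta>: "cmod \<zeta> < r" using z bB by (auto simp: \<zeta>_def polydisc_def)
    have x: "cmod (x b') < r" if "b' \<in> Basis" for b' using z that by (auto simp: x_def polydisc_def)
    have inner: "((\<lambda>\<beta>. c n \<beta> * (\<Prod>b\<in>J. x b ^ \<beta> b)) has_sum Fn n z) (J \<rightarrow>\<^sub>E (UNIV :: nat set))" for n
    proof -
      have "\<forall>b\<in>Basis - J. ccoord b (\<pi> z - (p, 0)) = 0" using z0 by (auto simp: cc_pi)
      from cs[OF pi_mem[OF z r(1)] this[rule_format], of n]
      have "((\<lambda>\<beta>. c n \<beta> * (\<Prod>b\<in>J. ccoord b (\<pi> z - (p, 0)) ^ \<beta> b)) has_sum Fn n z) (J \<rightarrow>\<^sub>E (UNIV :: nat set))"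
        by (simp add: Fn_def pi_pi)
      moreover have "(\<Prod>b\<in>J. ccoord b (\<pi> z - (p, 0)) ^ \<beta> b) = (\<Prod>b\<in>J. x b ^ \<beta> b)" for \<beta> :: "'a \<Rightarrow> nat"
        by (rule prod.cong) (use insert.hyps JB in \<open>auto simp: x_def cc_pi\<close>)
      ultimately show ?thesis by simp
    qed
    have outer: "((\<lambda>n. Fn n z * \<zeta> ^ n) has_sum F z) UNIV"
    proof (rule norm_summable_imp_has_sum)
      have "(\<lambda>n. (deriv ^^ n) (f z) 0 / fact n * (\<zeta> - 0) ^ n) sums f z \<zeta>"
        by (rule holomorphic_power_series[OF holf[OF zR]]) (use \<zeta> r in auto)
      then show "(\<lambda>n. Fn n z * \<zeta> ^ n) sums F z"
        using derf[OF zR, of 0] r by (simp add: Fn_def f_def \<zeta>_def z_line)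
      show "summable (\<lambda>n. cmod (Fn n z * \<zeta> ^ n))"
      proof (rule summable_comparison_test)
        show "\<exists>N. \<forall>n\<ge>N. norm (cmod (Fn n z * \<zeta> ^ n)) \<le> B * (cmod \<zeta> / r) ^ n"
        proof (intro exI[of _ 0] allI impI)
          fix n
          show "norm (cmod (Fn n z * \<zeta> ^ n)) \<le> B * (cmod \<zeta> / r) ^ n"
            using mult_right_mono[OF bdFn[OF zR, of n], of "cmod \<zeta> ^ n"] r
            by (simp add: norm_mult norm_power power_divide)
        qed
        show "summable (\<lambda>n. B * (cmod \<zeta> / r) ^ n)"
          using \<zeta> r by (intro summable_mult summable_geometric) auto
      qed
    qed
    \<comment> \<open>Unconditional convergence over the whole index set comes from the geometric
      majorant with ratios \<open>cmod (x b) / r\<close>; only with it may the iterated sum, inner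
      over \<open>J\<close> and outer over \<open>n\<close>, be read as one sum.\<close>
    have ins: "((\<lambda>\<alpha>. c' \<alpha> * (\<Prod>b\<in>insert b J. x b ^ \<alpha> b)) summable_on (insert b J \<rightarrow>\<^sub>E (UNIV :: nat set)))"
    proof (rule Infinite_Sum.abs_summable_summable, rule Infinite_Sum.abs_summable_on_comparison_test')
      show "(\<lambda>\<alpha>. B * (\<Prod>b\<in>insert b J. (cmod (x b) / r) ^ \<alpha> b)) summable_on (insert b J \<rightarrow>\<^sub>E (UNIV :: nat set))"
        by (intro summable_on_cmult_right summable_on_geometric_PiE)
          (use insert.hyps insert.prems x r in auto)
      fix \<alpha> :: "'a \<Rightarrow> nat"
      have s: "(\<Sum>b'\<in>J. (\<alpha>(b := undefined)) b') = (\<Sum>b'\<in>J. \<alpha> b')"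
        by (rule sum.cong) (use insert.hyps in auto)
      have "cmod (c' \<alpha>) \<le> B / r ^ (\<Sum>b\<in>insert b J. \<alpha> b)"
        using cb[of "\<alpha> b" "\<alpha>(b := undefined)"] insert.hyps s by (simp add: c'_def power_add)
      then have "cmod (c' \<alpha> * (\<Prod>b\<in>insert b J. x b ^ \<alpha> b)) \<le>
          B / r ^ (\<Sum>b\<in>insert b J. \<alpha> b) * (\<Prod>b\<in>insert b J. cmod (x b) ^ \<alpha> b)"
        unfolding norm_mult prod_norm[symmetric] norm_power
        by (intro mult_right_mono prod_nonneg) auto
      also have "\<dots> = B * (\<Prod>b\<in>insert b J. (cmod (x b) / r) ^ \<alpha> b)"
        by (simp add: power_divide prod_dividef power_sum)
      finally show "cmod (c' \<alpha> * (\<Prod>b\<in>insert b J. x b ^ \<alpha> b)) \<le> B * (\<Prod>b\<in>insert b J. (cmod (x b) / r) ^ \<alpha> b)" .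
    qed
    have bij: "bij_betw (\<lambda>(n, \<beta>). \<beta>(b := n)) (UNIV \<times> (J \<rightarrow>\<^sub>E (UNIV :: nat set))) (insert b J \<rightarrow>\<^sub>E UNIV)"
      unfolding PiE_insert_eq by (intro inj_on_imp_bij_betw inj_combinator insert.hyps)
    have eq: "c' (\<beta>(b := n)) * (\<Prod>b'\<in>insert b J. x b' ^ (\<beta>(b := n)) b') = c n \<beta> * (\<Prod>b\<in>J. x b ^ \<beta> b) * \<zeta> ^ n"
      if "\<beta> \<in> J \<rightarrow>\<^sub>E (UNIV :: nat set)" for n \<beta>
    proof -
      have "(\<Prod>b'\<in>J. x b' ^ (if b' = b then n else \<beta> b')) = (\<Prod>b\<in>J. x b ^ \<beta> b)"
        by (rule prod.cong) (use insert.hyps in auto)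
      moreover have "\<beta>(b := undefined) = \<beta>"
        using that insert.hyps by (auto simp: PiE_def extensional_def)
      ultimately show ?thesis
        using insert.hyps by (simp add: c'_def x_def \<zeta>_def)
    qed
    have "((\<lambda>(n, \<beta>). c n \<beta> * (\<Prod>b\<in>J. x b ^ \<beta> b) * \<zeta> ^ n) has_sum F z) (UNIV \<times> (J \<rightarrow>\<^sub>E (UNIV :: nat set)))"
    proof (rule has_sum_SigmaI[where g = "\<lambda>n. Fn n z * \<zeta> ^ n"])
      show "((\<lambda>\<beta>. case (n, \<beta>) of (n, \<beta>) \<Rightarrow> c n \<beta> * (\<Prod>b\<in>J. x b ^ \<beta> b) * \<zeta> ^ n) has_sum Fn n z * \<zeta> ^ n)
         (J \<rightarrow>\<^sub>E UNIV)" for n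
        using has_sum_cmult_left[OF inner[of n], of "\<zeta> ^ n"] by simp
      show "((\<lambda>n. Fn n z * \<zeta> ^ n) has_sum F z) UNIV" by (rule outer)
      have "(\<lambda>y. c' ((\<lambda>(n, \<beta>). \<beta>(b := n)) y) * (\<Prod>b'\<in>insert b J. x b' ^ ((\<lambda>(n, \<beta>). \<beta>(b := n)) y) b'))
          summable_on (UNIV \<times> (J \<rightarrow>\<^sub>E (UNIV :: nat set)))"
        using summable_on_reindex_bij_betw[OF bij, of "\<lambda>\<alpha>. c' \<alpha> * (\<Prod>b\<in>insert b J. x b ^ \<alpha> b)"] ins by simp
      then show "(\<lambda>(n, \<beta>). c n \<beta> * (\<Prod>b\<in>J. x b ^ \<beta> b) * \<zeta> ^ n) summable_on (UNIV \<times> (J \<rightarrow>\<^sub>E (UNIV :: nat set)))"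
        by (rule summable_on_cong[THEN iffD1, rotated]) (use eq in auto)
    qed
    then have "((\<lambda>y. c' ((\<lambda>(n, \<beta>). \<beta>(b := n)) y) * (\<Prod>b'\<in>insert b J. x b' ^ ((\<lambda>(n, \<beta>). \<beta>(b := n)) y) b'))
          has_sum F z) (UNIV \<times> (J \<rightarrow>\<^sub>E (UNIV :: nat set)))"
      by (rule has_sum_cong[THEN iffD1, rotated]) (use eq in auto)
    then show "((\<lambda>\<alpha>. c' \<alpha> * (\<Prod>b\<in>insert b J. ccoord b (z - (p, 0)) ^ \<alpha> b)) has_sum F z) (insert b J \<rightarrow>\<^sub>E UNIV)"
      unfolding x_def[symmetric] has_sum_reindex_bij_betw[OF bij, of "\<lambda>\<alpha>. c' \<alpha> * (\<Prod>b\<in>insert b J. x b ^ \<alpha> b)"] .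
  qed
qed

section \<open>Real-analytic functions\<close>

text \<open>One extension serves all nearby real points too, which makes the property open.
  \<open>real_analytic_at_iff\<close> ties it to convergent series.\<close>

definition cxan :: "('a::euclidean_space \<Rightarrow> complex) \<Rightarrow> 'a \<Rightarrow> bool" where
  "cxan h p \<longleftrightarrow> (\<exists>F U. open U \<and> (p, 0) \<in> U \<and> chol_on F U \<and> (\<forall>x. (x, 0) \<in> U \<longrightarrow> h x = F (x, 0)))"

text \<open>Abel's argument: convergence at one real point with all offsets equal to
  \<open>t > 0\<close> dominates the series on the complex polydisc of radius \<open>t\<close>, and
  the sum is a uniform limit of polynomials.\<close>

lemma real_analytic_at_imp_cxan:
  fixes r :: "'a::euclidean_space \<Rightarrow> real"
  assumes "real_analytic_at r p"
  shows "cxan (\<lambda>x. of_real (r x)) p"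
proof -
  obtain c :: "('a \<Rightarrow> nat) \<Rightarrow> real" and \<rho> where \<rho>: "\<rho> > 0" and
    hs: "\<And>y. y \<in> ball p \<rho> \<Longrightarrow> ((\<lambda>\<alpha>. c \<alpha> * (\<Prod>b\<in>Basis. ((y - p) \<bullet> b) ^ \<alpha> b)) has_sum r y) (Basis \<rightarrow>\<^sub>E (UNIV :: nat set))"
    using assms unfolding real_analytic_at_def by blast
  define I where "I = (Basis :: 'a set) \<rightarrow>\<^sub>E (UNIV :: nat set)"
  \<comment> \<open>The point \<open>y0\<close> with all offsets \<open>t\<close> is at distance at
    most \<open>\<rho> / 2\<close> from \<open>p\<close>, and the polydisc of radius
    \<open>t\<close> lies in a ball of radius \<open>2 * DIM('a) * t = \<rho>\<close>.\<close>
  define t where "t = \<rho> / (2 * DIM('a))"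
  have t: "t > 0" using \<rho> by (simp add: t_def)
  define y0 where "y0 = p + t *\<^sub>R (\<Sum>b\<in>Basis. b)"
  have "norm (y0 - p) \<le> t * (\<Sum>b\<in>(Basis :: 'a set). norm b)"
    using t by (simp add: y0_def norm_sum del: norm_Basis)
  also have "\<dots> < \<rho>" using \<rho> by (simp add: t_def)
  finally have "y0 \<in> ball p \<rho>" by (simp add: dist_norm norm_minus_commute)
  from hs[OF this] have "(\<lambda>\<alpha>. c \<alpha> * (\<Prod>b\<in>Basis. ((y0 - p) \<bullet> b) ^ \<alpha> b)) summable_on I"
    unfolding I_def by (rule has_sum_imp_summable)
  moreover have "c \<alpha> * (\<Prod>b\<in>Basis. ((y0 - p) \<bullet> b) ^ \<alpha> b) = c \<alpha> * (\<Prod>b\<in>(Basis :: 'a set). t ^ \<alpha> b)" for \<alpha>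
    by (intro arg_cong2[where f = "(*)"] prod.cong refl) (auto simp: y0_def inner_sum_left inner_Basis if_distrib sum.If_cases)
  ultimately have "(\<lambda>\<alpha>. c \<alpha> * (\<Prod>b\<in>(Basis :: 'a set). t ^ \<alpha> b)) summable_on I" by simp
  then have summ: "(\<lambda>\<alpha>. \<bar>c \<alpha> * (\<Prod>b\<in>(Basis :: 'a set). t ^ \<alpha> b)\<bar>) summable_on I"
    using summable_on_iff_abs_summable_on_real by fastforce
  define T where "T \<alpha> z = of_real (c \<alpha>) * (\<Prod>b\<in>Basis. ccoord b (z - (p, 0)) ^ \<alpha> b)" for \<alpha> :: "'a \<Rightarrow> nat" and z
  define F where "F z = (\<Sum>\<^sub>\<infinity>\<alpha>\<in>I. T \<alpha> z)" for z
  have ul: "uniform_limit (polydisc p t) (\<lambda>X z. \<Sum>\<alpha>\<in>X. T \<alpha> z) F (finite_subsets_at_top I)"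
    unfolding F_def
  proof (rule Weierstrass_m_test_general[OF _ summ])
    fix \<alpha> :: "'a \<Rightarrow> nat" and z assume z: "z \<in> polydisc p t"
    have "(\<Prod>b\<in>Basis. cmod (ccoord b (z - (p, 0))) ^ \<alpha> b) \<le> (\<Prod>b\<in>(Basis :: 'a set). t ^ \<alpha> b)"
      by (intro prod_mono conjI power_mono) (use z in \<open>auto simp: polydisc_def less_imp_le\<close>)
    then show "cmod (T \<alpha> z) \<le> \<bar>c \<alpha> * (\<Prod>b\<in>(Basis :: 'a set). t ^ \<alpha> b)\<bar>"
      using t by (simp add: T_def norm_mult prod_norm[symmetric] norm_power abs_mult abs_prod mult_left_mono)
  qed
  have cc: "chol_on (\<lambda>z. ccoord b (z - (p, 0))) U" for b and U :: "('a \<times> 'a) set"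
  proof -
    have "chol_on (\<lambda>z. ccoord b z + - ccoord b (p, 0)) U" by (intro chol_on_add chol_on_const chol_on_ccoord)
    then show ?thesis by (simp add: ccoord_linear)
  qed
  have "chol_on F (polydisc p t)"
  proof (rule chol_uniform_limit(1)[OF open_polydisc _ uniform_limit_on_subset[OF ul]])
    show "\<forall>\<^sub>F X in finite_subsets_at_top I. chol_on (\<lambda>z. \<Sum>\<alpha>\<in>X. T \<alpha> z) (polydisc p t)"
      unfolding T_def
      by (intro always_eventually allI chol_on_sum chol_on_mult chol_on_const chol_on_prod chol_on_power cc)
  qed auto
  moreover have "of_real (r x) = F (x, 0)" if "(x, 0) \<in> polydisc p t" for x
  proof -
    have "(x, 0 :: 'a) \<in> ball (p, 0) (2 * DIM('a) * t)" by (rule subsetD[OF polydisc_subset_ball that])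
    then have "x \<in> ball p \<rho>" using dist_fst_le[of "(p, 0 :: 'a)" "(x, 0 :: 'a)"] by (simp add: t_def)
    from has_sum_of_real[OF hs[OF this], where 'a = complex]
    have "((\<lambda>\<alpha>. T \<alpha> (x, 0)) has_sum of_real (r x)) I"
      by (simp add: T_def I_def)
    then show ?thesis unfolding F_def by (simp add: infsumI)
  qed
  moreover have "(p, 0) \<in> polydisc p t" using t by (simp add: polydisc_def ccoord_linear)
  ultimately show ?thesis unfolding cxan_def
    by (intro exI[of _ F] exI[of _ "polydisc p t"]) (simp add: open_polydisc)
qed

lemma cxan_imp_real_analytic_at:
  fixes r :: "'a::euclidean_space \<Rightarrow> real"
  assumes "cxan (\<lambda>x. of_real (r x)) p"
  shows "real_analytic_at r p"
proof -
  obtain F U where U: "open U" "(p, 0) \<in> U" "chol_on F U" "\<And>x. (x, 0) \<in> U \<Longrightarrow> of_real (r x) = F (x, 0)"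
    using assms unfolding cxan_def by blast
  obtain e where e: "e > 0" "cball (p, 0) e \<subseteq> U" using open_contains_cball[of U] U by blast
  define R where "R = e / (2 * DIM('a))"
  have R: "R > 0" using e by (simp add: R_def)
  have sub: "polydisc p R \<subseteq> cball (p, 0) e"
    using polydisc_subset_ball[of p R] by (auto simp: R_def)
  have "compact (F ` cball (p, 0) e)"
    by (intro compact_continuous_image continuous_on_subset[OF chol_on_continuous[OF U(3)] e(2)]) auto
  then obtain B where B: "\<forall>w\<in>cball (p, 0) e. cmod (F w) \<le> B"
    using compact_imp_bounded bounded_iff by (metis imageI)
  define s where "s = R / 2"
  have s: "0 < s" "s < R" using R by (auto simp: s_def)
  have "\<exists>c :: ('a \<Rightarrow> nat) \<Rightarrow> complex. (\<forall>\<alpha>. cmod (c \<alpha>) \<le> B / s ^ (\<Sum>b\<in>Basis. \<alpha> b)) \<and>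
    (\<forall>z\<in>polydisc p s. (\<forall>b\<in>Basis - Basis. ccoord b (z - (p, 0)) = 0) \<longrightarrow>
       ((\<lambda>\<alpha>. c \<alpha> * (\<Prod>b\<in>Basis. ccoord b (z - (p, 0)) ^ \<alpha> b)) has_sum F z) (Basis \<rightarrow>\<^sub>E (UNIV :: nat set)))"
    by (rule chol_power_series[OF finite_Basis subset_refl s chol_on_subset[OF U(3)]]) (use sub e B in auto)
  then obtain c :: "('a \<Rightarrow> nat) \<Rightarrow> complex" where c: "\<And>z. z \<in> polydisc p s \<Longrightarrow>
       ((\<lambda>\<alpha>. c \<alpha> * (\<Prod>b\<in>Basis. ccoord b (z - (p, 0)) ^ \<alpha> b)) has_sum F z) (Basis \<rightarrow>\<^sub>E (UNIV :: nat set))"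
    by auto
  show ?thesis unfolding real_analytic_at_def
  proof (intro exI[of _ "\<lambda>\<alpha>. Re (c \<alpha>)"] exI[of _ s] conjI ballI s)
    fix y assume y: "y \<in> ball p s"
    have "\<bar>(y - p) \<bullet> b\<bar> < s" if "b \<in> Basis" for b
      using Basis_le_norm[OF that, of "y - p"] y by (simp add: dist_norm norm_minus_commute)
    then have yp: "(y, 0) \<in> polydisc p s" by (simp add: polydisc_def)
    have yU: "(y, 0) \<in> U" using yp sub s e(2) by (force simp: polydisc_def)
    \<comment> \<open>At real points the monomials and the value of \<open>F\<close> are real, so
      the real parts of the complex coefficients give the required real series.\<close>
    have "((\<lambda>\<alpha>. Re (c \<alpha> * (\<Prod>b\<in>Basis. ccoord b ((y, 0) - (p, 0)) ^ \<alpha> b))) has_sum Re (F (y, 0))) (Basis \<rightarrow>\<^sub>E (UNIV :: nat set))"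
      by (rule has_sum_Re[OF c[OF yp]])
    moreover have "Re (F (y, 0)) = r y" using U(4)[OF yU] by (metis Re_complex_of_real)
    moreover have "Re (c \<alpha> * (\<Prod>b\<in>Basis. ccoord b ((y, 0) - (p, 0)) ^ \<alpha> b)) = Re (c \<alpha>) * (\<Prod>b\<in>Basis. ((y - p) \<bullet> b) ^ \<alpha> b)" for \<alpha>
    proof -
      have "(\<Prod>b\<in>Basis. ccoord b ((y, 0) - (p, 0)) ^ \<alpha> b) = of_real (\<Prod>b\<in>Basis. ((y - p) \<bullet> b) ^ \<alpha> b)" by simp
      then show ?thesis by (simp only: Re_complex_of_real mult.commute times_complex.sel Im_complex_of_real)
    qed
    ultimately show "((\<lambda>\<alpha>. Re (c \<alpha>) * (\<Prod>b\<in>Basis. ((y - p) \<bullet> b) ^ \<alpha> b)) has_sum r y) (Basis \<rightarrow>\<^sub>E (UNIV :: nat set))"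
      by simp
  qed
qed

lemma real_analytic_at_iff: "real_analytic_at r p \<longleftrightarrow> cxan (\<lambda>x. of_real (r x)) p"
  using cxan_imp_real_analytic_at real_analytic_at_imp_cxan by blast

lemma cxan_cong:
  assumes "\<forall>\<^sub>F x in nhds p. h x = h' x" "cxan h p"
  shows "cxan h' p"
proof -
  obtain F U where U: "open U" "(p, 0) \<in> U" "chol_on F U" "\<And>x. (x, 0) \<in> U \<Longrightarrow> h x = F (x, 0)"
    using assms unfolding cxan_def by blast
  obtain S where S: "open S" "p \<in> S" "\<And>x. x \<in> S \<Longrightarrow> h x = h' x"
    using assms(1) unfolding eventually_nhds by blast
  show ?thesis unfolding cxan_def
    by (intro exI[of _ F] exI[of _ "U \<inter> (S \<times> UNIV)"])
      (use U S(1,2) S(3)[symmetric] chol_on_subset[OF U(3)] in \<open>auto intro!: open_Int open_Times\<close>)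
qed

lemma cxan_const [intro]: "cxan (\<lambda>x. c) p"
  unfolding cxan_def by (intro exI[of _ "\<lambda>_. c"] exI[of _ UNIV]) auto

lemma cxan_add [intro]: "cxan f p \<Longrightarrow> cxan g p \<Longrightarrow> cxan (\<lambda>x. f x + g x) p"
  unfolding cxan_def
proof (elim exE conjE)
  fix F U G V
  assume "open U" "(p, 0) \<in> U" "chol_on F U" "\<forall>x. (x, 0) \<in> U \<longrightarrow> f x = F (x, 0)"
    "open V" "(p, 0) \<in> V" "chol_on G V" "\<forall>x. (x, 0) \<in> V \<longrightarrow> g x = G (x, 0)"
  then show "\<exists>F U. open U \<and> (p, 0) \<in> U \<and> chol_on F U \<and> (\<forall>x. (x, 0) \<in> U \<longrightarrow> f x + g x = F (x, 0))"
    by (intro exI[of _ "\<lambda>z. F z + G z"] exI[of _ "U \<inter> V"])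
      (auto intro: chol_on_subset)
qed

lemma cxan_mult [intro]: "cxan f p \<Longrightarrow> cxan g p \<Longrightarrow> cxan (\<lambda>x. f x * g x) p"
  unfolding cxan_def
proof (elim exE conjE)
  fix F U G V
  assume "open U" "(p, 0) \<in> U" "chol_on F U" "\<forall>x. (x, 0) \<in> U \<longrightarrow> f x = F (x, 0)"
    "open V" "(p, 0) \<in> V" "chol_on G V" "\<forall>x. (x, 0) \<in> V \<longrightarrow> g x = G (x, 0)"
  then show "\<exists>F U. open U \<and> (p, 0) \<in> U \<and> chol_on F U \<and> (\<forall>x. (x, 0) \<in> U \<longrightarrow> f x * g x = F (x, 0))"
    by (intro exI[of _ "\<lambda>z. F z * G z"] exI[of _ "U \<inter> V"])
      (auto intro: chol_on_subset)
qed

lemma cxan_uminus [intro]: "cxan f p \<Longrightarrow> cxan (\<lambda>x. - f x) p"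
  using cxan_mult[OF cxan_const[of "-1"]] by simp

lemma cxan_diff [intro]: "cxan f p \<Longrightarrow> cxan g p \<Longrightarrow> cxan (\<lambda>x. f x - g x) p"
  using cxan_add[OF _ cxan_uminus] by simp

lemma cxan_sum [intro]: "(\<And>i. i \<in> A \<Longrightarrow> cxan (f i) p) \<Longrightarrow> cxan (\<lambda>x. \<Sum>i\<in>A. f i x) p"
  by (induction A rule: infinite_finite_induct) auto

lemma cxan_prod [intro]: "(\<And>i. i \<in> A \<Longrightarrow> cxan (f i) p) \<Longrightarrow> cxan (\<lambda>x. \<Prod>i\<in>A. f i x) p"
  by (induction A rule: infinite_finite_induct) auto

lemma cxan_inverse [intro]:
  assumes "cxan f p" "f p \<noteq> 0"
  shows "cxan (\<lambda>x. inverse (f x)) p"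
proof -
  obtain F U where U: "open U" "(p, 0) \<in> U" "chol_on F U" "\<And>x. (x, 0) \<in> U \<Longrightarrow> f x = F (x, 0)"
    using assms unfolding cxan_def by blast
  have "open (U \<inter> F -` (- {0}))"
    by (rule continuous_open_preimage[OF chol_on_continuous[OF U(3)] U(1)]) auto
  moreover have "chol_on (\<lambda>z. inverse (F z)) (U \<inter> F -` (- {0}))"
    by (rule chol_on_inverse[OF chol_on_subset[OF U(3)]]) auto
  ultimately show ?thesis unfolding cxan_def
    by (intro exI[of _ "\<lambda>z. inverse (F z)"] exI[of _ "U \<inter> F -` (- {0})"]) (use U assms(2) in auto)
qed

text \<open>Schwarz reflection: \<open>\<sigma>\<close> is complex conjugation on the
  complexification. Conjugating before and after \<open>F\<close> restores complex linearity of the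
  derivative and gives the conjugate of \<open>f\<close> at real points.\<close>

lemma cxan_cnj [intro]:
  fixes f :: "'a::euclidean_space \<Rightarrow> complex"
  assumes "cxan f p"
  shows "cxan (\<lambda>x. cnj (f x)) p"
proof -
  obtain F U where U: "open U" "(p, 0) \<in> U" "chol_on F U" "\<And>x. (x, 0) \<in> U \<Longrightarrow> f x = F (x, 0)"
    using assms unfolding cxan_def by blast
  define \<sigma> where "\<sigma> z = (fst z, - snd z)" for z :: "'a \<times> 'a"
  have bl: "bounded_linear \<sigma>" unfolding \<sigma>_def
    by (intro bounded_linear_Pair bounded_linear_fst bounded_linear_minus bounded_linear_snd)
  have sig: "\<sigma> (cscale c v) = cscale (cnj c) (\<sigma> v)" for c v
    by (simp add: \<sigma>_def cscale_def)
  have "open (\<sigma> -` U)"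
    by (intro open_vimage U(1) linear_continuous_on bl)
  moreover have "chol_on (\<lambda>z. cnj (F (\<sigma> z))) (\<sigma> -` U)"
    unfolding chol_on_def
  proof
    fix z assume "z \<in> \<sigma> -` U"
    then obtain D where D: "(F has_derivative D) (at (\<sigma> z))" "\<forall>c v. D (cscale c v) = c * D v"
      using U(3) unfolding chol_on_def by auto
    have "((\<lambda>z. cnj (F (\<sigma> z))) has_derivative (\<lambda>v. cnj (D (\<sigma> v)))) (at z)"
      by (rule bounded_linear.has_derivative[OF bounded_linear_cnj
            has_derivative_compose[OF bounded_linear_imp_has_derivative[OF bl] D(1)]])
    moreover have "\<forall>c v. cnj (D (\<sigma> (cscale c v))) = c * cnj (D (\<sigma> v))"
      by (simp only: sig D(2)) simp
    ultimately show "\<exists>D. ((\<lambda>z. cnj (F (\<sigma> z))) has_derivative D) (at z) \<and> (\<forall>c v. D (cscale c v) = c * D v)"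
      by blast
  qed
  ultimately show ?thesis unfolding cxan_def
    by (intro exI[of _ "\<lambda>z. cnj (F (\<sigma> z))"] exI[of _ "\<sigma> -` U"]) (use U in \<open>auto simp: \<sigma>_def\<close>)
qed

lemma cxan_Re [intro]: "cxan f p \<Longrightarrow> cxan (\<lambda>x. of_real (Re (f x))) p"
  and cxan_Im [intro]: "cxan f p \<Longrightarrow> cxan (\<lambda>x. of_real (Im (f x))) p"
proof -
  assume f: "cxan f p"
  have "cxan (\<lambda>x. (f x + cnj (f x)) * (1/2)) p" "cxan (\<lambda>x. (f x - cnj (f x)) * (1/(2 * \<i>))) p"
    by (intro cxan_add cxan_diff cxan_mult cxan_const cxan_cnj f)+
  moreover have "(f x + cnj (f x)) * (1/2) = of_real (Re (f x))" "(f x - cnj (f x)) * (1/(2 * \<i>)) = of_real (Im (f x))" for x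
    by (auto simp: complex_eq_iff complex_add_cnj complex_diff_cnj)
  ultimately show "cxan (\<lambda>x. of_real (Re (f x))) p" "cxan (\<lambda>x. of_real (Im (f x))) p" by simp_all
qed

lemma cxan_inner [intro]: "cxan (\<lambda>x. of_real (x \<bullet> v)) p"
proof -
  have "cxan (\<lambda>x. of_real (x \<bullet> b)) p" for b
    unfolding cxan_def by (intro exI[of _ "ccoord b"] exI[of _ UNIV]) auto
  then show ?thesis .
qed

lemma cxan_eventually:
  assumes "cxan h p"
  shows "\<forall>\<^sub>F q in nhds p. cxan h q"
proof -
  obtain F U where U: "open U" "(p, 0) \<in> U" "chol_on F U" "\<And>x. (x, 0) \<in> U \<Longrightarrow> h x = F (x, 0)"
    using assms unfolding cxan_def by blast
  have "open ((\<lambda>x. (x, 0)) -` U)" by (intro open_vimage U(1) continuous_intros)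
  then show ?thesis
    unfolding eventually_nhds cxan_def by (intro exI[of _ "(\<lambda>x. (x, 0)) -` U"]) (use U in auto)
qed

lemma cxan_extension_derivative:
  fixes h :: "'a::euclidean_space \<Rightarrow> complex"
  assumes U: "open U" "(p, 0) \<in> U" "chol_on F U" "\<And>x. (x, 0) \<in> U \<Longrightarrow> h x = F (x, 0)"
  shows "(h has_derivative (\<lambda>v. frechet_derivative F (at (p, 0)) (v, 0))) (at p)"
proof -
  have "((\<lambda>x::'a. (x, 0 :: 'a)) has_derivative (\<lambda>v. (v, 0))) (at p)"
    by (auto intro!: derivative_eq_intros)
  from has_derivative_compose[OF this chol_onD(1)[OF U(3,2)]]
  have "((\<lambda>x. F (x, 0)) has_derivative (\<lambda>v. frechet_derivative F (at (p, 0)) (v, 0))) (at p)" .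
  moreover have "open ((\<lambda>x. (x, 0)) -` U)" by (intro open_vimage U(1) continuous_intros)
  ultimately show ?thesis
    by (rule has_derivative_transform_within_open) (use U in auto)
qed

lemma cxan_has_derivative:
  assumes "cxan h p"
  shows "(h has_derivative frechet_derivative h (at p)) (at p)"
proof -
  obtain F U where U: "open U" "(p, 0) \<in> U" "chol_on F U" "\<And>x. (x, 0) \<in> U \<Longrightarrow> h x = F (x, 0)"
    using assms unfolding cxan_def by blast
  have d: "(h has_derivative (\<lambda>v. frechet_derivative F (at (p, 0)) (v, 0))) (at p)"
    by (rule cxan_extension_derivative[OF U(1-3)]) (rule U(4))
  from d show ?thesis unfolding frechet_derivative_at[OF d] .
qed

lemma
  fixes h :: "'a::euclidean_space \<Rightarrow> complex"
  assumes "cxan h p"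
  shows cxan_frechet_derivative [intro]: "cxan (\<lambda>x. frechet_derivative h (at x) v) p"
    and frechet_derivative_commute: "frechet_derivative (\<lambda>x. frechet_derivative h (at x) v) (at p) w =
         frechet_derivative (\<lambda>x. frechet_derivative h (at x) w) (at p) v"
proof -
  obtain F U where U: "open U" "(p, 0) \<in> U" "chol_on F U" "\<And>x. (x, 0) \<in> U \<Longrightarrow> h x = F (x, 0)"
    using assms unfolding cxan_def by blast
  have fd: "frechet_derivative h (at x) v = frechet_derivative F (at (x, 0)) (v, 0)" if "(x, 0) \<in> U" for x v
    by (rule fun_cong[OF frechet_derivative_at[OF cxan_extension_derivative[OF U(1) that U(3,4)], symmetric]])
  note c = chol_on_frechet_derivative[OF U(1,3)]
  show "cxan (\<lambda>x. frechet_derivative h (at x) v) p"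
    unfolding cxan_def
    by (intro exI[of _ "\<lambda>z. frechet_derivative F (at z) (v, 0)"] exI[of _ U]) (use U c fd in auto)
  have fd2: "frechet_derivative (\<lambda>x. frechet_derivative h (at x) v) (at p) w =
      frechet_derivative (\<lambda>z. frechet_derivative F (at z) (v, 0)) (at (p, 0)) (w, 0)" for v w
    by (rule fun_cong[OF frechet_derivative_at[OF cxan_extension_derivative[OF U(1,2) c fd], symmetric]])
  show "frechet_derivative (\<lambda>x. frechet_derivative h (at x) v) (at p) w =
         frechet_derivative (\<lambda>x. frechet_derivative h (at x) w) (at p) v"
    unfolding fd2 by (rule frechet_derivative_chol_commute[OF U(1,3,2)])
qed

section \<open>Vector-valued real-analytic maps\<close>

definition van :: "('b::euclidean_space \<Rightarrow> 'a::euclidean_space) \<Rightarrow> 'b \<Rightarrow> bool" where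
  "van g p \<longleftrightarrow> (\<forall>b\<in>Basis. cxan (\<lambda>x. of_real (g x \<bullet> b)) p)"

lemma chol_on_vhol_combination:
  assumes "finite A" "\<And>b. b \<in> A \<Longrightarrow> chol_on (F b) U"
  shows "vhol_on (\<lambda>z. \<Sum>b\<in>A. cscale (F b z) (v b)) U"
  unfolding vhol_on_def
proof
  fix z assume z: "z \<in> U"
  have "((\<lambda>z. \<Sum>b\<in>A. cscale (F b z) (v b)) has_derivative
      (\<lambda>w. \<Sum>b\<in>A. cscale (frechet_derivative (F b) (at z) w) (v b))) (at z)"
    by (intro has_derivative_sum bounded_linear.has_derivative[OF bounded_linear_cscale_left] chol_onD(1)[OF assms(2) z])
  moreover have "(\<Sum>b\<in>A. cscale (frechet_derivative (F b) (at z) (cscale c w)) (v b)) =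
      cscale c (\<Sum>b\<in>A. cscale (frechet_derivative (F b) (at z) w) (v b))" for c w
    by (simp add: chol_onD(2)[OF assms(2) z] linear_sum[OF bounded_linear.linear[OF bounded_linear_cscale_right]] cscale_cscale)
  ultimately show "\<exists>D. ((\<lambda>z. \<Sum>b\<in>A. cscale (F b z) (v b)) has_derivative D) (at z) \<and> (\<forall>c w. D (cscale c w) = cscale c (D w))"
    by blast
qed

lemma vhol_on_continuous: "vhol_on G U \<Longrightarrow> continuous_on U G"
  unfolding vhol_on_def by (meson continuous_at_imp_continuous_on has_derivative_continuous)

lemma sum_cscale_real:
  fixes x :: "'a::euclidean_space"
  shows "(\<Sum>b\<in>Basis. cscale (of_real (x \<bullet> b)) (b, 0)) = (x, 0)"
proof -
  have "(\<Sum>b\<in>Basis. cscale (of_real (x \<bullet> b)) (b, 0)) = (\<Sum>b\<in>Basis. ((x \<bullet> b) *\<^sub>R b, 0 :: 'a))" by simp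
  also have "\<dots> = (x, 0)" by (simp add: prod_eq_iff fst_sum snd_sum euclidean_representation)
  finally show ?thesis .
qed

text \<open>The components are extended separately and recombined with complex scalars. The
  extension maps real points to real points, which is what lets extensions be composed.\<close>

lemma van_extension:
  fixes g :: "'b::euclidean_space \<Rightarrow> 'a::euclidean_space"
  assumes "van g p"
  shows "\<exists>G U. open U \<and> (p, 0) \<in> U \<and> vhol_on G U \<and> (\<forall>x. (x, 0) \<in> U \<longrightarrow> G (x, 0) = (g x, 0))"
proof -
  have "\<forall>b\<in>Basis. \<exists>F U. open U \<and> (p, 0) \<in> U \<and> chol_on F U \<and> (\<forall>x. (x, 0) \<in> U \<longrightarrow> of_real (g x \<bullet> b) = F (x, 0))"
    using assms unfolding van_def cxan_def by blast
  then obtain F U where FU: "\<And>b. b \<in> Basis \<Longrightarrow> open (U b) \<and> (p, 0) \<in> U b \<and> chol_on (F b) (U b) \<and>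
      (\<forall>x. (x, 0) \<in> U b \<longrightarrow> of_real (g x \<bullet> b) = F b (x, 0))" by metis
  have 1: "vhol_on (\<lambda>z. \<Sum>b\<in>Basis. cscale (F b z) (b, 0 :: 'a)) (\<Inter>b\<in>Basis. U b)"
  proof (rule chol_on_vhol_combination[OF finite_Basis])
    show "chol_on (F b) (\<Inter>b\<in>Basis. U b)" if "b \<in> Basis" for b
      using FU[OF that] by (rule_tac chol_on_subset[of "F b" "U b"]) (use that in auto)
  qed
  have 2: "(\<Sum>b\<in>Basis. cscale (F b (x, 0)) (b, 0 :: 'a)) = (g x, 0)" if "(x, 0) \<in> (\<Inter>b\<in>Basis. U b)" for x
  proof -
    have "(\<Sum>b\<in>Basis. cscale (F b (x, 0)) (b, 0 :: 'a)) = (\<Sum>b\<in>Basis. cscale (of_real (g x \<bullet> b)) (b, 0))"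
      by (rule sum.cong) (use FU that in auto)
    then show ?thesis unfolding sum_cscale_real .
  qed
  have 3: "open (\<Inter>b\<in>Basis. U b)" "(p, 0) \<in> (\<Inter>b\<in>Basis. U b)"
    using FU by (auto intro!: open_INT)
  show ?thesis
    by (intro exI conjI allI impI, rule 3, rule 3, rule 1, rule 2)
qed

lemma cxan_compose:
  assumes g: "van g p" and h: "cxan h (g p)"
  shows "cxan (\<lambda>x. h (g x)) p"
proof -
  obtain G U where U: "open U" "(p, 0) \<in> U" "vhol_on G U" "\<And>x. (x, 0) \<in> U \<Longrightarrow> G (x, 0) = (g x, 0)"
    using van_extension[OF g] by auto
  obtain F V where V: "open V" "(g p, 0) \<in> V" "chol_on F V" "\<And>x. (x, 0) \<in> V \<Longrightarrow> h x = F (x, 0)"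
    using h unfolding cxan_def by blast
  have "open (U \<inter> G -` V)"
    by (rule continuous_open_preimage[OF vhol_on_continuous[OF U(3)] U(1) V(1)])
  moreover have "chol_on (\<lambda>z. F (G z)) (U \<inter> G -` V)"
    by (rule chol_on_compose[OF _ V(3)]) (use U(3) in \<open>auto simp: vhol_on_def\<close>)
  ultimately show ?thesis unfolding cxan_def
    by (intro exI[of _ "\<lambda>z. F (G z)"] exI[of _ "U \<inter> G -` V"]) (use U V in auto)
qed

lemma van_eventually:
  assumes "van g p" shows "\<forall>\<^sub>F q in nhds p. van g q"
  using assms unfolding van_def
  by (intro eventually_ball_finite) (auto intro: cxan_eventually)

section \<open>Identity theorem for analytic functions of one real variable\<close>

lemma cxan_real_extension:
  fixes \<phi> :: "real \<Rightarrow> complex"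
  assumes "cxan \<phi> t"
  shows "\<exists>e>0. \<exists>Z. Z holomorphic_on ball (of_real t) e \<and> (\<forall>x. \<bar>x - t\<bar> < e \<longrightarrow> \<phi> x = Z (of_real x))"
proof -
  obtain F U where U: "open U" "(t, 0) \<in> U" "chol_on F U" "\<And>x. (x, 0) \<in> U \<Longrightarrow> \<phi> x = F (x, 0)"
    using assms unfolding cxan_def by blast
  obtain e where e: "e > 0" "ball (t, 0) e \<subseteq> U" using open_contains_ball[of U] U by blast
  \<comment> \<open>\<open>cscale \<zeta> (1, 0)\<close> identifies the complex plane with the
    complexification of \<open>real\<close>, so an extension to pairs becomes a function of one
    complex variable.\<close>
  define Z where "Z \<zeta> = F (0 + cscale \<zeta> (1, 0))" for \<zeta>
  have mem: "0 + cscale \<zeta> (1, 0) \<in> U" if "\<zeta> \<in> ball (of_real t) e" for \<zeta>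
  proof -
    have "cscale \<zeta> (1, 0) - (t, 0) = cscale (\<zeta> - of_real t) (1, 0)" by (simp add: cscale_def)
    then have "dist (cscale \<zeta> (1, 0)) (t, 0) = cmod (\<zeta> - of_real t)"
      unfolding dist_norm by (simp only: norm_cscale) simp
    then have "cscale \<zeta> (1, 0) \<in> ball (t, 0) e"
      using that by (simp add: dist_commute dist_norm norm_minus_commute)
    then show ?thesis using e by auto
  qed
  show ?thesis
  proof (intro exI[of _ e] exI[of _ Z] conjI allI impI e)
    show "Z holomorphic_on ball (of_real t) e"
      unfolding Z_def by (rule chol_line_holomorphic[OF U(3) mem]) auto
    fix x assume x: "\<bar>x - t\<bar> < e"
    then have "(of_real x :: complex) \<in> ball (of_real t) e"
      by (simp add: dist_norm norm_minus_commute flip: of_real_diff)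
    from mem[OF this] show "\<phi> x = Z (of_real x)"
      using U(4)[of x] by (simp add: Z_def del: cscale_simps(4)) (simp add: cscale_def)
  qed
qed

text \<open>Real zeros accumulate at \<open>y\<close>, so the identity theorem on the disc
  applies.\<close>

lemma holomorphic_zero_near_real:
  assumes Z: "Z holomorphic_on ball (of_real t) e" and y: "\<bar>y - t\<bar> < e"
    and "\<forall>\<^sub>F x in nhds y. Z (of_real x) = 0" and w: "w \<in> ball (of_real t) e"
  shows "Z w = 0"
proof -
  obtain d where d: "d > 0" "\<And>x. \<bar>x - y\<bar> < d \<Longrightarrow> Z (of_real x) = 0"
    using assms(3) unfolding eventually_nhds_metric dist_real_def by blast
  define U :: "complex set" where "U = of_real ` {x. \<bar>x - y\<bar> < d \<and> \<bar>x - t\<bar> < e}"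
  have of_real_mem: "(of_real x :: complex) \<in> ball (of_real t) e" if "\<bar>x - t\<bar> < e" for x
    using that by (simp add: dist_norm norm_minus_commute flip: of_real_diff)
  show ?thesis
  proof (rule analytic_continuation[OF Z open_ball connected_ball])
    show "U \<subseteq> ball (of_real t) e" using of_real_mem by (auto simp: U_def)
    show "(of_real y :: complex) \<in> ball (of_real t) e" by (rule of_real_mem[OF y])
    show "(of_real y :: complex) islimpt U"
      unfolding islimpt_approachable
    proof (intro allI impI)
      fix \<delta> :: real assume \<delta>: "\<delta> > 0"
      define s where "s = min (min \<delta> d) (e - \<bar>y - t\<bar>) / 2"
      have s: "0 < s" "s < \<delta>" "s < d" "s < e - \<bar>y - t\<bar>"
        using \<delta> d(1) y by (auto simp: s_def min_def field_simps)
      have "of_real (y + s) \<in> U"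
        unfolding U_def by (rule imageI) (use s in \<open>simp add: abs_if split: if_splits\<close>)
      moreover have "dist (of_real (y + s)) (of_real y :: complex) < \<delta>"
        using s by (simp add: dist_norm)
      ultimately show "\<exists>x'\<in>U. x' \<noteq> of_real y \<and> dist x' (of_real y) < \<delta>"
        using s by (intro bexI[of _ "of_real (y + s)"]) auto
    qed
  qed (use d w in \<open>auto simp: U_def\<close>)
qed

text \<open>Vanishing near a point is a locally constant property on the interval, because near each
  point \<open>\<phi>\<close> is the trace of a function holomorphic on a disc; connectedness
  spreads it from \<open>t0\<close>.\<close>

lemma cxan_zero_on_interval:
  fixes \<phi> :: "real \<Rightarrow> complex"
  assumes an: "\<And>t. t \<in> {a..b} \<Longrightarrow> cxan \<phi> t" and z: "t0 \<in> {a..b}" "\<forall>\<^sub>F x in nhds t0. \<phi> x = 0"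
    and t: "t \<in> {a..b}"
  shows "\<phi> t = 0"
proof -
  have "\<forall>\<^sub>F x in nhds t. \<phi> x = 0"
  proof (rule connected_induction_simple[where S = "{a..b}" and P = "\<lambda>t. \<forall>\<^sub>F x in nhds t. \<phi> x = 0", OF _ z(1) t z(2)])
    fix s assume "s \<in> {a..b}"
    from cxan_real_extension[OF an[OF this]] obtain e Z where e: "e > 0"
      "Z holomorphic_on ball (of_real s) e" "\<And>x. \<bar>x - s\<bar> < e \<Longrightarrow> \<phi> x = Z (of_real x)" by blast
    have near: "\<forall>\<^sub>F x' in nhds x. \<bar>x' - s\<bar> < e" if "\<bar>x - s\<bar> < e" for x
      using that by (intro eventually_nhds_in_open[of "{x. \<bar>x - s\<bar> < e}" x, simplified] open_Collect_less continuous_intros)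
    have "\<forall>\<^sub>F x in nhds y. \<phi> x = 0" if x: "\<bar>x - s\<bar> < e" and y: "\<bar>y - s\<bar> < e" and P: "\<forall>\<^sub>F x in nhds x. \<phi> x = 0" for x y
    proof -
      have "\<forall>\<^sub>F x in nhds x. Z (of_real x) = 0"
        using P near[OF x] by eventually_elim (use e(3) in auto)
      note Z0 = holomorphic_zero_near_real[OF e(2) x this]
      show ?thesis using near[OF y]
      proof eventually_elim
        case (elim x)
        have "(of_real x :: complex) \<in> ball (of_real s) e"
          using elim by (simp add: dist_norm norm_minus_commute flip: of_real_diff)
        from Z0[OF this] e(3)[OF elim] show ?case by simp
      qed
    qed
    then show "\<exists>T. openin (top_of_set {a..b}) T \<and> s \<in> T \<and> (\<forall>x\<in>T. \<forall>y\<in>T. (\<forall>\<^sub>F x in nhds x. \<phi> x = 0) \<longrightarrow> (\<forall>\<^sub>F x in nhds y. \<phi> x = 0))"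
      using \<open>s \<in> {a..b}\<close> e(1)
      by (intro exI[of _ "{a..b} \<inter> ball s e"]) (auto simp: dist_real_def abs_minus_commute openin_open)
  qed auto
  then show ?thesis by (rule eventually_nhds_x_imp_x)
qed

text \<open>The \<open>\<phi> k\<close> play the role of iterated derivatives. The neighbourhood on
  which \<open>\<phi> (Suc k)\<close> differentiates \<open>\<phi> k\<close> may shrink with
  \<open>k\<close>, so only the values at \<open>t\<close> are used: they are the derivatives of the
  extension \<open>Z\<close> at the centre of its disc.\<close>

lemma cxan_zero_if_derivs_zero:
  fixes \<phi> :: "nat \<Rightarrow> real \<Rightarrow> complex"
  assumes an: "cxan (\<phi> 0) t" and z: "\<And>k. \<phi> k t = 0"
    and d: "\<And>k. \<forall>\<^sub>F x in nhds t. (\<phi> k has_vector_derivative \<phi> (Suc k) x) (at x)"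
  shows "\<forall>\<^sub>F x in nhds t. \<phi> 0 x = 0"
proof -
  from cxan_real_extension[OF an] obtain e Z where e: "e > 0"
    "Z holomorphic_on ball (of_real t) e" "\<And>x. \<bar>x - t\<bar> < e \<Longrightarrow> \<phi> 0 x = Z (of_real x)" by blast
  have near: "\<forall>\<^sub>F x in nhds t. \<bar>x - t\<bar> < e"
    using e by (intro eventually_nhds_in_open[of "{x. \<bar>x - t\<bar> < e}" t, simplified] open_Collect_less continuous_intros)
  have of_real_mem: "(of_real x :: complex) \<in> ball (of_real t) e" if "\<bar>x - t\<bar> < e" for x
    using that by (simp add: dist_norm norm_minus_commute flip: of_real_diff)
  have der: "\<forall>\<^sub>F x in nhds t. (deriv ^^ k) Z (of_real x) = \<phi> k x" for k
  proof (induction k)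
    case 0
    show ?case using near by eventually_elim (use e(3) in auto)
  next
    case (Suc k)
    have "\<forall>\<^sub>F x in nhds t. \<forall>\<^sub>F x' in nhds x. (deriv ^^ k) Z (of_real x') = \<phi> k x'"
      using Suc by (simp add: eventually_eventually)
    with near d[of k] show ?case
    proof eventually_elim
      case (elim x)
      have "((deriv ^^ k) Z has_field_derivative deriv ((deriv ^^ k) Z) (of_real x)) (at (of_real x))"
        by (rule holomorphic_derivI[OF holomorphic_higher_deriv[OF e(2) open_ball] open_ball of_real_mem[OF elim(1)]])
      then have "((\<lambda>x. (deriv ^^ k) Z (of_real x)) has_vector_derivative deriv ((deriv ^^ k) Z) (of_real x)) (at x)"
        by (rule has_vector_derivative_real_field)
      moreover obtain N where N: "open N" "x \<in> N" "\<And>x'. x' \<in> N \<Longrightarrow> (deriv ^^ k) Z (of_real x') = \<phi> k x'"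
        using elim(3) unfolding eventually_nhds by blast
      ultimately have "(\<phi> k has_vector_derivative deriv ((deriv ^^ k) Z) (of_real x)) (at x)"
        by (blast intro: has_vector_derivative_transform_within_open[OF _ N(1,2)] N(3))
      from vector_derivative_unique_at[OF this elim(2)] show ?case by simp
    qed
  qed
  have "(deriv ^^ k) Z (of_real t) = 0" for k
    using eventually_nhds_x_imp_x[OF der[of k]] z by simp
  then have "Z w = 0" if "w \<in> ball (of_real t) e" for w
    using holomorphic_fun_eq_0_on_ball[OF e(2) that] by blast
  then show ?thesis using near by (auto elim!: eventually_mono simp: e(3) of_real_mem simp del: mem_ball)
qed

lemma van_intros [intro]:
  "van (\<lambda>x. c) p" "van (\<lambda>x. x) p"
  by (auto simp: van_def)

lemma van_inner: "van g p \<Longrightarrow> cxan (\<lambda>x. of_real (g x \<bullet> v)) p"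
proof -
  assume g: "van g p"
  have "cxan (\<lambda>x. \<Sum>b\<in>Basis. of_real (g x \<bullet> b) * of_real (v \<bullet> b)) p"
    using g by (intro cxan_sum cxan_mult cxan_const) (auto simp: van_def)
  moreover have "(\<Sum>b\<in>Basis. of_real (g x \<bullet> b) * of_real (v \<bullet> b)) = (of_real (g x \<bullet> v) :: complex)" for x
    by (subst (3) euclidean_inner) simp
  ultimately show ?thesis by simp
qed

lemma van_add [intro]: "van f p \<Longrightarrow> van g p \<Longrightarrow> van (\<lambda>x. f x + g x) p"
  unfolding van_def by (auto simp: inner_left_distrib)

lemma van_diff [intro]: "van f p \<Longrightarrow> van g p \<Longrightarrow> van (\<lambda>x. f x - g x) p"
  unfolding van_def by (auto simp: inner_diff_left)

lemma van_scaleR [intro]: "cxan (\<lambda>x. of_real (a x)) p \<Longrightarrow> van g p \<Longrightarrow> van (\<lambda>x. a x *\<^sub>R g x) p"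
  unfolding van_def by auto

lemma van_sum [intro]: "(\<And>i. i \<in> A \<Longrightarrow> van (f i) p) \<Longrightarrow> van (\<lambda>x. \<Sum>i\<in>A. f i x) p"
  by (induction A rule: infinite_finite_induct) auto

lemma van_linear:
  fixes L :: "'a::euclidean_space \<Rightarrow> 'b::euclidean_space"
  assumes "linear L"
  shows "van L p"
proof -
  have "van (\<lambda>x. \<Sum>b\<in>Basis. (x \<bullet> b) *\<^sub>R L b) p" by (intro van_sum van_scaleR van_intros cxan_inner)
  moreover have "(\<Sum>b\<in>Basis. (x \<bullet> b) *\<^sub>R L b) = L x" for x
    using linear_sum[OF assms, of "\<lambda>b. (x \<bullet> b) *\<^sub>R b" Basis] by (simp add: euclidean_representation linear_scale[OF assms])
  ultimately show ?thesis by simp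
qed

lemma van_compose:
  assumes "van g p" "van f (g p)"
  shows "van (\<lambda>x. f (g x)) p"
  using assms(2) cxan_compose[OF assms(1)] unfolding van_def by blast

lemma van_cong: "\<forall>\<^sub>F x in nhds p. f x = g x \<Longrightarrow> van f p \<Longrightarrow> van g p"
  unfolding van_def by (auto elim!: cxan_cong[rotated] eventually_mono)

lemma van_has_derivative:
  fixes g :: "'a::euclidean_space \<Rightarrow> 'b::euclidean_space"
  assumes "van g p"
  shows "(g has_derivative frechet_derivative g (at p)) (at p)"
proof -
  have "g differentiable at p"
    unfolding differentiable_componentwise_within[of g]
  proof
    fix b :: 'b assume "b \<in> Basis"
    then have "((\<lambda>x. of_real (g x \<bullet> b) :: complex) has_derivative frechet_derivative (\<lambda>x. of_real (g x \<bullet> b) :: complex) (at p)) (at p)"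
      using assms unfolding van_def by (blast intro: cxan_has_derivative)
    from bounded_linear.has_derivative[OF bounded_linear_Re this]
    show "(\<lambda>x. g x \<bullet> b) differentiable at p" unfolding differentiable_def by auto
  qed
  then show ?thesis by (simp add: frechet_derivative_works)
qed

lemma frechet_derivative_of_real:
  fixes r :: "'a::euclidean_space \<Rightarrow> real"
  assumes "cxan (\<lambda>x. of_real (r x)) p"
  shows "(r has_derivative frechet_derivative r (at p)) (at p)"
    and "frechet_derivative (\<lambda>x. of_real (r x) :: complex) (at p) v = of_real (frechet_derivative r (at p) v)"
proof -
  from bounded_linear.has_derivative[OF bounded_linear_Re cxan_has_derivative[OF assms]]
  have "r differentiable at p" unfolding differentiable_def by auto
  then show d: "(r has_derivative frechet_derivative r (at p)) (at p)"
    by (simp add: frechet_derivative_works)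
  from frechet_derivative_at[OF bounded_linear.has_derivative[OF bounded_linear_of_real d]]
  show "frechet_derivative (\<lambda>x. of_real (r x) :: complex) (at p) v = of_real (frechet_derivative r (at p) v)"
    by metis
qed

lemma van_frechet_derivative:
  fixes g :: "'a::euclidean_space \<Rightarrow> 'b::euclidean_space"
  assumes "van g p"
  shows "van (\<lambda>x. frechet_derivative g (at x) v) p"
  unfolding van_def
proof
  fix b :: 'b assume b: "b \<in> Basis"
  then have c: "cxan (\<lambda>x. of_real (g x \<bullet> b)) p" using assms by (auto simp: van_def)
  show "cxan (\<lambda>x. of_real (frechet_derivative g (at x) v \<bullet> b)) p"
  proof (rule cxan_cong[OF _ cxan_frechet_derivative[OF c, of v]])
    show "\<forall>\<^sub>F x in nhds p. frechet_derivative (\<lambda>x. of_real (g x \<bullet> b)) (at x) v = of_real (frechet_derivative g (at x) v \<bullet> b)"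
      using van_eventually[OF assms]
    proof eventually_elim
      case (elim x)
      have "((\<lambda>x. of_real (g x \<bullet> b)) has_derivative (\<lambda>v. of_real (frechet_derivative g (at x) v \<bullet> b))) (at x)"
        by (intro derivative_intros van_has_derivative elim)
      from frechet_derivative_at[OF this] show ?case by metis
    qed
  qed
qed

lemma cxan_frechet_derivative_vec:
  assumes h: "cxan h p" and X: "van X p"
  shows "cxan (\<lambda>q. frechet_derivative h (at q) (X q)) p"
proof (rule cxan_cong)
  show "cxan (\<lambda>q. \<Sum>b\<in>Basis. of_real (X q \<bullet> b) * frechet_derivative h (at q) b) p"
    using h X by (intro cxan_sum cxan_mult) (auto simp: van_def)
  show "\<forall>\<^sub>F q in nhds p. (\<Sum>b\<in>Basis. of_real (X q \<bullet> b) * frechet_derivative h (at q) b) = frechet_derivative h (at q) (X q)"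
    using cxan_eventually[OF h]
  proof eventually_elim
    case (elim q)
    have l: "linear (frechet_derivative h (at q))"
      using cxan_has_derivative[OF elim] by (rule has_derivative_linear)
    have "frechet_derivative h (at q) (X q) = frechet_derivative h (at q) (\<Sum>b\<in>Basis. (X q \<bullet> b) *\<^sub>R b)"
      by (simp add: euclidean_representation)
    also have "\<dots> = (\<Sum>b\<in>Basis. of_real (X q \<bullet> b) * frechet_derivative h (at q) b)"
      by (simp add: linear_sum[OF l] linear_scale[OF l] scaleR_conv_of_real)
    finally show ?case by simp
  qed
qed

lemma van_frechet_derivative_vec:
  fixes g :: "'a::euclidean_space \<Rightarrow> 'b::euclidean_space"
  assumes h: "van g p" and X: "van X p"
  shows "van (\<lambda>q. frechet_derivative g (at q) (X q)) p"
proof (rule van_cong)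
  show "van (\<lambda>q. \<Sum>b\<in>Basis. (X q \<bullet> b) *\<^sub>R frechet_derivative g (at q) b) p"
    using h X by (intro van_sum van_scaleR van_inner van_frechet_derivative)
  show "\<forall>\<^sub>F q in nhds p. (\<Sum>b\<in>Basis. (X q \<bullet> b) *\<^sub>R frechet_derivative g (at q) b) = frechet_derivative g (at q) (X q)"
    using van_eventually[OF h]
  proof eventually_elim
    case (elim q)
    have l: "linear (frechet_derivative g (at q))"
      using van_has_derivative[OF elim] by (rule has_derivative_linear)
    have "frechet_derivative g (at q) (X q) = frechet_derivative g (at q) (\<Sum>b\<in>Basis. (X q \<bullet> b) *\<^sub>R b)"
      by (simp add: euclidean_representation)
    also have "\<dots> = (\<Sum>b\<in>Basis. (X q \<bullet> b) *\<^sub>R frechet_derivative g (at q) b)"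
      by (simp add: linear_sum[OF l] linear_scale[OF l])
    finally show ?case by simp
  qed
qed

lemma frechet_derivative_commute_vec:
  fixes g :: "'a::euclidean_space \<Rightarrow> 'b::euclidean_space"
  assumes g: "van g p"
  shows "frechet_derivative (\<lambda>x. frechet_derivative g (at x) v) (at p) w =
         frechet_derivative (\<lambda>x. frechet_derivative g (at x) w) (at p) v"
proof -
  have *: "of_real (frechet_derivative (\<lambda>x. frechet_derivative g (at x) v) (at p) w \<bullet> b) =
     frechet_derivative (\<lambda>x. frechet_derivative (\<lambda>x. of_real (g x \<bullet> b) :: complex) (at x) v) (at p) w"
    if b: "b \<in> Basis" for b v w
  proof -
    have d1: "((\<lambda>x. of_real (frechet_derivative g (at x) v \<bullet> b) :: complex) has_derivative
        (\<lambda>w. of_real (frechet_derivative (\<lambda>x. frechet_derivative g (at x) v) (at p) w \<bullet> b))) (at p)"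
      by (intro derivative_intros van_has_derivative van_frechet_derivative g)
    have ev: "\<forall>\<^sub>F x in nhds p. of_real (frechet_derivative g (at x) v \<bullet> b) =
       frechet_derivative (\<lambda>x. of_real (g x \<bullet> b) :: complex) (at x) v"
      using van_eventually[OF g]
    proof eventually_elim
      case (elim x)
      have "((\<lambda>x. of_real (g x \<bullet> b)) has_derivative (\<lambda>v. of_real (frechet_derivative g (at x) v \<bullet> b))) (at x)"
        by (intro derivative_intros van_has_derivative elim)
      from frechet_derivative_at[OF this] show ?case by metis
    qed
    obtain N where N: "open N" "p \<in> N" "\<And>x. x \<in> N \<Longrightarrow> of_real (frechet_derivative g (at x) v \<bullet> b) =
       frechet_derivative (\<lambda>x. of_real (g x \<bullet> b) :: complex) (at x) v"
      using ev unfolding eventually_nhds by blast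
    have "((\<lambda>x. frechet_derivative (\<lambda>x. of_real (g x \<bullet> b) :: complex) (at x) v) has_derivative
        (\<lambda>w. of_real (frechet_derivative (\<lambda>x. frechet_derivative g (at x) v) (at p) w \<bullet> b))) (at p)"
      by (rule has_derivative_transform_within_open[OF d1 N(1,2)]) (rule N(3))
    from frechet_derivative_at[OF this] show ?thesis by metis
  qed
  show ?thesis
  proof (rule euclidean_eqI)
    fix b :: 'b assume b: "b \<in> Basis"
    have "cxan (\<lambda>x. of_real (g x \<bullet> b)) p" using g b by (auto simp: van_def)
    from frechet_derivative_commute[OF this, of v w] *[OF b, of v w] *[OF b, of w v]
    show "frechet_derivative (\<lambda>x. frechet_derivative g (at x) v) (at p) w \<bullet> b =
         frechet_derivative (\<lambda>x. frechet_derivative g (at x) w) (at p) v \<bullet> b"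
      by (metis of_real_eq_iff)
  qed
qed

text \<open>Here the real space underlying \<open>complex ^ 'n\<close> is itself complexified. The
  map \<open>T\<close>, sending \<open>(x, y)\<close> to \<open>x + \<i> *s y\<close>, is complex
  linear and the identity on real points, so \<open>f\<close> composed with \<open>T\<close> is an
  extension.\<close>

lemma cxan_holomorphic:
  fixes f :: "complex ^ 'n \<Rightarrow> complex"
  assumes f: "holomorphic_cn_on f U" "open U" "p \<in> U"
  shows "cxan f p"
proof -
  define T where "T z = fst z + \<i> *s snd z" for z :: "(complex ^ 'n) \<times> (complex ^ 'n)"
  have bl: "bounded_linear T"
  proof (rule bounded_linear_intro[where K = 2])
    have n: "norm (\<i> *s x) = norm x" for x :: "complex ^ 'n" by (simp add: norm_vec_def norm_mult)
    show "norm (T z) \<le> norm z * 2" for z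
      using norm_triangle_ineq[of "fst z" "\<i> *s snd z"] norm_fst_le[of "fst z" "snd z"] norm_snd_le[of "snd z" "fst z"]
      by (simp add: T_def n)
  qed (auto simp: T_def vec_eq_iff algebra_simps)
  have T: "T (cscale c v) = c *s T v" for c v
    by (auto simp: T_def cscale_def vec_eq_iff complex_eq_iff algebra_simps)
  have "open (T -` U)" by (intro open_vimage f linear_continuous_on bl)
  moreover have "chol_on (\<lambda>z. f (T z)) (T -` U)"
    unfolding chol_on_def
  proof
    fix z assume "z \<in> T -` U"
    then obtain D where D: "(f has_derivative D) (at (T z))" "\<forall>c v. D (c *s v) = c * D v"
      using f(1) unfolding holomorphic_cn_on_def by auto
    show "\<exists>D. ((\<lambda>z. f (T z)) has_derivative D) (at z) \<and> (\<forall>c v. D (cscale c v) = c * D v)"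
      by (intro exI[of _ "\<lambda>v. D (T v)"] conjI allI)
        (rule has_derivative_compose[OF bounded_linear_imp_has_derivative[OF bl] D(1)], simp only: T D(2))
  qed
  ultimately show ?thesis unfolding cxan_def
    by (intro exI[of _ "\<lambda>z. f (T z)"] exI[of _ "T -` U"]) (use f in \<open>auto simp: T_def\<close>)
qed

section \<open>Analytic solutions of differential equations\<close>

text \<open>Differentiation under the integral sign: the Taylor bound is uniform in
  \<open>t\<close>, so it integrates to a quadratic bound for the integral.\<close>

lemma chol_on_integral:
  fixes K :: "real \<Rightarrow> 'a::euclidean_space \<times> 'a \<Rightarrow> complex"
  assumes U: "open U" and K: "\<And>t. t \<in> {0..1} \<Longrightarrow> chol_on (K t) U"
    and cont: "\<And>z. z \<in> U \<Longrightarrow> continuous_on {0..1} (\<lambda>t. K t z)"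
    and B: "\<And>t z. t \<in> {0..1} \<Longrightarrow> z \<in> U \<Longrightarrow> cmod (K t z) \<le> B"
  shows "chol_on (\<lambda>z. integral {0..1} (\<lambda>t. K t z)) U"
  unfolding chol_on_def
proof
  fix z assume z: "z \<in> U"
  obtain R where R: "R > 0" and RU: "ball z R \<subseteq> U" using open_contains_ball[of U] U z by blast
  define D where "D t v = frechet_derivative (K t) (at z) v" for t v
  have KR: "chol_on (K t) (ball z R)" if "t \<in> {0..1}" for t
    by (rule chol_on_subset[OF K[OF that] RU])
  have Dbound: "cmod (D t v) \<le> 2 * B / R * norm v" if "t \<in> {0..1}" for t v
    using chol_deriv_bound[OF KR[OF that] R B[OF that subsetD[OF RU]], of v] by (simp add: D_def)
  have tay: "cmod (K t (z + h) - K t z - D t h) \<le> 8 * B / R\<^sup>2 * (norm h)\<^sup>2"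
    if "t \<in> {0..1}" "norm h < R / 2" for t h
    unfolding D_def by (rule chol_taylor_bound[OF KR[OF that(1)] R _ that(2)]) (use B[OF that(1)] RU in auto)
  have Dlin: "linear (D t)" if "t \<in> {0..1}" for t
    using has_derivative_linear[OF chol_onD(1)[OF K[OF that] z]] by (simp add: D_def[abs_def])
  have Dcs: "D t (cscale c v) = c * D t v" if "t \<in> {0..1}" for t c v
    using chol_onD(2)[OF K[OF that] z] by (simp add: D_def)
  \<comment> \<open>Continuity in \<open>t\<close> is assumed for \<open>K\<close> only. It passes
    to the derivatives because they are limits, uniform in \<open>t\<close>, of difference quotients
    of \<open>K\<close>.\<close>
  have Dcont: "continuous_on {0..1} (\<lambda>t. D t v)" for v
  proof (rule uniform_limit_theorem[where F = "at_right (0 :: real)"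
        and f = "\<lambda>h t. (K t (z + h *\<^sub>R v) - K t z) /\<^sub>R h"])
    define \<delta> where "\<delta> = R / (2 * (norm v + 1))"
    have nv: "norm v + 1 > 0" by (simp add: add_nonneg_pos)
    have \<delta>: "\<delta> > 0" using R nv by (simp add: \<delta>_def)
    have small: "norm (h *\<^sub>R v) < R / 2" if "0 < h" "h < \<delta>" for h
    proof -
      have "norm (h *\<^sub>R v) \<le> h * (norm v + 1)" using that by simp
      also have "\<dots> < \<delta> * (norm v + 1)" using that nv by (intro mult_strict_right_mono) auto
      also have "\<dots> = R / 2" using nv by (simp add: \<delta>_def field_simps)
      finally show ?thesis .
    qed
    have ev: "\<forall>\<^sub>F h in at_right 0. 0 < h \<and> h < \<delta>"
      using \<delta> by (auto simp: eventually_at_right_field)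
    show "\<forall>\<^sub>F h in at_right 0. continuous_on {0..1} (\<lambda>t. (K t (z + h *\<^sub>R v) - K t z) /\<^sub>R h)"
      using ev
    proof eventually_elim
      case (elim h)
      have "z + h *\<^sub>R v \<in> ball z R" using small[of h] elim R by (simp add: dist_norm del: norm_scaleR)
      then show ?case using RU by (intro continuous_intros cont z) auto
    qed
    show "uniform_limit {0..1} (\<lambda>h t. (K t (z + h *\<^sub>R v) - K t z) /\<^sub>R h) (\<lambda>t. D t v) (at_right 0)"
    proof (rule uniform_limitI)
      fix e :: real assume e: "e > 0"
      define C where "C = 8 * B / R\<^sup>2 * (norm v)\<^sup>2"
      have "((\<lambda>t. C * t) \<longlongrightarrow> C * 0) (at_right 0)" by (intro tendsto_intros)
      then have "\<forall>\<^sub>F t in at_right 0. C * t < e" using e by (auto dest: order_tendstoD)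
      with ev show "\<forall>\<^sub>F h in at_right 0. \<forall>t\<in>{0..1}. dist ((K t (z + h *\<^sub>R v) - K t z) /\<^sub>R h) (D t v) < e"
      proof (eventually_elim, intro ballI)
        fix h t assume h: "0 < h \<and> h < \<delta>" "C * h < e" and t: "t \<in> {0..1::real}"
        have "(K t (z + h *\<^sub>R v) - K t z) /\<^sub>R h - D t v
            = inverse h *\<^sub>R (K t (z + h *\<^sub>R v) - K t z - D t (h *\<^sub>R v))"
          using h by (simp add: linear_scale[OF Dlin[OF t]] algebra_simps)
        moreover have "norm (inverse h *\<^sub>R X) \<le> inverse h * Y" if "norm X \<le> Y" for X :: complex and Y
          using h that by (simp add: mult_left_mono)
        ultimately have "dist ((K t (z + h *\<^sub>R v) - K t z) /\<^sub>R h) (D t v)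
            \<le> inverse h * (8 * B / R\<^sup>2 * (norm (h *\<^sub>R v))\<^sup>2)"
          using tay[OF t small, of h] h unfolding dist_norm by metis
        also have "\<dots> = C * h" using h by (simp add: C_def power2_eq_square field_simps)
        finally show "dist ((K t (z + h *\<^sub>R v) - K t z) /\<^sub>R h) (D t v) < e" using h by simp
      qed
    qed
  qed auto
  have Dint: "(\<lambda>t. D t v) integrable_on {0..1}" for v
    by (rule integrable_continuous_real[OF Dcont])
  have Kint: "(\<lambda>t. K t z) integrable_on {0..1}" if "z \<in> U" for z
    by (rule integrable_continuous_real[OF cont[OF that]])
  define E where "E v = integral {0..1} (\<lambda>t. D t v)" for v
  have Ecs: "E (cscale c v) = c * E v" for c v
  proof -
    have "E (cscale c v) = integral {0..1} (\<lambda>t. c * D t v)"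
      unfolding E_def by (rule integral_cong) (simp add: Dcs)
    then show ?thesis by (simp add: E_def)
  qed
  have "bounded_linear E"
  proof (rule bounded_linear_intro[where K = "2 * B / R"])
    show "E (v + w) = E v + E w" for v w
    proof -
      have "E (v + w) = integral {0..1} (\<lambda>t. D t v + D t w)"
        unfolding E_def by (rule integral_cong) (simp add: linear_add[OF Dlin])
      then show ?thesis by (simp add: E_def integral_add Dint)
    qed
    show "E (r *\<^sub>R v) = r *\<^sub>R E v" for r v
      using Ecs[of "of_real r" v] by (simp add: scaleR_conv_of_real)
    show "norm (E v) \<le> norm v * (2 * B / R)" for v
      using integral_bound[OF zero_le_one Dcont, of v "2 * B / R * norm v"] Dbound
      by (simp add: E_def mult.commute)
  qed
  then have "((\<lambda>z. integral {0..1} (\<lambda>t. K t z)) has_derivative E) (at z)"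
  proof (rule has_derivativeI_quadratic[where \<delta> = "R / 2"])
    fix h :: "'a \<times> 'a" assume h: "norm h < R / 2"
    then have "z + h \<in> ball z R" using R by (simp add: dist_norm)
    then have zh: "z + h \<in> U" using RU by blast
    have "integral {0..1} (\<lambda>t. K t (z + h)) - integral {0..1} (\<lambda>t. K t z) - E h =
        integral {0..1} (\<lambda>t. K t (z + h) - K t z - D t h)"
      by (simp add: E_def integral_diff integrable_diff Kint[OF zh] Kint[OF z] Dint)
    also have "norm \<dots> \<le> 8 * B / R\<^sup>2 * (norm h)\<^sup>2 * (1 - 0)"
      by (rule integral_bound) (use tay h in \<open>auto intro!: continuous_intros cont zh z Dcont\<close>)
    finally show "norm (integral {0..1} (\<lambda>t. K t (z + h)) - integral {0..1} (\<lambda>t. K t z) - E h)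
        \<le> 8 * B / R\<^sup>2 * (norm h)\<^sup>2" by simp
  qed (use R in auto)
  with Ecs show "\<exists>D. ((\<lambda>z. integral {0..1} (\<lambda>t. K t z)) has_derivative D) (at z) \<and> (\<forall>c v. D (cscale c v) = c * D v)"
    by blast
qed

text \<open>Cauchy bounds the derivative on a smaller ball, and convexity turns this into a
  Lipschitz bound. Stating it for all small radii lets finitely many functions share one
  radius.\<close>

lemma chol_on_lipschitz:
  assumes U: "open U" "P \<in> U" and F: "chol_on F U"
  shows "\<exists>L\<ge>0. \<forall>\<^sub>F R in at_right 0. \<forall>q\<in>ball P R. \<forall>q'\<in>ball P R. cmod (F q - F q') \<le> L * norm (q - q')"
proof -
  obtain R0 where R0: "R0 > 0" and KU: "cball P R0 \<subseteq> U" using open_contains_cball[of U] U by blast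
  have "compact (F ` cball P R0)"
    by (intro compact_continuous_image continuous_on_subset[OF chol_on_continuous[OF F] KU]) auto
  then obtain B where B: "\<forall>w\<in>cball P R0. cmod (F w) \<le> B"
    using compact_imp_bounded bounded_iff by (metis imageI)
  have B0: "B \<ge> 0" using B R0 norm_ge_zero order_trans by (metis centre_in_cball less_imp_le)
  define R where "R = R0 / 2"
  have R: "R > 0" using R0 by (simp add: R_def)
  have sub: "ball q R \<subseteq> cball P R0" if "q \<in> ball P R" for q
  proof
    fix y assume "y \<in> ball q R"
    then show "y \<in> cball P R0" using that dist_triangle[of P y q] by (auto simp: R_def)
  qed
  have lip: "cmod (F q - F q') \<le> 2 * B / R * norm (q - q')" if "q \<in> ball P R" "q' \<in> ball P R" for q q'
  proof (rule differentiable_bound[OF convex_ball _ _ that])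
    fix x assume x: "x \<in> ball P R"
    have "x \<in> ball x R" using R by simp
    then have xU: "x \<in> U" using sub[OF x] KU by blast
    show "(F has_derivative frechet_derivative F (at x)) (at x within ball P R)"
      by (rule has_derivative_at_withinI[OF chol_onD(1)[OF F xU]])
    show "onorm (frechet_derivative F (at x)) \<le> 2 * B / R"
    proof (rule onorm_bound)
      show "0 \<le> 2 * B / R" using B0 R by simp
      show "cmod (frechet_derivative F (at x) v) \<le> 2 * B / R * norm v" for v
        using chol_deriv_bound[OF chol_on_subset[OF F subset_trans[OF sub[OF x] KU]] R, of B v]
          B[rule_format, OF subsetD[OF sub[OF x]]] by simp
    qed
  qed
  have "\<forall>\<^sub>F r in at_right 0. r < R" using R by (auto simp: eventually_at_right_field)
  then show ?thesis
    by (intro exI[of _ "2 * B / R"] conjI) (use B0 R in simp, elim eventually_mono, use lip in auto)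
qed

lemma vhol_on_iff: "vhol_on G U \<longleftrightarrow> (\<forall>b\<in>Basis. chol_on (\<lambda>z. ccoord b (G z)) U)"
proof
  assume "vhol_on G U"
  then show "\<forall>b\<in>Basis. chol_on (\<lambda>z. ccoord b (G z)) U"
    using chol_on_compose[OF _ chol_on_ccoord[of _ UNIV]] by blast
next
  assume *: "\<forall>b\<in>Basis. chol_on (\<lambda>z. ccoord b (G z)) U"
  have "vhol_on (\<lambda>z. \<Sum>b\<in>Basis. cscale (ccoord b (G z)) (b, 0)) U"
    by (rule chol_on_vhol_combination) (use * in auto)
  moreover have "(\<Sum>b\<in>Basis. cscale (ccoord b v) (b, 0)) = v" for v :: "'b \<times> 'b"
    by (simp add: cscale_def ccoord_def prod_eq_iff fst_sum snd_sum euclidean_representation)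
  ultimately show "vhol_on G U" by simp
qed

lemma vhol_on_compose:
  assumes "vhol_on G U" "vhol_on F V" "\<And>z. z \<in> U \<Longrightarrow> G z \<in> V"
  shows "vhol_on (\<lambda>z. F (G z)) U"
  using chol_on_compose[OF assms(1) _ assms(3)] assms(2) by (auto simp: vhol_on_iff)

lemma vhol_on_subset: "vhol_on F U \<Longrightarrow> V \<subseteq> U \<Longrightarrow> vhol_on F V"
  unfolding vhol_on_def by blast

lemma vhol_on_lipschitz:
  assumes U: "open U" "P \<in> U" and F: "vhol_on F U"
  shows "\<exists>L\<ge>0. \<forall>\<^sub>F R in at_right 0. \<forall>q\<in>ball P R. \<forall>q'\<in>ball P R. norm (F q - F q') \<le> L * norm (q - q')"
proof -
  have "\<forall>b\<in>Basis. \<exists>L\<ge>0. \<forall>\<^sub>F R in at_right 0. \<forall>q\<in>ball P R. \<forall>q'\<in>ball P R.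
      cmod (ccoord b (F q) - ccoord b (F q')) \<le> L * norm (q - q')"
    by (intro ballI chol_on_lipschitz[OF U]) (use F in \<open>auto simp: vhol_on_iff\<close>)
  then obtain L where L: "\<And>b. b \<in> Basis \<Longrightarrow> L b \<ge> 0" "\<And>b. b \<in> Basis \<Longrightarrow>
      \<forall>\<^sub>F R in at_right 0. \<forall>q\<in>ball P R. \<forall>q'\<in>ball P R.
      cmod (ccoord b (F q) - ccoord b (F q')) \<le> L b * norm (q - q')"
    by (elim bchoice[elim_format] exE) blast
  have "\<forall>\<^sub>F R in at_right 0. \<forall>b\<in>Basis. \<forall>q\<in>ball P R. \<forall>q'\<in>ball P R.
      cmod (ccoord b (F q) - ccoord b (F q')) \<le> L b * norm (q - q')"
    by (rule eventually_ball_finite) (use L(2) in auto)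
  then have "\<forall>\<^sub>F R in at_right 0. \<forall>q\<in>ball P R. \<forall>q'\<in>ball P R. norm (F q - F q') \<le> (2 * (\<Sum>b\<in>Basis. L b)) * norm (q - q')"
  proof (eventually_elim, intro ballI)
    fix R q q' assume H: "\<forall>b\<in>Basis. \<forall>q\<in>ball P R. \<forall>q'\<in>ball P R.
      cmod (ccoord b (F q) - ccoord b (F q')) \<le> L b * norm (q - q')" "q \<in> ball P R" "q' \<in> ball P R"
    have "norm (F q - F q') \<le> 2 * (\<Sum>b\<in>Basis. cmod (ccoord b (F q - F q')))" by (rule norm_le_ccoord)
    also have "\<dots> \<le> 2 * (\<Sum>b\<in>Basis. L b * norm (q - q'))"
      by (intro mult_left_mono sum_mono) (use H in \<open>auto simp: ccoord_linear\<close>)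
    finally show "norm (F q - F q') \<le> (2 * (\<Sum>b\<in>Basis. L b)) * norm (q - q')"
      by (simp add: sum_distrib_right mult.assoc)
  qed
  then show ?thesis using L(1) by (intro exI[of _ "2 * (\<Sum>b\<in>Basis. L b)"]) (auto intro!: sum_nonneg)
qed

lemma ccoord_bound: "\<exists>K\<ge>0. \<forall>s. cmod (ccoord b s) \<le> K * norm s"
  using bounded_linear.nonneg_bounded[OF bounded_linear_ccoord[of b]] by (auto simp: mult.commute)

lemma ball_Pair_zero:
  fixes s :: "'a::real_normed_vector"
  shows "(s, 0) \<in> ball (0 :: 'a \<times> 'b::real_normed_vector) \<delta> \<longleftrightarrow> s \<in> ball 0 \<delta>"
proof -
  have "norm (s, 0 :: 'b) = norm s" by simp
  then show ?thesis by (simp only: mem_ball dist_0_norm)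
qed

text \<open>Picard iteration for \<open>G s = (p, 0) + \<integral>\<^sub>0\<^sup>1 Y s (G (t s)) dt\<close>.\<close>
lemma complex_flow:
  fixes X :: "'a::euclidean_space \<Rightarrow> 'a \<times> 'a \<Rightarrow> 'a \<times> 'a" and p :: 'a
  assumes B: "finite B" and U: "open U" "(p, 0) \<in> U" and X: "\<And>b. b \<in> B \<Longrightarrow> vhol_on (X b) U"
    and real: "\<And>b x. b \<in> B \<Longrightarrow> (x, 0) \<in> U \<Longrightarrow> snd (X b (x, 0)) = 0"
  defines "Y \<equiv> \<lambda>s q. \<Sum>b\<in>B. cscale (ccoord b s) (X b q)"
  shows "\<exists>\<delta>>0. \<exists>G. vhol_on G (ball 0 \<delta>) \<and> G ` ball 0 \<delta> \<subseteq> U \<and> G 0 = (p, 0) \<and>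
    (\<forall>s\<in>ball 0 \<delta>. snd (G (s, 0)) = 0) \<and>
    (\<forall>s\<in>ball 0 \<delta>. ((\<lambda>t. G (t *\<^sub>R s)) has_vector_derivative Y s (G s)) (at 1))"
proof -
  define P where "P = (p, 0 :: 'a)"
  define Lip where "Lip b L R \<longleftrightarrow> (\<forall>q\<in>ball P R. \<forall>q'\<in>ball P R. norm (X b q - X b q') \<le> L * norm (q - q'))"
    for b L R
  have "\<exists>L\<ge>0. \<forall>\<^sub>F R in at_right 0. Lip b L R" if "b \<in> B" for b
    unfolding Lip_def by (rule vhol_on_lipschitz[OF U(1) _ X[OF that]]) (use U(2) in \<open>simp add: P_def\<close>)
  then obtain L0 where L0: "\<And>b. b \<in> B \<Longrightarrow> L0 b \<ge> 0" "\<And>b. b \<in> B \<Longrightarrow> \<forall>\<^sub>F R in at_right 0. Lip b (L0 b) R"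
    by metis
  obtain k where k: "\<And>b::'a. k b \<ge> 0" "\<And>b s. cmod (ccoord b s) \<le> k b * norm s"
    using ccoord_bound by metis
  define L where "L = (\<Sum>b\<in>B. k b * L0 b)"
  have L: "L \<ge> 0" unfolding L_def by (intro sum_nonneg mult_nonneg_nonneg k L0)
  have "\<forall>\<^sub>F R in at_right 0. \<forall>b\<in>B. Lip b (L0 b) R"
    by (rule eventually_ball_finite[OF B]) (use L0(2) in auto)
  moreover obtain R0 where R0: "R0 > 0" "ball P R0 \<subseteq> U" using open_contains_ball[of U] U unfolding P_def by blast
  then have "\<forall>\<^sub>F R in at_right 0. 0 < R \<and> R < R0" by (auto simp: eventually_at_right_field)
  ultimately have "\<forall>\<^sub>F R in at_right 0. (\<forall>b\<in>B. Lip b (L0 b) R) \<and> 0 < R \<and> R < R0" by eventually_elim auto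
  then obtain R where R: "0 < R" "R < R0"
    and "\<forall>b\<in>B. Lip b (L0 b) R"
    using eventually_happens'[OF trivial_limit_at_right_real] by blast
  then have lipX: "\<And>b q q'. b \<in> B \<Longrightarrow> q \<in> ball P R \<Longrightarrow> q' \<in> ball P R \<Longrightarrow> norm (X b q - X b q') \<le> L0 b * norm (q - q')"
    unfolding Lip_def by blast
  have RU: "ball P R \<subseteq> U" using R R0 by (auto simp: subset_iff)
  have lipY: "norm (Y s q - Y s q') \<le> L * norm s * norm (q - q')" if "q \<in> ball P R" "q' \<in> ball P R" for s q q'
  proof -
    have "norm (Y s q - Y s q') = norm (\<Sum>b\<in>B. cscale (ccoord b s) (X b q - X b q'))"
      by (simp add: Y_def sum_subtractf cscale_diff_right)
    also have "\<dots> \<le> (\<Sum>b\<in>B. (k b * norm s) * (L0 b * norm (q - q')))"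
      by (intro sum_norm_le, unfold norm_cscale, intro mult_mono k lipX that mult_nonneg_nonneg) auto
    also have "\<dots> = L * norm s * norm (q - q')"
      unfolding L_def sum_distrib_right by (intro sum.cong refl) (simp only: mult_ac)
    finally show ?thesis .
  qed
  define K0 where "K0 = (\<Sum>b\<in>B. k b * norm (X b P))"
  define C where "C = K0 + L * R"
  have C: "C \<ge> 0" unfolding C_def K0_def using L R k by (intro add_nonneg_nonneg sum_nonneg mult_nonneg_nonneg) auto
  have bdY: "norm (Y s q) \<le> C * norm s" if q: "q \<in> ball P R" for s q
  proof -
    have "norm (Y s P) \<le> (\<Sum>b\<in>B. (k b * norm s) * norm (X b P))"
      unfolding Y_def by (intro sum_norm_le) (unfold norm_cscale, intro mult_right_mono k norm_ge_zero)
    also have "\<dots> = K0 * norm s"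
      unfolding K0_def sum_distrib_right by (intro sum.cong refl) (simp only: mult_ac)
    finally have 1: "norm (Y s P) \<le> K0 * norm s" .
    have "norm (Y s q - Y s P) \<le> L * norm s * norm (q - P)" by (rule lipY[OF q]) (use R in simp)
    also have "\<dots> \<le> L * norm s * R"
      using q L by (intro mult_left_mono) (auto simp: dist_norm norm_minus_commute)
    finally show ?thesis using 1 norm_triangle_sub[of "Y s q" "Y s P"] by (simp add: C_def algebra_simps)
  qed
  \<comment> \<open>The first bound keeps every iterate within \<open>R / 2\<close> of
    \<open>P\<close>, the second makes the integral operator contract by 1/2; adding 1 keeps the
    divisors positive.\<close>
  define \<delta> where "\<delta> = min (R / (2 * (C + 1))) (1 / (2 * (L + 1)))"
  have \<delta>: "\<delta> > 0" using R C L by (auto simp: \<delta>_def)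
  have smallC: "C * norm s \<le> R / 2" if "s \<in> ball 0 \<delta>" for s :: "'a \<times> 'a"
  proof -
    have "norm s * (2 * (C + 1)) \<le> R"
      using that C by (simp add: \<delta>_def pos_less_divide_eq less_imp_le)
    moreover have "norm s * (2 * (A + 1)) = 2 * (A * norm s) + 2 * norm s" for A :: real
      by (simp add: algebra_simps)
    moreover note this[of C]
    ultimately show ?thesis using norm_ge_zero[of s] by linarith
  qed
  have smallL: "L * norm s \<le> 1 / 2" if "s \<in> ball 0 \<delta>" for s :: "'a \<times> 'a"
  proof -
    have "norm s * (2 * (L + 1)) \<le> 1"
      using that L by (simp add: \<delta>_def pos_less_divide_eq less_imp_le)
    moreover have "norm s * (2 * (A + 1)) = 2 * (A * norm s) + 2 * norm s" for A :: real
      by (simp add: algebra_simps)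
    moreover note this[of L]
    ultimately show ?thesis using norm_ge_zero[of s] by linarith
  qed
  have scale: "t *\<^sub>R s \<in> ball 0 \<delta>" if "s \<in> ball 0 \<delta>" "t \<in> {0..1}" for s :: "'a \<times> 'a" and t
    using that mult_right_mono[of t 1 "norm s"] by auto
  define H where "H n = ((\<lambda>G s. P + integral {0..1} (\<lambda>t. Y s (G (t *\<^sub>R s)))) ^^ n) (\<lambda>_. P)" for n
  have H0: "H 0 = (\<lambda>_. P)" and HS: "H (Suc n) = (\<lambda>s. P + integral {0..1} (\<lambda>t. Y s (H n (t *\<^sub>R s))))" for n
    by (auto simp: H_def)
  have XR: "vhol_on (X b) (ball P R)" if "b \<in> B" for b by (rule vhol_on_subset[OF X[OF that] RU])
  have contY: "continuous_on {0..1} (\<lambda>t. Y s (G (t *\<^sub>R s)))"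
    if G: "continuous_on (ball 0 \<delta>) G" "\<And>s. s \<in> ball 0 \<delta> \<Longrightarrow> G s \<in> ball P R" and s: "s \<in> ball 0 \<delta>" for G s
  proof -
    have "continuous_on {0..1} (\<lambda>t. G (t *\<^sub>R s))"
      by (rule continuous_on_compose2[OF G(1)]) (use scale[OF s] in \<open>auto intro!: continuous_intros\<close>)
    then have "continuous_on {0..1} (\<lambda>t. X b (G (t *\<^sub>R s)))" if "b \<in> B" for b
      by (rule continuous_on_compose2[OF vhol_on_continuous[OF XR[OF that]]]) (use G(2)[OF scale[OF s]] in blast)
    then show ?thesis unfolding Y_def
      by (intro continuous_on_sum bounded_linear.continuous_on[OF bounded_linear_cscale_right])
  qed
  \<comment> \<open>Three invariants of the iteration: holomorphy in \<open>s\<close>, confinement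
    to half the ball, and real values at real arguments. The last makes the limit restrict to a flow
    on the real space.\<close>
  have Hprop: "vhol_on (H n) (ball 0 \<delta>) \<and> (\<forall>s\<in>ball 0 \<delta>. norm (H n s - P) \<le> R / 2) \<and>
      (\<forall>s\<in>ball 0 \<delta>. snd (H n (s, 0)) = 0)" for n
  proof (induction n)
    case 0
    have "vhol_on (\<lambda>_ :: 'a \<times> 'a. P) (ball 0 \<delta>)" unfolding vhol_on_iff by auto
    then show ?case using R by (simp add: H0 P_def)
  next
    case (Suc n)
    then have v: "vhol_on (H n) (ball 0 \<delta>)" and bd: "\<And>s. s \<in> ball 0 \<delta> \<Longrightarrow> norm (H n s - P) \<le> R / 2"
      and re: "\<And>s. s \<in> ball 0 \<delta> \<Longrightarrow> snd (H n (s, 0)) = 0" by auto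
    have mem: "H n s \<in> ball P R" if "s \<in> ball 0 \<delta>" for s
      using bd[OF that] R by (simp add: dist_norm norm_minus_commute)
    have cY: "continuous_on {0..1} (\<lambda>t. Y s (H n (t *\<^sub>R s)))" if "s \<in> ball 0 \<delta>" for s
      by (rule contY[OF vhol_on_continuous[OF v] mem that])
    show ?case
    proof (intro conjI ballI allI impI)
      show "norm (H (Suc n) s - P) \<le> R / 2" if s: "s \<in> ball 0 \<delta>" for s
      proof -
        have "norm (integral {0..1} (\<lambda>t. Y s (H n (t *\<^sub>R s)))) \<le> C * norm s * (1 - 0)"
          by (rule integral_bound[OF _ cY[OF s]]) (use bdY mem scale[OF s] in auto)
        then show ?thesis using smallC[OF s] by (simp add: HS)
      qed
      show "snd (H (Suc n) (s, 0)) = 0" if s0: "s \<in> ball 0 \<delta>" for s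
      proof -
        have s: "(s, 0) \<in> ball (0 :: 'a \<times> 'a) \<delta>" using s0 by (simp add: ball_Pair_zero del: mem_ball)
        have "snd (integral {0..1} (\<lambda>t. Y (s, 0) (H n (t *\<^sub>R (s, 0))))) =
            integral {0..1} (snd \<circ> (\<lambda>t. Y (s, 0) (H n (t *\<^sub>R (s, 0)))))"
          by (rule integral_linear[OF integrable_continuous_real[OF cY[OF s]] bounded_linear_snd, symmetric])
        also have "\<dots> = integral {0..1} (\<lambda>t::real. 0)"
        proof (rule integral_cong)
          fix t :: real assume t: "t \<in> {0..1}"
          have m: "t *\<^sub>R s \<in> ball 0 \<delta>" using scale[OF s t] by (simp add: ball_Pair_zero del: mem_ball)
          have e: "H n (t *\<^sub>R (s, 0)) = (fst (H n (t *\<^sub>R (s, 0))), 0)" using re[OF m] by (simp add: prod_eq_iff)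
          have u: "(fst (H n (t *\<^sub>R (s, 0))), 0) \<in> U" using mem[OF scale[OF s t]] e RU by auto
          have "snd (X b (H n (t *\<^sub>R (s, 0)))) = 0" if "b \<in> B" for b
            by (subst e) (rule real[OF that u])
          then show "(snd \<circ> (\<lambda>t. Y (s, 0) (H n (t *\<^sub>R (s, 0))))) t = 0"
            by (simp add: Y_def snd_sum cscale_def)
        qed
        finally show ?thesis by (simp add: HS P_def)
      qed
      show "vhol_on (H (Suc n)) (ball 0 \<delta>)"
        unfolding vhol_on_iff
      proof
        fix b' :: 'a assume b': "b' \<in> Basis"
        have "chol_on (\<lambda>s. integral {0..1} (\<lambda>t. ccoord b' (Y s (H n (t *\<^sub>R s))))) (ball 0 \<delta>)"
        proof (rule chol_on_integral[OF open_ball, where B = "k b' * (C * \<delta>)"])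
          fix t :: real assume t: "t \<in> {0..1}"
          have "vhol_on (\<lambda>s. 0 + t *\<^sub>R s) (ball 0 \<delta>)"
            by (rule vhol_on_linear) (auto intro: bounded_linear_scaleR_right simp: cscale_scaleR_right)
          then have 1: "vhol_on (\<lambda>s. H n (t *\<^sub>R s)) (ball 0 \<delta>)"
            using vhol_on_compose[OF _ v, of "\<lambda>s. t *\<^sub>R s" "ball 0 \<delta>"] scale[OF _ t] by simp
          have "chol_on (\<lambda>s. \<Sum>b\<in>B. ccoord b s * ccoord b' (X b (H n (t *\<^sub>R s)))) (ball 0 \<delta>)"
          proof (intro chol_on_sum chol_on_mult chol_on_ccoord)
            fix b assume "b \<in> B"
            from vhol_on_compose[OF 1 XR[OF this]] mem[OF scale[OF _ t]]
            have "vhol_on (\<lambda>s. X b (H n (t *\<^sub>R s))) (ball 0 \<delta>)" by blast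
            then show "chol_on (\<lambda>s. ccoord b' (X b (H n (t *\<^sub>R s)))) (ball 0 \<delta>)"
              using b' by (simp add: vhol_on_iff)
          qed
          then show "chol_on (\<lambda>s. ccoord b' (Y s (H n (t *\<^sub>R s)))) (ball 0 \<delta>)"
            by (simp add: Y_def linear_sum[OF bounded_linear.linear[OF bounded_linear_ccoord]] ccoord_cscale)
        next
          fix s :: "'a \<times> 'a" assume s: "s \<in> ball 0 \<delta>"
          show "continuous_on {0..1} (\<lambda>t. ccoord b' (Y s (H n (t *\<^sub>R s))))"
            by (rule bounded_linear.continuous_on[OF bounded_linear_ccoord cY[OF s]])
        next
          fix t :: real and s :: "'a \<times> 'a" assume t: "t \<in> {0..1}" and s: "s \<in> ball 0 \<delta>"
          have "cmod (ccoord b' (Y s (H n (t *\<^sub>R s)))) \<le> k b' * norm (Y s (H n (t *\<^sub>R s)))" by (rule k(2))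
          also have "\<dots> \<le> k b' * (C * norm s)" by (intro mult_left_mono bdY mem scale s t k)
          also have "\<dots> \<le> k b' * (C * \<delta>)" using s by (intro mult_left_mono C k) auto
          finally show "cmod (ccoord b' (Y s (H n (t *\<^sub>R s)))) \<le> k b' * (C * \<delta>)" .
        qed
        then have "chol_on (\<lambda>s. ccoord b' P + integral {0..1} (\<lambda>t. ccoord b' (Y s (H n (t *\<^sub>R s))))) (ball 0 \<delta>)"
          by (intro chol_on_add chol_on_const)
        then show "chol_on (\<lambda>s. ccoord b' (H (Suc n) s)) (ball 0 \<delta>)"
        proof (rule chol_on_cong[OF open_ball, rotated])
          fix s :: "'a \<times> 'a" assume s: "s \<in> ball 0 \<delta>"
          have "ccoord b' (integral {0..1} (\<lambda>t. Y s (H n (t *\<^sub>R s)))) = integral {0..1} (ccoord b' \<circ> (\<lambda>t. Y s (H n (t *\<^sub>R s))))"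
            by (rule integral_linear[OF integrable_continuous_real[OF cY[OF s]] bounded_linear_ccoord, symmetric])
          then show "ccoord b' P + integral {0..1} (\<lambda>t. ccoord b' (Y s (H n (t *\<^sub>R s)))) = ccoord b' (H (Suc n) s)"
            by (simp add: HS ccoord_linear o_def)
        qed
      qed
    qed
  qed
  have Hv: "vhol_on (H n) (ball 0 \<delta>)" for n using Hprop by blast
  have Hmem: "H n s \<in> ball P R" if "s \<in> ball 0 \<delta>" for n s
    using Hprop[of n] that R by (fastforce simp: dist_norm norm_minus_commute)
  have cY: "continuous_on {0..1} (\<lambda>t. Y s (H n (t *\<^sub>R s)))" if "s \<in> ball 0 \<delta>" for s n
    by (rule contY[OF vhol_on_continuous[OF Hv] Hmem that])
  \<comment> \<open>Confinement gives the first difference; afterwards each integration gains the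
    contraction factor 1/2.\<close>
  have diff: "norm (H (Suc n) s - H n s) \<le> R * (1/2) ^ Suc n" if "s \<in> ball 0 \<delta>" for n s
    using that
  proof (induction n arbitrary: s)
    case 0
    then show ?case using Hprop[of 1] by (simp add: H0)
  next
    case (Suc n)
    have "H (Suc (Suc n)) s - H (Suc n) s = integral {0..1} (\<lambda>t. Y s (H (Suc n) (t *\<^sub>R s)) - Y s (H n (t *\<^sub>R s)))"
      using integral_diff[OF integrable_continuous_real[OF cY[OF Suc.prems, of "Suc n"]]
          integrable_continuous_real[OF cY[OF Suc.prems, of n]]]
        fun_cong[OF HS[of "Suc n"], of s] fun_cong[OF HS[of n], of s] by simp
    also have "norm \<dots> \<le> (1/2 * (R * (1/2) ^ Suc n)) * (1 - 0)"
    proof (rule integral_bound)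
      show "continuous_on {0..1} (\<lambda>t. Y s (H (Suc n) (t *\<^sub>R s)) - Y s (H n (t *\<^sub>R s)))"
        by (intro continuous_on_diff cY Suc.prems)
      fix t :: real assume t: "t \<in> {0..1}"
      note m = scale[OF Suc.prems t]
      have "norm (Y s (H (Suc n) (t *\<^sub>R s)) - Y s (H n (t *\<^sub>R s))) \<le>
          L * norm s * norm (H (Suc n) (t *\<^sub>R s) - H n (t *\<^sub>R s))"
        by (rule lipY[OF Hmem[OF m] Hmem[OF m]])
      also have "\<dots> \<le> 1/2 * (R * (1/2) ^ Suc n)"
        by (intro mult_mono smallL Suc.prems Suc.IH m) auto
      finally show "norm (Y s (H (Suc n) (t *\<^sub>R s)) - Y s (H n (t *\<^sub>R s))) \<le> 1/2 * (R * (1/2) ^ Suc n)" .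
    qed simp
    finally show ?case by simp
  qed
  define G where "G s = P + (\<Sum>n. H (Suc n) s - H n s)" for s
  have "uniform_limit (ball 0 \<delta>) (\<lambda>n s. \<Sum>i<n. H (Suc i) s - H i s) (\<lambda>s. \<Sum>n. H (Suc n) s - H n s) sequentially"
    by (rule Weierstrass_m_test[where M = "\<lambda>n. R * (1/2) ^ Suc n"])
      (use diff in \<open>auto intro!: summable_mult summable_geometric simp del: power_Suc simp: summable_Suc_iff\<close>)
  then have "uniform_limit (ball 0 \<delta>) (\<lambda>n s. P + (\<Sum>i<n. H (Suc i) s - H i s)) G sequentially"
    unfolding G_def by (intro uniform_limit_intros)
  moreover have "P + (\<Sum>i<n. H (Suc i) s - H i s) = H n s" for n s
    by (subst sum_lessThan_telescope) (simp add: H0)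
  ultimately have ul: "uniform_limit (ball 0 \<delta>) H G sequentially" by simp
  have lim: "(\<lambda>n. H n s) \<longlonglongrightarrow> G s" if "s \<in> ball 0 \<delta>" for s
    by (rule tendsto_uniform_limitI[OF ul that])
  have Gbd: "norm (G s - P) \<le> R / 2" if s: "s \<in> ball 0 \<delta>" for s
    by (rule tendsto_upperbound[OF tendsto_norm[OF tendsto_diff[OF lim[OF s] tendsto_const]]])
      (use Hprop s in auto)
  have Gmem: "G s \<in> ball P R" if s: "s \<in> ball 0 \<delta>" for s
    using Gbd[OF s] R by (simp add: dist_norm norm_minus_commute)
  have Gv: "vhol_on G (ball 0 \<delta>)"
    unfolding vhol_on_iff
  proof
    fix b :: 'a assume b: "b \<in> Basis"
    have "uniform_limit (ball 0 \<delta>) (\<lambda>n s. ccoord b (H n s)) (\<lambda>s. ccoord b (G s)) sequentially"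
      by (rule bounded_linear.uniform_limit[OF bounded_linear_ccoord ul])
    from chol_uniform_limit(1)[OF open_ball _ uniform_limit_on_subset[OF this] sequentially_bot]
    show "chol_on (\<lambda>s. ccoord b (G s)) (ball 0 \<delta>)"
      using Hv b unfolding vhol_on_iff by auto
  qed
  have cG: "continuous_on {0..1} (\<lambda>t. Y s (G (t *\<^sub>R s)))" if "s \<in> ball 0 \<delta>" for s
    by (rule contY[OF vhol_on_continuous[OF Gv] Gmem that])
  have fixp: "G s = P + integral {0..1} (\<lambda>t. Y s (G (t *\<^sub>R s)))" if s: "s \<in> ball 0 \<delta>" for s
  proof (rule LIMSEQ_unique[OF LIMSEQ_Suc[OF lim[OF s]]])
    have "(\<lambda>n. integral {0..1} (\<lambda>t. Y s (H n (t *\<^sub>R s)))) \<longlonglongrightarrow> integral {0..1} (\<lambda>t. Y s (G (t *\<^sub>R s)))"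
    proof (rule LIMSEQ_I)
      fix e :: real assume e: "e > 0"
      then have "\<forall>\<^sub>F n in sequentially. \<forall>s\<in>ball 0 \<delta>. dist (H n s) (G s) < e"
        using ul by (simp add: uniform_limit_iff)
      then obtain N where N: "\<And>n s. n \<ge> N \<Longrightarrow> s \<in> ball 0 \<delta> \<Longrightarrow> dist (H n s) (G s) < e"
        unfolding eventually_sequentially by blast
      show "\<exists>N. \<forall>n\<ge>N. norm (integral {0..1} (\<lambda>t. Y s (H n (t *\<^sub>R s))) - integral {0..1} (\<lambda>t. Y s (G (t *\<^sub>R s)))) < e"
      proof (intro exI[of _ N] allI impI)
        fix n assume n: "n \<ge> N"
        have "norm (integral {0..1} (\<lambda>t. Y s (H n (t *\<^sub>R s)) - Y s (G (t *\<^sub>R s)))) \<le> (1/2 * e) * (1 - 0)"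
        proof (rule integral_bound)
          show "continuous_on {0..1} (\<lambda>t. Y s (H n (t *\<^sub>R s)) - Y s (G (t *\<^sub>R s)))"
            by (intro continuous_on_diff cY cG s)
          fix t :: real assume t: "t \<in> {0..1}"
          note m = scale[OF s t]
          have "norm (Y s (H n (t *\<^sub>R s)) - Y s (G (t *\<^sub>R s))) \<le> L * norm s * norm (H n (t *\<^sub>R s) - G (t *\<^sub>R s))"
            by (rule lipY[OF Hmem[OF m] Gmem[OF m]])
          also have "\<dots> \<le> 1/2 * e"
            using N[OF n m] by (intro mult_mono smallL s) (auto simp: dist_norm)
          finally show "norm (Y s (H n (t *\<^sub>R s)) - Y s (G (t *\<^sub>R s))) \<le> 1/2 * e" .
        qed simp
        then show "norm (integral {0..1} (\<lambda>t. Y s (H n (t *\<^sub>R s))) - integral {0..1} (\<lambda>t. Y s (G (t *\<^sub>R s)))) < e"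
          using e by (subst integral_diff[symmetric]) (auto intro!: integrable_continuous_real cY cG s)
      qed
    qed
    then show "(\<lambda>n. H (Suc n) s) \<longlonglongrightarrow> P + integral {0..1} (\<lambda>t. Y s (G (t *\<^sub>R s)))"
      unfolding HS by (intro tendsto_intros)
  qed
  have Yscale: "Y (t *\<^sub>R s) q = t *\<^sub>R Y s q" for t s q
    unfolding Y_def scaleR_sum_right
    by (rule sum.cong) (auto simp: ccoord_def cscale_def prod_eq_iff algebra_simps)
  have deriv: "((\<lambda>t. G (t *\<^sub>R s)) has_vector_derivative Y s (G s)) (at 1)" if s: "s \<in> ball 0 \<delta>" for s
  proof -
    \<comment> \<open>The ray is followed slightly beyond time 1, so that \<open>t = 1\<close> is
      interior and a two-sided derivative exists there.\<close>
    obtain T where T: "T > 1" "T * norm s < \<delta>"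
    proof -
      have "((\<lambda>T. T * norm s) \<longlongrightarrow> 1 * norm s) (at_right 1)" by (intro tendsto_intros)
      then have "\<forall>\<^sub>F T in at_right 1. T * norm s < \<delta>" using s by (auto dest: order_tendstoD)
      moreover have "\<forall>\<^sub>F T in at_right 1. T > (1::real)" by (simp add: eventually_at_right_less)
      ultimately have "\<forall>\<^sub>F T in at_right 1. T * norm s < \<delta> \<and> T > 1" by eventually_elim auto
      then show ?thesis using that eventually_happens'[OF trivial_limit_at_right_real] by blast
    qed
    have Tmem: "t *\<^sub>R s \<in> ball 0 \<delta>" if "t \<in> {0..T}" for t
      using that T mult_right_mono[of t T "norm s"] by auto
    define \<phi> where "\<phi> t = Y s (G (t *\<^sub>R s))" for t
    have "continuous_on {0..T} (\<lambda>t. G (t *\<^sub>R s))"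
      by (rule continuous_on_compose2[OF vhol_on_continuous[OF Gv]]) (use Tmem in \<open>auto intro!: continuous_intros\<close>)
    then have "continuous_on {0..T} (\<lambda>t. X b (G (t *\<^sub>R s)))" if "b \<in> B" for b
      by (rule continuous_on_compose2[OF vhol_on_continuous[OF XR[OF that]]]) (use Gmem[OF Tmem] in blast)
    then have c\<phi>: "continuous_on {0..T} \<phi>" unfolding Y_def \<phi>_def
      by (intro continuous_on_sum bounded_linear.continuous_on[OF bounded_linear_cscale_right])
    \<comment> \<open>Homogeneity of \<open>Y\<close> in \<open>s\<close> and a substitution turn
      the fixed point equation at \<open>t *\<^sub>R s\<close> into an integral up to
      \<open>t\<close>, to which the fundamental theorem of calculus applies.\<close>
    have eq: "G (t *\<^sub>R s) = P + integral {0..t} \<phi>" if t: "t \<in> {0<..<T}" for t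
    proof -
      have "G (t *\<^sub>R s) = P + integral {0..1} (\<lambda>u. t *\<^sub>R \<phi> (t * u))"
        using fixp[OF Tmem, of t] t by (simp add: Yscale \<phi>_def mult.commute)
      also have "integral {0..1} (\<lambda>u. t *\<^sub>R \<phi> (t * u)) = t *\<^sub>R integral ((\<lambda>x. x / t) ` {0..t}) (\<lambda>u. \<phi> (t * u))"
        using t by (simp add: image_divide_atLeastAtMost)
      also have "\<dots> = integral {0..t} \<phi>"
        by (subst integral_stretch_real) (use t in auto)
      finally show ?thesis .
    qed
    have "((\<lambda>t. P + integral {0..t} \<phi>) has_vector_derivative \<phi> 1) (at 1 within {0..T})"
      using integral_has_vector_derivative[OF c\<phi>, of 1] T(1)
      by (auto intro!: derivative_eq_intros)
    then have "((\<lambda>t. P + integral {0..t} \<phi>) has_vector_derivative \<phi> 1) (at 1)"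
      using T(1) at_within_interior[of 1 "{0..T}"] by simp
    then have "((\<lambda>t. G (t *\<^sub>R s)) has_vector_derivative \<phi> 1) (at 1)"
      by (rule has_vector_derivative_transform_within_open[where S = "{0<..<T}"]) (use T eq in auto)
    then show ?thesis by (simp add: \<phi>_def)
  qed
  show ?thesis
  proof (intro exI[of _ \<delta>] exI[of _ G] conjI \<delta> Gv allI impI ballI deriv)
    show "G ` ball 0 \<delta> \<subseteq> U" using Gmem RU by auto
    have z: "(0 :: 'a \<times> 'a) \<in> ball 0 \<delta>" using \<delta> by simp
    have "Y 0 q = 0" for q using Yscale[of 0 0] by simp
    then show "G 0 = (p, 0)" using fixp[OF z] by (simp add: P_def)
    fix s :: 'a assume s0: "s \<in> ball 0 \<delta>"
    then have s: "(s, 0) \<in> ball (0 :: 'a \<times> 'a) \<delta>" by (simp add: ball_Pair_zero del: mem_ball)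
    have "(\<lambda>n. snd (H n (s, 0))) \<longlonglongrightarrow> snd (G (s, 0))" by (intro tendsto_snd lim s)
    moreover have "snd (H n (s, 0)) = 0" for n using Hprop s0 by blast
    ultimately show "snd (G (s, 0)) = 0" by (simp add: LIMSEQ_const_iff)
  qed
qed

text \<open>\<open>G\<close> is an exponential map: \<open>G s\<close> is the time-one value of the
  flow of \<open>\<Sum>b\<in>B. (s \<bullet> b) *\<^sub>R X b\<close> from \<open>p\<close>. Time is
  absorbed into the parameter, so one map carries both the flow and its analytic dependence on the
  parameters, and the flow equation becomes a condition on the radial derivative.\<close>

lemma analytic_flow:
  fixes X :: "'a::euclidean_space \<Rightarrow> 'a \<Rightarrow> 'a" and p :: 'a
  assumes B: "finite B" and X: "\<And>b. b \<in> B \<Longrightarrow> van (X b) p"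
  shows "\<exists>G \<delta>. \<delta> > 0 \<and> G 0 = p \<and> (\<forall>s\<in>ball 0 \<delta>. van G s \<and>
    frechet_derivative G (at s) s = (\<Sum>b\<in>B. (s \<bullet> b) *\<^sub>R X b (G s)))"
proof -
  have "\<forall>b\<in>B. \<exists>F U. open U \<and> (p, 0) \<in> U \<and> vhol_on F U \<and> (\<forall>x. (x, 0) \<in> U \<longrightarrow> F (x, 0) = (X b x, 0))"
    using van_extension[OF X] by blast
  then obtain F U where FU: "\<And>b. b \<in> B \<Longrightarrow> open (U b) \<and> (p, 0) \<in> U b \<and> vhol_on (F b) (U b) \<and>
      (\<forall>x. (x, 0) \<in> U b \<longrightarrow> F b (x, 0) = (X b x, 0))" by metis
  define V where "V = (\<Inter>b\<in>B. U b)"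
  have V: "open V" "(p, 0) \<in> V" using FU B by (auto simp: V_def intro!: open_INT)
  have FV: "vhol_on (F b) V" if "b \<in> B" for b
    using FU[OF that] that by (auto simp: V_def vhol_on_def)
  have Fr: "F b (x, 0) = (X b x, 0)" if "b \<in> B" "(x, 0) \<in> V" for b x
    using FU[OF that(1)] that by (auto simp: V_def)
  have snd0: "snd (F b (x, 0)) = 0" if "b \<in> B" "(x, 0) \<in> V" for b x
    using Fr[OF that] by simp
  have "\<exists>\<delta>>0. \<exists>G. vhol_on G (ball 0 \<delta>) \<and> G ` ball 0 \<delta> \<subseteq> V \<and> G 0 = (p, 0) \<and>
    (\<forall>s\<in>ball 0 \<delta>. snd (G (s, 0)) = 0) \<and>
    (\<forall>s\<in>ball 0 \<delta>. ((\<lambda>t. G (t *\<^sub>R s)) has_vector_derivative (\<Sum>b\<in>B. cscale (ccoord b s) (F b (G s)))) (at 1))"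
    by (rule complex_flow[OF B V]; (rule FV | rule snd0); assumption)
  then obtain \<delta> G where \<delta>: "\<delta> > 0" and G: "vhol_on G (ball 0 \<delta>)" "G ` ball 0 \<delta> \<subseteq> V" "G 0 = (p, 0)"
    "\<forall>s\<in>ball 0 \<delta>. snd (G (s, 0)) = 0"
    "\<forall>s\<in>ball 0 \<delta>. ((\<lambda>t. G (t *\<^sub>R s)) has_vector_derivative (\<Sum>b\<in>B. cscale (ccoord b s) (F b (G s)))) (at 1)"
    by (elim exE conjE) (assumption | rule that)+
  define g where "g s = fst (G (s, 0))" for s
  have Gg: "G (s, 0) = (g s, 0)" if "s \<in> ball 0 \<delta>" for s
  proof -
    from G(4)[rule_format, OF that] show ?thesis by (simp add: g_def prod_eq_iff)
  qed
  have vg: "van g s" if s: "s \<in> ball 0 \<delta>" for s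
    unfolding van_def cxan_def
  proof
    fix b :: 'a assume b: "b \<in> Basis"
    show "\<exists>F U. open U \<and> (s, 0) \<in> U \<and> chol_on F U \<and> (\<forall>x. (x, 0) \<in> U \<longrightarrow> of_real (g x \<bullet> b) = F (x, 0))"
      by (intro exI[of _ "\<lambda>z. ccoord b (G z)"] exI[of _ "ball 0 \<delta>"])
        (use G(1) b s Gg in \<open>auto simp: vhol_on_iff\<close>)
  qed
  show ?thesis
  proof (intro exI[of _ g] exI[of _ \<delta>] conjI \<delta> ballI vg)
    show "g 0 = p" using G(3) by (simp add: g_def zero_prod_def)
    fix s :: 'a assume s: "s \<in> ball 0 \<delta>"
    have s0: "(s, 0) \<in> ball (0 :: 'a \<times> 'a) \<delta>" using s by (simp add: ball_Pair_zero del: mem_ball)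
    have "((\<lambda>t. G (t *\<^sub>R (s, 0))) has_vector_derivative (\<Sum>b\<in>B. cscale (ccoord b (s, 0)) (F b (G (s, 0))))) (at 1)"
      by (rule G(5)[rule_format, OF s0])
    then have d1: "((\<lambda>t. fst (G (t *\<^sub>R (s, 0)))) has_vector_derivative fst (\<Sum>b\<in>B. cscale (ccoord b (s, 0)) (F b (G (s, 0))))) (at 1)"
      by (rule bounded_linear.has_vector_derivative[OF bounded_linear_fst])
    have "(g s, 0) \<in> V" using G(2) s0 Gg[OF s] by (metis image_subset_iff)
    then have "fst (\<Sum>b\<in>B. cscale (ccoord b (s, 0)) (F b (G (s, 0)))) = (\<Sum>b\<in>B. (s \<bullet> b) *\<^sub>R X b (g s))"
      unfolding fst_sum by (intro sum.cong) (auto simp: Gg[OF s] Fr)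
    with d1 have d1': "((\<lambda>t. g (t *\<^sub>R s)) has_vector_derivative (\<Sum>b\<in>B. (s \<bullet> b) *\<^sub>R X b (g s))) (at 1)"
      by (simp add: g_def)
    have "((\<lambda>t. t *\<^sub>R s) has_derivative (\<lambda>t. t *\<^sub>R s)) (at (1::real))" by (auto intro!: derivative_eq_intros)
    moreover have "(g has_derivative frechet_derivative g (at s)) (at (1 *\<^sub>R s))" using van_has_derivative[OF vg[OF s]] by simp
    ultimately have "((\<lambda>t. g (t *\<^sub>R s)) has_derivative (\<lambda>t. frechet_derivative g (at s) (t *\<^sub>R s))) (at 1)"
      by (rule has_derivative_compose)
    then have "((\<lambda>t. g (t *\<^sub>R s)) has_vector_derivative frechet_derivative g (at s) s) (at 1)"
      unfolding has_vector_derivative_def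
      by (simp add: linear_scale[OF has_derivative_linear[OF van_has_derivative[OF vg[OF s]]]])
    from vector_derivative_unique_at[OF this d1']
    show "frechet_derivative g (at s) s = (\<Sum>b\<in>B. (s \<bullet> b) *\<^sub>R X b (g s))" .
  qed
qed

section \<open>Nagano's theorem\<close>

definition lie_bracket :: "('a::euclidean_space \<Rightarrow> 'a) \<Rightarrow> ('a \<Rightarrow> 'a) \<Rightarrow> 'a \<Rightarrow> 'a" where
  "lie_bracket X Y q = frechet_derivative Y (at q) (X q) - frechet_derivative X (at q) (Y q)"

lemma van_lie_bracket: "van X p \<Longrightarrow> van Y p \<Longrightarrow> van (lie_bracket X Y) p"
  unfolding lie_bracket_def[abs_def] by (intro van_diff van_frechet_derivative_vec)

lemma van_isCont: "van X p \<Longrightarrow> isCont X p"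
  by (meson van_has_derivative has_derivative_continuous)

lemma cxan_isCont: "cxan X p \<Longrightarrow> isCont X p"
  by (meson cxan_has_derivative has_derivative_continuous)

lemma isCont_nhds: "isCont f a \<Longrightarrow> (f \<longlongrightarrow> f a) (nhds a)"
  by (simp add: isCont_def tendsto_at_iff_tendsto_nhds)

lemma frechet_derivative_inner_const:
  assumes X: "van X p" and c: "\<forall>\<^sub>F q in nhds p. X q \<bullet> e = c"
  shows "\<forall>\<^sub>F q in nhds p. frechet_derivative X (at q) v \<bullet> e = 0"
proof -
  have "\<forall>\<^sub>F q in nhds p. \<forall>\<^sub>F q' in nhds q. X q' \<bullet> e = c" using c by (simp add: eventually_eventually)
  with van_eventually[OF X] show ?thesis
  proof eventually_elim
    case (elim q)
    have 1: "((\<lambda>q. X q \<bullet> e) has_derivative (\<lambda>v. frechet_derivative X (at q) v \<bullet> e)) (at q)"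
      by (intro derivative_intros van_has_derivative elim)
    obtain N where N: "open N" "q \<in> N" "\<And>q'. q' \<in> N \<Longrightarrow> X q' \<bullet> e = c"
      using elim(2) unfolding eventually_nhds by blast
    have "((\<lambda>q. X q \<bullet> e) has_derivative (\<lambda>v. 0)) (at q)"
      by (rule has_derivative_transform_within_open[OF has_derivative_const N(1,2)]) (simp add: N(3))
    from has_derivative_unique[OF 1 this] show ?case by metis
  qed
qed

lemma linear_expand:
  assumes "linear f"
  shows "f x = (\<Sum>b\<in>Basis. (x \<bullet> b) *\<^sub>R f b)"
proof -
  have "f x = f (\<Sum>b\<in>Basis. (x \<bullet> b) *\<^sub>R b)" by (simp add: euclidean_representation)
  then show ?thesis by (simp add: linear_sum[OF assms] linear_scale[OF assms])
qed

text \<open>An involutive module of fields over the ring of functions analytic at \<open>p\<close>.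
  The dimension of the space of its values may jump at points near \<open>p\<close>.\<close>

locale analytic_lie =
  fixes p :: "'a::euclidean_space" and L :: "('a \<Rightarrow> 'a) set"
  assumes L_van: "X \<in> L \<Longrightarrow> van X p"
    and L_zero: "(\<lambda>_. 0) \<in> L"
    and L_add: "X \<in> L \<Longrightarrow> Y \<in> L \<Longrightarrow> (\<lambda>q. X q + Y q) \<in> L"
    and L_scale: "X \<in> L \<Longrightarrow> cxan (\<lambda>q. of_real (a q)) p \<Longrightarrow> (\<lambda>q. a q *\<^sub>R X q) \<in> L"
    and L_bracket: "X \<in> L \<Longrightarrow> Y \<in> L \<Longrightarrow> lie_bracket X Y \<in> L"
begin

lemma L_sum: "(\<And>i. i \<in> A \<Longrightarrow> X i \<in> L) \<Longrightarrow> (\<lambda>q. \<Sum>i\<in>A. X i q) \<in> L"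
  by (induction A rule: infinite_finite_induct) (auto simp: L_zero L_add)

text \<open>The future tangent space of the leaf at \<open>p\<close>.\<close>

definition W :: "'a set" where "W = (\<lambda>X. X p) ` L"

lemma subspace_W: "subspace W"
  unfolding subspace_def W_def
proof (intro conjI ballI allI)
  show "0 \<in> (\<lambda>X. X p) ` L" using L_zero by force
  show "x + y \<in> (\<lambda>X. X p) ` L" if "x \<in> (\<lambda>X. X p) ` L" "y \<in> (\<lambda>X. X p) ` L" for x y
    using that L_add by force
  show "c *\<^sub>R x \<in> (\<lambda>X. X p) ` L" if "x \<in> (\<lambda>X. X p) ` L" for c x
    using that L_scale[OF _ cxan_const, of _ c] by force
qed

text \<open>Gaussian elimination with analytic coefficients, one vector of \<open>A\<close> at a time.\<close>
lemma normalized_fields_exist: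
  assumes "finite A" "A \<subseteq> B" and B: "B \<subseteq> W" and orth: "\<And>b b'. b \<in> B \<Longrightarrow> b' \<in> B \<Longrightarrow> b \<bullet> b' = (if b = b' then 1 else 0)"
  shows "\<exists>X. \<forall>b\<in>B. X b \<in> L \<and> X b p = b \<and> (\<forall>a\<in>A. \<forall>\<^sub>F q in nhds p. X b q \<bullet> a = (if b = a then 1 else 0))"
  using assms(1,2)
proof (induction A rule: finite_induct)
  case empty
  have "\<forall>b\<in>B. \<exists>X. X \<in> L \<and> X p = b" using B by (auto simp: W_def)
  then show ?case by (metis empty_iff)
next
  case (insert a A)
  then obtain X where X: "\<And>b. b \<in> B \<Longrightarrow> X b \<in> L" "\<And>b. b \<in> B \<Longrightarrow> X b p = b"
    "\<And>b a. b \<in> B \<Longrightarrow> a \<in> A \<Longrightarrow> \<forall>\<^sub>F q in nhds p. X b q \<bullet> a = (if b = a then 1 else 0)" by blast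
  have aB: "a \<in> B" using insert.prems by auto
  define c where "c q = X a q \<bullet> a" for q
  have cp: "c p = 1" using X(2)[OF aB] orth[OF aB aB] by (simp add: c_def)
  have cc: "cxan (\<lambda>q. of_real (c q)) p" unfolding c_def by (rule van_inner[OF L_van[OF X(1)[OF aB]]])
  have "isCont c p" unfolding c_def by (intro continuous_intros van_isCont L_van X(1) aB)
  from order_tendstoD(1)[OF isCont_nhds[OF this], of 0] have "\<forall>\<^sub>F q in nhds p. c q > 0"
    using cp by simp
  then have cnz: "\<forall>\<^sub>F q in nhds p. c q \<noteq> 0" by eventually_elim auto
  have ci: "cxan (\<lambda>q. of_real (inverse (c q))) p"
    using cxan_inverse[OF cc] cp by simp
  define Xa where "Xa q = inverse (c q) *\<^sub>R X a q" for q
  have XaL: "Xa \<in> L" unfolding Xa_def[abs_def] by (rule L_scale[OF X(1)[OF aB] ci])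
  \<comment> \<open>The pivot field is scaled to have component 1 along \<open>a\<close> near
    \<open>p\<close>, and a multiple of it is subtracted from each other field. Components along
    earlier members of \<open>A\<close> do not change, since those of the pivot field are 0.\<close>
  define X' where "X' b = (if b = a then Xa else (\<lambda>q. X b q + (- (X b q \<bullet> a)) *\<^sub>R Xa q))" for b
  show ?case
  proof (intro exI[of _ X'] ballI conjI)
    fix b assume b: "b \<in> B"
    have "cxan (\<lambda>q. of_real (- (X b q \<bullet> a))) p"
      using cxan_uminus[OF van_inner[OF L_van[OF X(1)[OF b]], of a]] by simp
    then have "(\<lambda>q. X b q + (- (X b q \<bullet> a)) *\<^sub>R Xa q) \<in> L"
      by (rule L_add[OF X(1)[OF b] L_scale[OF XaL]])
    then show "X' b \<in> L"
      unfolding X'_def using XaL by (cases "b = a") (simp_all only: if_True if_False refl)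
    have Xap: "Xa p = a" using cp X(2)[OF aB] by (simp add: Xa_def)
    then show "X' b p = b"
      using X(2)[OF b] orth[OF b aB] by (simp add: X'_def)
    fix a' assume a': "a' \<in> insert a A"
    show "\<forall>\<^sub>F q in nhds p. X' b q \<bullet> a' = (if b = a' then 1 else 0)"
    proof (cases "a' = a")
      case True
      show ?thesis using cnz
        by eventually_elim (auto simp: True X'_def Xa_def c_def[symmetric] inner_left_distrib inner_diff_left)
    next
      case False
      then have a'A: "a' \<in> A" using a' by auto
      show ?thesis using X(3)[OF b a'A] X(3)[OF aB a'A]
        by eventually_elim (use False in \<open>auto simp: X'_def Xa_def inner_left_distrib inner_diff_left\<close>)
    qed
  qed
qed

end

text \<open>An adapted frame. The fields \<open>X b\<close> have constant components along the
  orthonormal basis \<open>B\<close> of \<open>W\<close> near \<open>p\<close>; this makes their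
  brackets orthogonal to \<open>W\<close> and lets the leaf be a graph over \<open>W\<close>.
  \<open>G\<close> is the exponential map of the frame.\<close>

locale analytic_lie_flow = analytic_lie +
  fixes B :: "'a set" and X :: "'a \<Rightarrow> 'a \<Rightarrow> 'a" and G :: "'a \<Rightarrow> 'a" and \<delta> :: real
  assumes B: "finite B" "span B = W"
    and orth: "\<And>b b'. b \<in> B \<Longrightarrow> b' \<in> B \<Longrightarrow> b \<bullet> b' = (if b = b' then 1 else 0)"
    and XL: "\<And>b. b \<in> B \<Longrightarrow> X b \<in> L" and Xp: "\<And>b. b \<in> B \<Longrightarrow> X b p = b"
    and Xorth: "\<And>b a. b \<in> B \<Longrightarrow> a \<in> B \<Longrightarrow> \<forall>\<^sub>F q in nhds p. X b q \<bullet> a = (if b = a then 1 else 0)"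
    and \<delta>: "\<delta> > 0" and G0: "G 0 = p" and Gvan: "\<And>s. s \<in> ball 0 \<delta> \<Longrightarrow> van G s"
    and Gflow: "\<And>s. s \<in> ball 0 \<delta> \<Longrightarrow> frechet_derivative G (at s) s = (\<Sum>b\<in>B. (s \<bullet> b) *\<^sub>R X b (G s))"
begin

definition Xs :: "'a \<Rightarrow> 'a \<Rightarrow> 'a" where "Xs s q = (\<Sum>b\<in>B. (s \<bullet> b) *\<^sub>R X b q)"

lemma Xs_L: "Xs s \<in> L"
  unfolding Xs_def[abs_def] by (intro L_sum L_scale XL cxan_const)

lemma W_expand: "w \<in> W \<Longrightarrow> (\<Sum>b\<in>B. (w \<bullet> b) *\<^sub>R b) = w"
proof -
  assume "w \<in> W"
  then have "w \<in> span B" using B by simp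
  then show ?thesis
  proof (induction rule: span_induct)
    case base
    show ?case
      by (rule subspaceI) (auto simp: inner_left_distrib scaleR_left_distrib sum.distrib scaleR_sum_right[symmetric] simp flip: scaleR_scaleR)
  next
    case (step x)
    then show ?case using B(1)
      by (simp add: orth if_distrib[of "\<lambda>c. c *\<^sub>R _"] sum.delta cong: if_cong)
  qed
qed

lemma Xs_inner:
  assumes "e \<in> B"
  shows "\<forall>\<^sub>F q in nhds p. Xs s q \<bullet> e = s \<bullet> e"
proof -
  have "\<forall>\<^sub>F q in nhds p. \<forall>b\<in>B. X b q \<bullet> e = (if b = e then 1 else 0)"
    by (rule eventually_ball_finite[OF B(1)]) (use Xorth assms in blast)
  then show ?thesis
  proof eventually_elim
    case (elim q)
    have "Xs s q \<bullet> e = (\<Sum>b\<in>B. if b = e then s \<bullet> b else 0)"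
      unfolding Xs_def inner_sum_left by (rule sum.cong) (use elim in auto)
    then show ?case using B(1) assms by simp
  qed
qed

lemma scale_mem: "s \<in> ball 0 r \<Longrightarrow> t \<in> {0..1} \<Longrightarrow> t *\<^sub>R s \<in> ball (0 :: 'a) r"
  using mult_right_mono[of t 1 "norm s"] by auto

text \<open>The radial equation at \<open>t *\<^sub>R s\<close> is \<open>t\<close> times the claim;
  division covers \<open>t \<noteq> 0\<close>, and continuity of both sides gives
  \<open>t = 0\<close>.\<close>

lemma Gflow_ray:
  assumes "t *\<^sub>R s \<in> ball 0 \<delta>"
  shows "frechet_derivative G (at (t *\<^sub>R s)) s = Xs s (G (t *\<^sub>R s))"
proof -
  have nz: "frechet_derivative G (at (t *\<^sub>R s)) s = Xs s (G (t *\<^sub>R s))" if "t *\<^sub>R s \<in> ball 0 \<delta>" "t \<noteq> 0" for t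
  proof -
    have "t *\<^sub>R frechet_derivative G (at (t *\<^sub>R s)) s = t *\<^sub>R Xs s (G (t *\<^sub>R s))"
      using Gflow[OF that(1)] linear_scale[OF has_derivative_linear[OF van_has_derivative[OF Gvan[OF that(1)]]], of t s]
      by (simp add: Xs_def scaleR_sum_right)
    with that(2) show ?thesis by simp
  qed
  show ?thesis
  proof (cases "t = 0")
    case False
    then show ?thesis using nz assms by simp
  next
    case True
    have z: "(0 :: 'a) \<in> ball 0 \<delta>" using \<delta> by simp
    have line: "((\<lambda>u::real. u *\<^sub>R s) \<longlongrightarrow> 0) (at 0)" by (auto intro!: tendsto_eq_intros)
    have "isCont (\<lambda>x. frechet_derivative G (at x) s) 0"
      by (intro van_isCont van_frechet_derivative Gvan z)
    then have 1: "((\<lambda>u. frechet_derivative G (at (u *\<^sub>R s)) s) \<longlongrightarrow> frechet_derivative G (at 0) s) (at 0)"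
      by (rule isCont_tendsto_compose[OF _ line])
    have "van (Xs s) (G 0)" using L_van[OF Xs_L] by (simp add: G0)
    from van_isCont[OF van_compose[OF Gvan[OF z] this]] have "isCont (\<lambda>x. Xs s (G x)) 0" .
    then have 2: "((\<lambda>u. Xs s (G (u *\<^sub>R s))) \<longlongrightarrow> Xs s (G 0)) (at 0)"
      by (rule isCont_tendsto_compose[OF _ line])
    have "\<forall>\<^sub>F u in at (0::real). u *\<^sub>R s \<in> ball 0 \<delta>"
      by (rule topological_tendstoD[OF line open_ball z])
    moreover have "\<forall>\<^sub>F u in at (0::real). u \<noteq> 0" by (simp add: eventually_at_filter)
    ultimately have "\<forall>\<^sub>F u in at (0::real). frechet_derivative G (at (u *\<^sub>R s)) s = Xs s (G (u *\<^sub>R s))"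
      by eventually_elim (use nz in auto)
    from tendsto_unique[OF _ Lim_transform_eventually[OF 1 this] 2] True show ?thesis by simp
  qed
qed

lemma G_near:
  assumes "\<forall>\<^sub>F q in nhds p. P q"
  shows "\<exists>r>0. r \<le> \<delta> \<and> (\<forall>s\<in>ball 0 r. P (G s))"
proof -
  have z: "(0 :: 'a) \<in> ball 0 \<delta>" using \<delta> by simp
  have "(G \<longlongrightarrow> p) (nhds 0)"
    using isCont_nhds[OF van_isCont[OF Gvan[OF z]]] G0 by simp
  then have "\<forall>\<^sub>F s in nhds 0. P (G s)" using assms by (simp add: filterlim_iff)
  then obtain r where r: "r > 0" "\<And>s. s \<in> ball 0 r \<Longrightarrow> P (G s)"
    unfolding eventually_nhds_metric by (auto simp: dist_commute)
  then show ?thesis using \<delta> by (intro exI[of _ "min r \<delta>"]) auto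
qed

lemma G_line_derivative:
  assumes t: "t *\<^sub>R s \<in> ball 0 \<delta>"
  shows "((\<lambda>t. G (t *\<^sub>R s)) has_derivative (\<lambda>u. u *\<^sub>R Xs s (G (t *\<^sub>R s)))) (at t)"
proof -
  have "((\<lambda>t. t *\<^sub>R s) has_derivative (\<lambda>t. t *\<^sub>R s)) (at t)" by (auto intro!: derivative_eq_intros)
  from has_derivative_compose[OF this van_has_derivative[OF Gvan[OF t]]]
  have "((\<lambda>t. G (t *\<^sub>R s)) has_derivative (\<lambda>u. frechet_derivative G (at (t *\<^sub>R s)) (u *\<^sub>R s))) (at t)" .
  then show ?thesis
    by (simp add: linear_scale[OF has_derivative_linear[OF van_has_derivative[OF Gvan[OF t]]]] Gflow_ray[OF t])
qed

text \<open>
  All derivatives of \<open>u\<close> along the integral curve \<open>t \<mapsto> G (t s)\<close> vanish at \<open>t = 0\<close>, so analyticity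
  makes \<open>u\<close> vanish along the whole curve.
\<close>
lemma vanishes_on_leaf_if_invariant:
  assumes N: "\<And>u. u \<in> N \<Longrightarrow> cxan u p \<and> u p = 0 \<and> (\<forall>s. (\<lambda>q. frechet_derivative u (at q) (Xs s q)) \<in> N)"
    and u: "u \<in> N"
  shows "\<forall>\<^sub>F s in nhds 0. u (G s) = 0"
proof -
  obtain r where r: "r > 0" "r \<le> \<delta>" "\<And>s. s \<in> ball 0 r \<Longrightarrow> cxan u (G s)"
    using G_near[OF cxan_eventually] N[OF u] by metis
  have "u (G s) = 0" if s: "s \<in> ball 0 r" for s
  proof -
    have mem: "t *\<^sub>R s \<in> ball 0 r" if "t \<in> {0..1}" for t by (rule scale_mem[OF s that])
    have mem\<delta>: "t *\<^sub>R s \<in> ball 0 \<delta>" if "t \<in> {0..1}" for t using mem[OF that] r(2) by auto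
    have vl: "van (\<lambda>t. t *\<^sub>R s) t" for t :: real by (rule van_linear) (simp add: linearI scaleR_left_distrib)
    define \<phi> where "\<phi> k t = ((\<lambda>u q. frechet_derivative u (at q) (Xs s q)) ^^ k) u (G (t *\<^sub>R s))" for k and t :: real
    have uN: "((\<lambda>u q. frechet_derivative u (at q) (Xs s q)) ^^ k) u \<in> N" for k
      by (induction k) (use u N in auto)
    have an: "cxan (\<phi> 0) t" if "t \<in> {0..1}" for t
      using cxan_compose[OF van_compose[OF vl, of G t] , of u] Gvan[OF mem\<delta>[OF that]] r(3)[OF mem[OF that]]
      by (simp add: \<phi>_def[abs_def])
    have ev0: "\<forall>\<^sub>F t in nhds (0::real). P (t *\<^sub>R s)" if "\<forall>\<^sub>F x in nhds 0. P x" for P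
    proof -
      have "((\<lambda>u::real. u *\<^sub>R s) \<longlongrightarrow> 0) (nhds 0)" by (auto intro!: tendsto_eq_intros filterlim_ident)
      then show ?thesis using that by (simp add: filterlim_iff)
    qed
    have "\<forall>\<^sub>F t in nhds 0. \<phi> 0 t = 0"
    proof (rule cxan_zero_if_derivs_zero[where \<phi> = \<phi>])
      show "cxan (\<phi> 0) 0" by (rule an) simp
      show "\<phi> k 0 = 0" for k using N[OF uN[of k]] by (simp add: \<phi>_def G0)
      fix k
      define v where "v = ((\<lambda>u q. frechet_derivative u (at q) (Xs s q)) ^^ k) u"
      have "cxan v p" using N[OF uN[of k]] by (simp add: v_def)
      from G_near[OF cxan_eventually[OF this]] obtain r' where r': "r' > 0" "r' \<le> \<delta>"
        "\<And>x. x \<in> ball 0 r' \<Longrightarrow> cxan v (G x)" by blast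
      have "\<forall>\<^sub>F x in nhds 0. x \<in> ball (0 :: 'a) r'" by (rule eventually_nhds_in_open) (use r' in auto)
      from ev0[OF this] show "\<forall>\<^sub>F t in nhds 0. (\<phi> k has_vector_derivative \<phi> (Suc k) t) (at t)"
      proof eventually_elim
        case (elim t)
        then have t: "t *\<^sub>R s \<in> ball 0 \<delta>" using r' by auto
        have "((\<lambda>t. v (G (t *\<^sub>R s))) has_derivative
            (\<lambda>x. frechet_derivative v (at (G (t *\<^sub>R s))) (x *\<^sub>R Xs s (G (t *\<^sub>R s))))) (at t)"
          by (rule has_derivative_compose[OF G_line_derivative[OF t] cxan_has_derivative[OF r'(3)[OF elim]]])
        then show ?case
          unfolding has_vector_derivative_def
          by (simp add: \<phi>_def[abs_def] v_def[symmetric]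
              linear_scale[OF has_derivative_linear[OF cxan_has_derivative[OF r'(3)[OF elim]]]])
      qed
    qed
    then have zero: "\<forall>\<^sub>F t in nhds 0. \<phi> 0 t = 0" .
    have "\<phi> 0 1 = 0"
    proof (rule cxan_zero_on_interval[where \<phi> = "\<phi> 0" and a = 0 and b = 1])
      show "\<forall>\<^sub>F t in nhds 0. \<phi> 0 t = 0" by (rule zero)
    qed (use an in auto)
    then show ?thesis by (simp add: \<phi>_def)
  qed
  moreover have "\<forall>\<^sub>F x in nhds 0. x \<in> ball (0 :: 'a) r" by (rule eventually_nhds_in_open) (use r in auto)
  ultimately show ?thesis by (auto elim: eventually_mono)
qed

text \<open>The obstruction to constant rank: fields without component along \<open>W\<close> near
  \<open>p\<close>. The aim is that they vanish on the leaf.\<close>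

definition vertical :: "('a \<Rightarrow> 'a) \<Rightarrow> bool" where
  "vertical Y \<longleftrightarrow> Y \<in> L \<and> (\<forall>e\<in>B. \<forall>\<^sub>F q in nhds p. Y q \<bullet> e = 0)"

lemma vertical_add: "vertical Y \<Longrightarrow> vertical Z \<Longrightarrow> vertical (\<lambda>q. Y q + Z q)"
  unfolding vertical_def
proof (intro conjI ballI)
  fix e assume H: "Y \<in> L \<and> (\<forall>e\<in>B. \<forall>\<^sub>F q in nhds p. Y q \<bullet> e = 0)" "Z \<in> L \<and> (\<forall>e\<in>B. \<forall>\<^sub>F q in nhds p. Z q \<bullet> e = 0)" "e \<in> B"
  then have "\<forall>\<^sub>F q in nhds p. Y q \<bullet> e = 0" "\<forall>\<^sub>F q in nhds p. Z q \<bullet> e = 0" by auto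
  then show "\<forall>\<^sub>F q in nhds p. (Y q + Z q) \<bullet> e = 0" by eventually_elim (simp add: inner_left_distrib)
qed (auto intro: L_add)

lemma vertical_scale: "vertical Y \<Longrightarrow> cxan (\<lambda>q. of_real (a q)) p \<Longrightarrow> vertical (\<lambda>q. a q *\<^sub>R Y q)"
  unfolding vertical_def by (auto intro: L_scale elim: eventually_mono)

lemma vertical_zero: "vertical (\<lambda>q. 0)" by (simp add: vertical_def L_zero)

lemma vertical_sum: "(\<And>i. i \<in> A \<Longrightarrow> vertical (Y i)) \<Longrightarrow> vertical (\<lambda>q. \<Sum>i\<in>A. Y i q)"
  by (induction A rule: infinite_finite_induct) (auto simp: vertical_zero vertical_add)

text \<open>The value at \<open>p\<close> lies in \<open>W\<close> and is orthogonal to the basis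
  \<open>B\<close> of \<open>W\<close>.\<close>

lemma vertical_p: "vertical Y \<Longrightarrow> Y p = 0"
proof -
  assume Y: "vertical Y"
  then have "Y p \<in> W" by (auto simp: vertical_def W_def)
  moreover have "Y p \<bullet> e = 0" if "e \<in> B" for e
  proof -
    have "\<forall>\<^sub>F q in nhds p. Y q \<bullet> e = 0" using Y that by (simp add: vertical_def)
    then show ?thesis by (rule eventually_nhds_x_imp_x)
  qed
  ultimately show ?thesis using W_expand[of "Y p"] by simp
qed

text \<open>Constant components along \<open>B\<close> are killed by differentiation, so both terms
  of the bracket are orthogonal to \<open>B\<close>. The constants may be nonzero, which covers the
  frame fields \<open>X b\<close> as well as vertical ones.\<close>

lemma vertical_bracket:
  assumes YL: "Y \<in> L" and Y: "\<And>e. e \<in> B \<Longrightarrow> \<exists>c. \<forall>\<^sub>F q in nhds p. Y q \<bullet> e = c"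
  shows "vertical (lie_bracket (Xs s) Y)"
  unfolding vertical_def
proof (intro conjI ballI L_bracket Xs_L YL)
  fix e assume e: "e \<in> B"
  obtain c where c: "\<forall>\<^sub>F q in nhds p. Y q \<bullet> e = c" using Y[OF e] by blast
  have ball_ev: "\<forall>\<^sub>F q in nhds p. \<forall>b\<in>Basis. frechet_derivative Z (at q) b \<bullet> e = 0"
    if "van Z p" "\<forall>\<^sub>F q in nhds p. Z q \<bullet> e = c" for Z :: "'a \<Rightarrow> 'a" and c
    by (rule eventually_ball_finite) (auto intro: frechet_derivative_inner_const that)
  from ball_ev[OF L_van[OF YL] c] ball_ev[OF L_van[OF Xs_L] Xs_inner[OF e, of s]]
    van_eventually[OF L_van[OF YL]] van_eventually[OF L_van[OF Xs_L[of s]]]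
  show "\<forall>\<^sub>F q in nhds p. lie_bracket (Xs s) Y q \<bullet> e = 0"
  proof eventually_elim
    case (elim q)
    have "frechet_derivative Z (at q) v \<bullet> e = 0"
      if "van Z q" "\<forall>b\<in>Basis. frechet_derivative Z (at q) b \<bullet> e = 0" for Z v
      by (subst linear_expand[OF has_derivative_linear[OF van_has_derivative[OF that(1)]]])
        (simp add: inner_sum_left that(2))
    with elim show ?case by (simp add: lie_bracket_def inner_diff_left)
  qed
qed

text \<open>\<open>N\<close> consists of the functions that near \<open>p\<close> have the form
  \<open>\<Sum>b\<in>Basis. Y b q \<bullet> b\<close> with vertical \<open>Y b\<close>. They vanish
  at \<open>p\<close>, and derivation along \<open>Xs s\<close> leads to functions of the same form,
  so \<open>vanishes_on_leaf_if_invariant\<close> applies. Sums over all coordinates are needed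
  because the derivative of one component brings in the others.\<close>

lemma vertical_zero_on_leaf:
  assumes Y: "vertical Y"
  shows "\<forall>\<^sub>F s in nhds 0. Y (G s) = 0"
proof -
  define N where "N = {u. cxan u p \<and> (\<exists>Y. (\<forall>b\<in>Basis. vertical (Y b)) \<and>
      (\<forall>\<^sub>F q in nhds p. u q = of_real (\<Sum>b\<in>Basis. Y b q \<bullet> b)))}"
  have step: "cxan u p \<and> u p = 0 \<and> (\<forall>s. (\<lambda>q. frechet_derivative u (at q) (Xs s q)) \<in> N)" if "u \<in> N" for u
  proof (intro conjI allI)
    obtain Y where u: "cxan u p" and Y: "\<And>b. b \<in> Basis \<Longrightarrow> vertical (Y b)"
      and uY: "\<forall>\<^sub>F q in nhds p. u q = of_real (\<Sum>b\<in>Basis. Y b q \<bullet> b)"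
      using \<open>u \<in> N\<close> unfolding N_def by blast
    have Yvan: "van (Y b) p" if "b \<in> Basis" for b using Y[OF that] L_van by (simp add: vertical_def)
    show "cxan u p" by (rule u)
    show "u p = 0" using eventually_nhds_x_imp_x[OF uY] vertical_p[OF Y] by simp
    fix s
    \<comment> \<open>The derivative of \<open>Y\<close> along \<open>Xs s\<close> is the bracket of
      \<open>Xs s\<close> with \<open>Y\<close> plus the derivative of \<open>Xs s\<close> along
      \<open>Y\<close>. The bracket is vertical; expanding the last term in the coordinates of
      \<open>Y\<close> gives a combination of the \<open>Y b\<close> with analytic
      coefficients.\<close>
    define Z where "Z b' q = lie_bracket (Xs s) (Y b') q +
        (\<Sum>b\<in>Basis. (frechet_derivative (Xs s) (at q) b' \<bullet> b) *\<^sub>R Y b q)" for b' q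
    have vXs: "van (Xs s) p" by (rule L_van[OF Xs_L])
    have Z: "vertical (Z b')" if "b' \<in> Basis" for b'
      unfolding Z_def
    proof (intro vertical_add vertical_sum vertical_scale vertical_bracket Y)
      show "Y b' \<in> L" using Y[OF that] by (simp add: vertical_def)
      show "\<exists>c. \<forall>\<^sub>F q in nhds p. Y b' q \<bullet> e = c" if "e \<in> B" for e
        using Y[OF \<open>b' \<in> Basis\<close>] that by (auto simp: vertical_def)
      show "cxan (\<lambda>q. of_real (frechet_derivative (Xs s) (at q) b' \<bullet> b)) p" for b
        by (intro van_inner van_frechet_derivative vXs)
    qed
    have "\<forall>\<^sub>F q in nhds p. \<forall>\<^sub>F q' in nhds q. u q' = of_real (\<Sum>b\<in>Basis. Y b q' \<bullet> b)"
      using uY by (simp add: eventually_eventually)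
    moreover have "\<forall>\<^sub>F q in nhds p. \<forall>b\<in>Basis. van (Y b) q"
      by (rule eventually_ball_finite) (auto intro: van_eventually Yvan)
    ultimately have "\<forall>\<^sub>F q in nhds p. frechet_derivative u (at q) (Xs s q) = of_real (\<Sum>b\<in>Basis. Z b q \<bullet> b)"
      using van_eventually[OF vXs]
    proof eventually_elim
      case (elim q)
      obtain M where M: "open M" "q \<in> M" "\<And>q'. q' \<in> M \<Longrightarrow> u q' = of_real (\<Sum>b\<in>Basis. Y b q' \<bullet> b)"
        using elim(1) unfolding eventually_nhds by blast
      have d: "((\<lambda>q. of_real (\<Sum>b\<in>Basis. Y b q \<bullet> b) :: complex) has_derivative
          (\<lambda>v. of_real (\<Sum>b\<in>Basis. frechet_derivative (Y b) (at q) v \<bullet> b))) (at q)"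
        by (intro derivative_intros van_has_derivative) (use elim in auto)
      have du: "(u has_derivative (\<lambda>v. of_real (\<Sum>b\<in>Basis. frechet_derivative (Y b) (at q) v \<bullet> b))) (at q)"
        by (rule has_derivative_transform_within_open[OF d M(1,2)]) (simp add: M(3))
      have 1: "frechet_derivative u (at q) (Xs s q) = of_real (\<Sum>b\<in>Basis. frechet_derivative (Y b) (at q) (Xs s q) \<bullet> b)"
        using fun_cong[OF frechet_derivative_at[OF du], of "Xs s q"] by simp
      have lin: "linear (frechet_derivative (Xs s) (at q))"
        by (rule has_derivative_linear[OF van_has_derivative[OF elim(3)]])
      have "(\<Sum>b\<in>Basis. frechet_derivative (Xs s) (at q) (Y b q) \<bullet> b) =
          (\<Sum>b\<in>Basis. \<Sum>b'\<in>Basis. (Y b q \<bullet> b') * (frechet_derivative (Xs s) (at q) b' \<bullet> b))"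
        by (subst linear_expand[OF lin]) (simp add: inner_sum_left)
      also have "\<dots> = (\<Sum>b'\<in>Basis. (\<Sum>b\<in>Basis. (frechet_derivative (Xs s) (at q) b' \<bullet> b) *\<^sub>R Y b q) \<bullet> b')"
        by (subst sum.swap) (simp add: inner_sum_left mult.commute)
      finally have "(\<Sum>b\<in>Basis. frechet_derivative (Y b) (at q) (Xs s q) \<bullet> b) = (\<Sum>b\<in>Basis. Z b q \<bullet> b)"
        by (simp add: Z_def lie_bracket_def inner_left_distrib inner_diff_left sum.distrib sum_subtractf)
      with 1 show ?case by simp
    qed
    then show "(\<lambda>q. frechet_derivative u (at q) (Xs s q)) \<in> N"
      unfolding N_def using Z cxan_frechet_derivative_vec[OF u vXs] by blast
  qed
  \<comment> \<open>A single component is the sum with \<open>Y\<close> in slot \<open>b\<close> and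
    zero fields in the other slots.\<close>
  have mem: "(\<lambda>q. of_real (Y q \<bullet> b)) \<in> N" if b: "b \<in> Basis" for b
    unfolding N_def
  proof (intro CollectI conjI exI[of _ "\<lambda>b'. if b' = b then Y else (\<lambda>_. 0)"] ballI)
    show "cxan (\<lambda>q. of_real (Y q \<bullet> b)) p" using Y by (intro van_inner L_van) (simp add: vertical_def)
    have "(\<Sum>b'\<in>Basis. (if b' = b then Y else (\<lambda>_. 0)) q \<bullet> b') = Y q \<bullet> b" for q
    proof -
      have "(\<Sum>b'\<in>Basis. (if b' = b then Y else (\<lambda>_. 0)) q \<bullet> b') = (\<Sum>b'\<in>Basis. if b' = b then Y q \<bullet> b else 0)"
        by (rule sum.cong) auto
      then show ?thesis using b by simp
    qed
    then show "\<forall>\<^sub>F q in nhds p. of_real (Y q \<bullet> b) = of_real (\<Sum>b'\<in>Basis. (if b' = b then Y else (\<lambda>_. 0)) q \<bullet> b')"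
      by simp
  qed (use Y vertical_zero in auto)
  have "\<forall>\<^sub>F s in nhds 0. \<forall>b\<in>Basis. (of_real (Y (G s) \<bullet> b) :: complex) = 0"
    by (rule eventually_ball_finite) (use vanishes_on_leaf_if_invariant[OF step mem] in auto)
  then show ?thesis by eventually_elim (simp add: euclidean_all_zero_iff)
qed

lemma Xs_B: "b \<in> B \<Longrightarrow> Xs b = X b"
proof
  fix q assume b: "b \<in> B"
  have "Xs b q = (\<Sum>b'\<in>B. if b' = b then X b' q else 0)"
    unfolding Xs_def by (rule sum.cong) (use b orth in auto)
  then show "Xs b q = X b q" using B(1) b by simp
qed

lemma Xs_derivative:
  assumes "\<And>b. b \<in> B \<Longrightarrow> van (X b) q"
  shows "frechet_derivative (Xs v) (at q) w = (\<Sum>b\<in>B. (v \<bullet> b) *\<^sub>R frechet_derivative (X b) (at q) w)"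
proof -
  have "(Xs v has_derivative (\<lambda>w. \<Sum>b\<in>B. (v \<bullet> b) *\<^sub>R frechet_derivative (X b) (at q) w)) (at q)"
    unfolding Xs_def[abs_def]
    by (intro has_derivative_sum has_derivative_scaleR_right van_has_derivative assms)
  from fun_cong[OF frechet_derivative_at[OF this], of w] show ?thesis by simp
qed

text \<open>
  The error \<open>e t = t (dG (t s) v - X\<^sub>v (G (t s)))\<close> satisfies a linear differential equation along the
  ray, because the vertical brackets \<open>[X\<^sub>s, X\<^sub>v]\<close> vanish on the leaf, and it starts at \<open>0\<close>.
\<close>
lemma leaf_tangent: "\<forall>\<^sub>F s in nhds 0. \<forall>v. frechet_derivative G (at s) v = Xs v (G s)"
proof -
  \<comment> \<open>Adding 1 turns the value at \<open>p\<close> into a strict bound, which persists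
    near \<open>p\<close> by continuity.\<close>
  define K where "K b i = norm (frechet_derivative (X b) (at p) i) + 1" for b i
  define M where "M = (\<Sum>b\<in>B. \<Sum>i\<in>Basis. K b i)"
  have M: "M \<ge> 0" unfolding M_def K_def by (intro sum_nonneg) simp
  have Bvan: "van (X b) p" if "b \<in> B" for b by (rule L_van[OF XL[OF that]])
  have e1: "\<forall>\<^sub>F q in nhds p. \<forall>b\<in>B. van (X b) q"
    by (rule eventually_ball_finite[OF B(1)]) (use van_eventually[OF Bvan] in blast)
  have "\<forall>\<^sub>F q in nhds p. norm (frechet_derivative (X b) (at q) i) < K b i" if "b \<in> B" for b i
  proof -
    have "isCont (\<lambda>q. norm (frechet_derivative (X b) (at q) i)) p"
      by (intro continuous_intros van_isCont van_frechet_derivative Bvan that)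
    from order_tendstoD(2)[OF isCont_nhds[OF this]] show ?thesis by (simp add: K_def)
  qed
  then have e2: "\<forall>\<^sub>F q in nhds p. \<forall>b\<in>B. \<forall>i\<in>Basis. norm (frechet_derivative (X b) (at q) i) < K b i"
    by (intro eventually_ball_finite B(1) finite_Basis ballI)
  obtain r1 where r1: "r1 > 0" "r1 \<le> \<delta>" "\<And>s. s \<in> ball 0 r1 \<Longrightarrow> (\<forall>b\<in>B. van (X b) (G s)) \<and>
      (\<forall>b\<in>B. \<forall>i\<in>Basis. norm (frechet_derivative (X b) (at (G s)) i) < K b i)"
    using G_near[OF eventually_conj[OF e1 e2]] by blast
  have "\<forall>\<^sub>F s in nhds 0. lie_bracket (X b) (X b') (G s) = 0" if "b \<in> B" "b' \<in> B" for b b'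
  proof -
    have "vertical (lie_bracket (Xs b) (X b'))"
      by (rule vertical_bracket[OF XL[OF that(2)]]) (use Xorth that in blast)
    from vertical_zero_on_leaf[OF this] show ?thesis by (simp add: Xs_B that)
  qed
  then have "\<forall>\<^sub>F s in nhds 0. \<forall>b\<in>B. \<forall>b'\<in>B. lie_bracket (X b) (X b') (G s) = 0"
    by (intro eventually_ball_finite B(1) ballI)
  then obtain r2 where r2: "r2 > 0" "\<And>s b b'. s \<in> ball 0 r2 \<Longrightarrow> b \<in> B \<Longrightarrow> b' \<in> B \<Longrightarrow> lie_bracket (X b) (X b') (G s) = 0"
    unfolding eventually_nhds_metric by (auto simp: dist_commute)
  \<comment> \<open>The bound by \<open>1 / (2 * (M + 1))\<close> gives the coefficient
    \<open>A t\<close> of the linear equation for \<open>e\<close> norm at most 1/2 on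
    \<open>{0..1}\<close>.\<close>
  define r where "r = min (min r1 r2) (1 / (2 * (M + 1)))"
  have r: "r > 0" "r \<le> r1" "r \<le> r2" using r1 r2 M by (auto simp: r_def)
  have main: "frechet_derivative G (at s) v = Xs v (G s)" if s: "s \<in> ball 0 r" for s v
  proof -
    define A where "A t w = frechet_derivative (Xs s) (at (G (t *\<^sub>R s))) w" for t w
    define e where "e t = t *\<^sub>R (frechet_derivative G (at (t *\<^sub>R s)) v - Xs v (G (t *\<^sub>R s)))" for t
    have mem: "t *\<^sub>R s \<in> ball 0 r1" "t *\<^sub>R s \<in> ball 0 r2" "t *\<^sub>R s \<in> ball 0 \<delta>" if "t \<in> {0..1}" for t
      using scale_mem[OF s that] r r1(2) by auto
    have vX: "van (X b) (G (t *\<^sub>R s))" if "t \<in> {0..1}" "b \<in> B" for t b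
      using r1(3)[OF mem(1)[OF that(1)]] that(2) by blast
    have Xsvan: "van (Xs w) (G (t *\<^sub>R s))" if "t \<in> {0..1}" for t w
      unfolding Xs_def[abs_def] by (intro van_sum van_scaleR cxan_const vX that)
    \<comment> \<open>The brackets of the frame vanish on the leaf, so the derivative of
      \<open>Xs v\<close> along \<open>Xs s\<close> equals there the derivative of
      \<open>Xs s\<close> along \<open>Xs v\<close>.\<close>
    have br: "frechet_derivative (Xs v) (at (G (t *\<^sub>R s))) (Xs s (G (t *\<^sub>R s))) = A t (Xs v (G (t *\<^sub>R s)))"
      if t: "t \<in> {0..1}" for t
    proof -
      let ?q = "G (t *\<^sub>R s)"
      have lin: "linear (frechet_derivative (X b) (at ?q))" if "b \<in> B" for b
        by (rule has_derivative_linear[OF van_has_derivative[OF vX[OF t that]]])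
      have sw: "frechet_derivative (X b) (at ?q) (X b' ?q) = frechet_derivative (X b') (at ?q) (X b ?q)"
        if "b \<in> B" "b' \<in> B" for b b'
        using r2(2)[OF mem(2)[OF t] that(2,1)] by (simp add: lie_bracket_def)
      have ex: "frechet_derivative (Xs v) (at ?q) (Xs w ?q) =
          (\<Sum>b\<in>B. \<Sum>b'\<in>B. (v \<bullet> b) *\<^sub>R (w \<bullet> b') *\<^sub>R frechet_derivative (X b) (at ?q) (X b' ?q))" for v w
      proof -
        have "frechet_derivative (Xs v) (at ?q) (Xs w ?q) = (\<Sum>b\<in>B. (v \<bullet> b) *\<^sub>R frechet_derivative (X b) (at ?q) (Xs w ?q))"
          by (rule Xs_derivative[OF vX[OF t]])
        also have "\<dots> = (\<Sum>b\<in>B. \<Sum>b'\<in>B. (v \<bullet> b) *\<^sub>R (w \<bullet> b') *\<^sub>R frechet_derivative (X b) (at ?q) (X b' ?q))"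
          by (rule sum.cong) (simp_all add: Xs_def linear_sum[OF lin] linear_scale[OF lin] scaleR_sum_right)
        finally show ?thesis .
      qed
      show ?thesis
        unfolding A_def ex
        by (subst sum.swap, intro sum.cong refl) (simp add: sw)
    qed
    have Abound: "norm (A t w) \<le> 1/2 * norm w" if t: "t \<in> {0..1}" for t w
    proof -
      have nb: "norm b = 1" if "b \<in> B" for b using orth[OF that that] by (simp add: norm_eq_1)
      have XD: "frechet_derivative (Xs s) (at (G (t *\<^sub>R s))) w =
          (\<Sum>b\<in>B. (s \<bullet> b) *\<^sub>R frechet_derivative (X b) (at (G (t *\<^sub>R s))) w)"
        by (rule Xs_derivative[OF vX[OF t]])
      have "norm (A t w) \<le> (\<Sum>b\<in>B. \<Sum>i\<in>Basis. (norm s * norm w) * K b i)"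
        unfolding A_def XD
      proof (rule sum_norm_le)
        fix b assume b: "b \<in> B"
        have lin: "linear (frechet_derivative (X b) (at (G (t *\<^sub>R s))))"
          by (rule has_derivative_linear[OF van_has_derivative[OF vX[OF t b]]])
        have "norm (\<Sum>i\<in>Basis. (s \<bullet> b) *\<^sub>R (w \<bullet> i) *\<^sub>R frechet_derivative (X b) (at (G (t *\<^sub>R s))) i)
            \<le> (\<Sum>i\<in>Basis. (norm s * norm w) * K b i)"
        proof (rule sum_norm_le)
          fix i :: 'a assume i: "i \<in> Basis"
          have "\<bar>s \<bullet> b\<bar> \<le> norm s" using Cauchy_Schwarz_ineq2[of s b] nb[OF b] by simp
          moreover have "\<bar>w \<bullet> i\<bar> \<le> norm w" using Cauchy_Schwarz_ineq2[of w i] i by simp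
          moreover have "norm (frechet_derivative (X b) (at (G (t *\<^sub>R s))) i) \<le> K b i"
            using r1(3)[OF mem(1)[OF t]] b i by (auto intro: less_imp_le)
          ultimately show "norm ((s \<bullet> b) *\<^sub>R (w \<bullet> i) *\<^sub>R frechet_derivative (X b) (at (G (t *\<^sub>R s))) i) \<le> (norm s * norm w) * K b i"
            unfolding norm_scaleR mult.assoc[symmetric] by (intro mult_mono) auto
        qed
        then show "norm ((s \<bullet> b) *\<^sub>R frechet_derivative (X b) (at (G (t *\<^sub>R s))) w)
            \<le> (\<Sum>i\<in>Basis. (norm s * norm w) * K b i)"
          by (subst linear_expand[OF lin]) (simp add: scaleR_sum_right)
      qed
      also have "\<dots> = M * norm s * norm w" by (simp add: M_def sum_distrib_left sum_distrib_right mult_ac)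
      also have "M * norm s \<le> 1/2"
      proof -
        have "norm s * (2 * (M + 1)) \<le> 1"
          using s M by (simp add: r_def pos_less_divide_eq less_imp_le)
        moreover have "norm s * (2 * (M + 1)) = 2 * (M * norm s) + 2 * norm s" by (simp add: algebra_simps)
        ultimately show ?thesis using norm_ge_zero[of s] by linarith
      qed
      finally show ?thesis by (simp add: mult_right_mono)
    qed
    have ederiv: "(e has_vector_derivative A t (e t)) (at t)" if t: "t \<in> {0..1}" for t
    proof -
      let ?x = "t *\<^sub>R s"
      note m = mem(3)[OF t]
      have linG: "linear (frechet_derivative G (at ?x))"
        by (rule has_derivative_linear[OF van_has_derivative[OF Gvan[OF m]]])
      define D2 where "D2 = frechet_derivative (\<lambda>x. frechet_derivative G (at x) v) (at ?x)"
      have linD2: "linear D2"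
        unfolding D2_def by (rule has_derivative_linear[OF van_has_derivative[OF van_frechet_derivative[OF Gvan[OF m]]]])
      have comp: "((\<lambda>x. X b (G x)) has_derivative (\<lambda>w. frechet_derivative (X b) (at (G ?x)) (frechet_derivative G (at ?x) w))) (at ?x)"
        if "b \<in> B" for b
        by (rule has_derivative_compose[OF van_has_derivative[OF Gvan[OF m]] van_has_derivative[OF vX[OF t that]]])
      \<comment> \<open>The derivative of \<open>G\<close> at \<open>x\<close>, applied to
        \<open>x\<close>, is differentiated in two ways: in the coordinates of \<open>x\<close>
        here, and through the flow equation in the next fact. Symmetry of the second derivative of
        \<open>G\<close> makes the comparison at \<open>v\<close> an equation for the derivative
        along the ray.\<close>
      have 1: "((\<lambda>x. \<Sum>i\<in>Basis. (x \<bullet> i) *\<^sub>R frechet_derivative G (at x) i) has_derivative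
          (\<lambda>w. \<Sum>i\<in>Basis. (?x \<bullet> i) *\<^sub>R frechet_derivative (\<lambda>x. frechet_derivative G (at x) i) (at ?x) w
             + (w \<bullet> i) *\<^sub>R frechet_derivative G (at ?x) i)) (at ?x)"
        by (intro derivative_intros van_has_derivative van_frechet_derivative Gvan m)
      have 2: "((\<lambda>x. \<Sum>b\<in>B. (x \<bullet> b) *\<^sub>R X b (G x)) has_derivative
          (\<lambda>w. \<Sum>b\<in>B. (?x \<bullet> b) *\<^sub>R frechet_derivative (X b) (at (G ?x)) (frechet_derivative G (at ?x) w)
             + (w \<bullet> b) *\<^sub>R X b (G ?x))) (at ?x)"
        by (intro derivative_intros comp)
      have "((\<lambda>x. \<Sum>i\<in>Basis. (x \<bullet> i) *\<^sub>R frechet_derivative G (at x) i) has_derivative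
          (\<lambda>w. \<Sum>b\<in>B. (?x \<bullet> b) *\<^sub>R frechet_derivative (X b) (at (G ?x)) (frechet_derivative G (at ?x) w)
             + (w \<bullet> b) *\<^sub>R X b (G ?x))) (at ?x)"
      proof (rule has_derivative_transform_within_open[OF 2 open_ball m])
        fix x :: 'a assume x: "x \<in> ball 0 \<delta>"
        have "frechet_derivative G (at x) x = (\<Sum>i\<in>Basis. (x \<bullet> i) *\<^sub>R frechet_derivative G (at x) i)"
          by (rule linear_expand[OF has_derivative_linear[OF van_has_derivative[OF Gvan[OF x]]]])
        with Gflow[OF x] show "(\<Sum>b\<in>B. (x \<bullet> b) *\<^sub>R X b (G x)) = (\<Sum>i\<in>Basis. (x \<bullet> i) *\<^sub>R frechet_derivative G (at x) i)"
          by simp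
      qed
      from fun_cong[OF has_derivative_unique[OF 1 this], of v]
      have "(\<Sum>i\<in>Basis. (?x \<bullet> i) *\<^sub>R frechet_derivative (\<lambda>x. frechet_derivative G (at x) i) (at ?x) v)
            + (\<Sum>i\<in>Basis. (v \<bullet> i) *\<^sub>R frechet_derivative G (at ?x) i) =
          (\<Sum>b\<in>B. (?x \<bullet> b) *\<^sub>R frechet_derivative (X b) (at (G ?x)) (frechet_derivative G (at ?x) v))
             + Xs v (G ?x)"
        by (simp add: sum.distrib Xs_def)
      moreover have "(\<Sum>i\<in>Basis. (v \<bullet> i) *\<^sub>R frechet_derivative G (at ?x) i) = frechet_derivative G (at ?x) v"
        by (rule linear_expand[OF linG, symmetric])
      moreover have "(\<Sum>i\<in>Basis. (?x \<bullet> i) *\<^sub>R frechet_derivative (\<lambda>x. frechet_derivative G (at x) i) (at ?x) v) = t *\<^sub>R D2 s"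
      proof -
        have "(\<Sum>i\<in>Basis. (?x \<bullet> i) *\<^sub>R frechet_derivative (\<lambda>x. frechet_derivative G (at x) i) (at ?x) v) = (\<Sum>i\<in>Basis. (?x \<bullet> i) *\<^sub>R D2 i)"
          unfolding D2_def by (intro sum.cong refl arg_cong2[where f = scaleR] frechet_derivative_commute_vec Gvan m)
        also have "\<dots> = D2 ?x" by (rule linear_expand[OF linD2, symmetric])
        finally show ?thesis by (simp add: linear_scale[OF linD2])
      qed
      moreover have "(\<Sum>b\<in>B. (?x \<bullet> b) *\<^sub>R frechet_derivative (X b) (at (G ?x)) (frechet_derivative G (at ?x) v)) = t *\<^sub>R A t (frechet_derivative G (at ?x) v)"
      proof -
        have "A t (frechet_derivative G (at ?x) v) =
            (\<Sum>b\<in>B. (s \<bullet> b) *\<^sub>R frechet_derivative (X b) (at (G ?x)) (frechet_derivative G (at ?x) v))"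
          unfolding A_def by (rule Xs_derivative[OF vX[OF t]])
        then show ?thesis by (simp add: scaleR_sum_right)
      qed
      ultimately have id: "t *\<^sub>R D2 s + frechet_derivative G (at ?x) v = t *\<^sub>R A t (frechet_derivative G (at ?x) v) + Xs v (G ?x)"
        by simp
      have lt: "((\<lambda>t. t *\<^sub>R s) has_derivative (\<lambda>t. t *\<^sub>R s)) (at t)" by (auto intro!: derivative_eq_intros)
      have d1: "((\<lambda>t. frechet_derivative G (at (t *\<^sub>R s)) v) has_derivative (\<lambda>u. D2 (u *\<^sub>R s))) (at t)"
        unfolding D2_def
        by (rule has_derivative_compose[OF lt van_has_derivative[OF van_frechet_derivative[OF Gvan[OF m]]]])
      have d2: "((\<lambda>t. Xs v (G (t *\<^sub>R s))) has_derivative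
          (\<lambda>u. frechet_derivative (Xs v) (at (G ?x)) (u *\<^sub>R Xs s (G ?x)))) (at t)"
        by (rule has_derivative_compose[OF G_line_derivative[OF m] van_has_derivative[OF Xsvan[OF t]]])
      have linXv: "linear (frechet_derivative (Xs w) (at (G ?x)))" for w
        by (rule has_derivative_linear[OF van_has_derivative[OF Xsvan[OF t]]])
      have "(e has_derivative (\<lambda>u. t *\<^sub>R (D2 (u *\<^sub>R s) - frechet_derivative (Xs v) (at (G ?x)) (u *\<^sub>R Xs s (G ?x)))
          + u *\<^sub>R (frechet_derivative G (at ?x) v - Xs v (G ?x)))) (at t)"
        unfolding e_def[abs_def] by (intro derivative_intros d1 d2)
      moreover have "t *\<^sub>R (D2 (u *\<^sub>R s) - frechet_derivative (Xs v) (at (G ?x)) (u *\<^sub>R Xs s (G ?x)))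
          + u *\<^sub>R (frechet_derivative G (at ?x) v - Xs v (G ?x)) = u *\<^sub>R A t (e t)" for u
      proof -
        have "A t (e t) = t *\<^sub>R A t (frechet_derivative G (at ?x) v) - t *\<^sub>R A t (Xs v (G ?x))"
          unfolding A_def e_def by (simp add: linear_scale[OF linXv] linear_diff[OF linXv] scaleR_diff_right)
        also have "\<dots> = t *\<^sub>R D2 s + frechet_derivative G (at ?x) v - Xs v (G ?x) - t *\<^sub>R A t (Xs v (G ?x))"
          using id by (simp add: algebra_simps)
        finally have eq: "A t (e t) = t *\<^sub>R D2 s + frechet_derivative G (at ?x) v - Xs v (G ?x) - t *\<^sub>R A t (Xs v (G ?x))" .
        show ?thesis unfolding eq
          by (simp add: linear_scale[OF linD2] linear_scale[OF linXv] br[OF t] algebra_simps)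
      qed
      ultimately show ?thesis unfolding has_vector_derivative_def by simp
    qed
    have ec: "continuous_on {0..1} (\<lambda>t. norm (e t))"
      by (intro continuous_on_norm continuous_at_imp_continuous_on ballI)
        (use ederiv has_vector_derivative_continuous in blast)
    \<comment> \<open>At the maximum of \<open>norm (e t)\<close> the mean value inequality gives
      \<open>norm (e t0) \<le> 1/2 * norm (e t0)\<close>, so \<open>e\<close> vanishes without a
      Gronwall estimate.\<close>
    obtain t0 where t0: "t0 \<in> {0..1}" "\<And>t. t \<in> {0..1} \<Longrightarrow> norm (e t) \<le> norm (e t0)"
      using continuous_attains_sup[OF compact_Icc _ ec] by auto
    have "norm (e t0 - e 0) \<le> (1/2 * norm (e t0)) * norm (t0 - 0)"
    proof (rule differentiable_bound[where S = "{0..1}"])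
      show "(e has_derivative (\<lambda>u. u *\<^sub>R A t (e t))) (at t within {0..1})" if "t \<in> {0..1}" for t
        using has_derivative_at_withinI[OF ederiv[OF that, unfolded has_vector_derivative_def]] .
      show "onorm (\<lambda>u. u *\<^sub>R A t (e t)) \<le> 1/2 * norm (e t0)" if "t \<in> {0..1}" for t
      proof (rule onorm_bound)
        fix u :: real
        have "norm (A t (e t)) \<le> 1/2 * norm (e t0)"
          using Abound[OF that, of "e t"] t0(2)[OF that] by linarith
        then have "norm (A t (e t)) * norm u \<le> (1/2 * norm (e t0)) * norm u"
          by (rule mult_right_mono) simp
        then show "norm (u *\<^sub>R A t (e t)) \<le> 1/2 * norm (e t0) * norm u"
          by (simp add: mult.commute)
      qed simp
    qed (use t0 in auto)
    also have "\<dots> \<le> 1/2 * norm (e t0)" using t0(1) by (simp add: mult_left_le)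
    finally have "norm (e t0 - e 0) \<le> 1/2 * norm (e t0)" .
    moreover have "e 0 = 0" by (simp add: e_def)
    ultimately have "norm (e t0) \<le> 1/2 * norm (e t0)" by (simp only: diff_zero)
    then have "norm (e t0) = 0" using norm_ge_zero[of "e t0"] by linarith
    with t0(2)[of 1] have "e 1 = 0" by simp
    then show ?thesis by (simp add: e_def)
  qed
  have "\<forall>\<^sub>F s in nhds 0. s \<in> ball (0 :: 'a) r" by (rule eventually_nhds_in_open) (use r in auto)
  then show ?thesis by eventually_elim (use main in auto)
qed

text \<open>Subtracting from \<open>Y\<close> the frame combination with the same components along
  \<open>B\<close> leaves a vertical field, which is zero on the leaf. There \<open>Y\<close> is
  thus a combination of the frame, and \<open>leaf_tangent\<close> writes it as a derivative of
  \<open>G\<close>.\<close>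

lemma leaf_tangent_field:
  assumes Y: "Y \<in> L"
  shows "\<forall>\<^sub>F s in nhds 0. Y (G s) = frechet_derivative G (at s) (\<Sum>b\<in>B. (Y (G s) \<bullet> b) *\<^sub>R b)"
proof -
  define Z where "Z q = Y q + (\<Sum>b\<in>B. (- (Y q \<bullet> b)) *\<^sub>R X b q)" for q
  have c: "cxan (\<lambda>q. of_real (- (Y q \<bullet> b))) p" for b
    using cxan_uminus[OF van_inner[OF L_van[OF Y], of b]] by simp
  have "vertical Z"
    unfolding vertical_def
  proof (intro conjI ballI)
    show "Z \<in> L" unfolding Z_def[abs_def] by (intro L_add Y L_sum L_scale XL c)
    fix e assume e: "e \<in> B"
    have "\<forall>\<^sub>F q in nhds p. \<forall>b\<in>B. X b q \<bullet> e = (if b = e then 1 else 0)"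
      by (rule eventually_ball_finite[OF B(1)]) (use Xorth e in blast)
    then show "\<forall>\<^sub>F q in nhds p. Z q \<bullet> e = 0"
    proof eventually_elim
      case (elim q)
      have "(\<Sum>b\<in>B. (- (Y q \<bullet> b)) *\<^sub>R X b q) \<bullet> e = (\<Sum>b\<in>B. if b = e then - (Y q \<bullet> e) else 0)"
        unfolding inner_sum_left by (rule sum.cong) (use elim in auto)
      then show ?case using B(1) e by (simp add: Z_def inner_left_distrib)
    qed
  qed
  from vertical_zero_on_leaf[OF this] leaf_tangent show ?thesis
  proof eventually_elim
    case (elim s)
    have "(\<Sum>b\<in>B. (Y (G s) \<bullet> b) *\<^sub>R b) \<bullet> b' = Y (G s) \<bullet> b'" if b': "b' \<in> B" for b'
    proof -
      have "(\<Sum>b\<in>B. (Y (G s) \<bullet> b) *\<^sub>R b) \<bullet> b' = (\<Sum>b\<in>B. if b = b' then Y (G s) \<bullet> b' else 0)"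
        unfolding inner_sum_left by (rule sum.cong) (use orth b' in auto)
      then show ?thesis using B(1) b' by simp
    qed
    then have "Xs (\<Sum>b\<in>B. (Y (G s) \<bullet> b) *\<^sub>R b) (G s) = (\<Sum>b\<in>B. (Y (G s) \<bullet> b) *\<^sub>R X b (G s))"
      unfolding Xs_def by (intro sum.cong) auto
    also have "\<dots> = Y (G s)" using elim(1) by (simp add: Z_def sum_negf add_eq_0_iff)
    finally show ?case using elim(2) by simp
  qed
qed

text \<open>Along a ray the velocity has the constant component \<open>s \<bullet> e\<close>. Hence,
  after translation by \<open>p\<close>, orthogonal projection to \<open>W\<close> inverts
  \<open>G\<close> on \<open>W\<close>, and the leaf is a graph.\<close>

lemma leaf_projection: "\<forall>\<^sub>F s in nhds 0. \<forall>e\<in>B. (G s - p) \<bullet> e = s \<bullet> e"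
proof (rule eventually_ball_finite[OF B(1)], intro ballI)
  fix e assume e: "e \<in> B"
  have "\<forall>\<^sub>F q in nhds p. \<forall>b\<in>B. X b q \<bullet> e = (if b = e then 1 else 0)"
    by (rule eventually_ball_finite[OF B(1)]) (use Xorth e in blast)
  then obtain r where r: "r > 0" "r \<le> \<delta>" "\<And>s b. s \<in> ball 0 r \<Longrightarrow> b \<in> B \<Longrightarrow> X b (G s) \<bullet> e = (if b = e then 1 else 0)"
    using G_near by blast
  have "(G s - p) \<bullet> e = s \<bullet> e" if s: "s \<in> ball 0 r" for s
  proof -
    define \<phi> where "\<phi> t = G (t *\<^sub>R s) \<bullet> e - t * (s \<bullet> e)" for t :: real
    have "(\<phi> has_derivative (\<lambda>u. 0)) (at t within {0..1})" if t: "t \<in> {0..1}" for t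
    proof -
      have m: "t *\<^sub>R s \<in> ball 0 r" by (rule scale_mem[OF s t])
      then have m\<delta>: "t *\<^sub>R s \<in> ball 0 \<delta>" using r by auto
      have "Xs s (G (t *\<^sub>R s)) \<bullet> e = (\<Sum>b\<in>B. if b = e then s \<bullet> b else 0)"
        unfolding Xs_def inner_sum_left by (rule sum.cong) (use r(3)[OF m] in auto)
      then have "Xs s (G (t *\<^sub>R s)) \<bullet> e = s \<bullet> e" using B(1) e by simp
      moreover have "(\<phi> has_derivative (\<lambda>u. (u *\<^sub>R Xs s (G (t *\<^sub>R s))) \<bullet> e - u * (s \<bullet> e))) (at t within {0..1})"
        unfolding \<phi>_def[abs_def]
        by (intro derivative_intros has_derivative_at_withinI[OF G_line_derivative[OF m\<delta>]])
      ultimately show ?thesis by simp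
    qed
    then have "\<phi> 1 = \<phi> 0"
      using has_derivative_zero_unique[of "{0..1}" \<phi> 0 1] by force
    then show ?thesis by (simp add: \<phi>_def G0 inner_diff_left)
  qed
  moreover have "\<forall>\<^sub>F x in nhds 0. x \<in> ball (0 :: 'a) r" by (rule eventually_nhds_in_open) (use r in auto)
  ultimately show "\<forall>\<^sub>F s in nhds 0. (G s - p) \<bullet> e = s \<bullet> e" by (auto elim: eventually_mono)
qed

end

context analytic_lie
begin

lemma flow_exists: "\<exists>B X G \<delta>. analytic_lie_flow p L B X G \<delta>"
proof -
  obtain B where B: "B \<subseteq> W" "pairwise orthogonal B" "\<And>x. x \<in> B \<Longrightarrow> norm x = 1" "independent B" "span B = W"
    using orthonormal_basis_subspace[OF subspace_W] by metis
  have fin: "finite B" using B(4) by (rule independent_imp_finite)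
  have orth: "b \<bullet> b' = (if b = b' then 1 else 0)" if "b \<in> B" "b' \<in> B" for b b'
    using B(2,3) that by (auto simp: pairwise_def orthogonal_def norm_eq_1)
  obtain X where X: "\<And>b. b \<in> B \<Longrightarrow> X b \<in> L" "\<And>b. b \<in> B \<Longrightarrow> X b p = b"
    "\<And>b a. b \<in> B \<Longrightarrow> a \<in> B \<Longrightarrow> \<forall>\<^sub>F q in nhds p. X b q \<bullet> a = (if b = a then 1 else 0)"
    using normalized_fields_exist[OF fin subset_refl B(1) orth] by blast
  obtain G \<delta> where G: "\<delta> > 0" "G 0 = p" "\<And>s. s \<in> ball 0 \<delta> \<Longrightarrow> van G s \<and>
    frechet_derivative G (at s) s = (\<Sum>b\<in>B. (s \<bullet> b) *\<^sub>R X b (G s))"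
    using analytic_flow[OF fin, of X p] L_van[OF X(1)] by blast
  have "analytic_lie_flow p L B X G \<delta>"
    by unfold_locales (use fin B orth X G in auto)
  then show ?thesis by blast
qed

end

section \<open>CR geometry\<close>

text \<open>The ideal of \<open>S\<close> at \<open>q\<close>, taken in the complex-valued functions
  so that it can contain Wronskians.\<close>

definition vanishing :: "'a::euclidean_space set \<Rightarrow> 'a \<Rightarrow> ('a \<Rightarrow> complex) \<Rightarrow> bool" where
  "vanishing S q h \<longleftrightarrow> cxan h q \<and> (\<forall>\<^sub>F x in nhds q. x \<in> S \<longrightarrow> h x = 0)"

text \<open>The real form of the CR bundle: tangent vectors whose multiple by \<open>\<i>\<close> is
  tangent too. Flows and brackets need real vectors; \<open>T01_iff\<close> gives the link to
  \<open>T01\<close>.\<close>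

definition complex_tangent :: "(complex ^ 'n) set \<Rightarrow> complex ^ 'n \<Rightarrow> (complex ^ 'n) set" where
  "complex_tangent S q = {v. \<forall>h. vanishing S q h \<longrightarrow>
     frechet_derivative h (at q) v = 0 \<and> frechet_derivative h (at q) (\<i> *s v) = 0}"

definition cnjv :: "complex ^ 'n \<Rightarrow> complex ^ 'n" where "cnjv a = (\<chi> j. cnj (a $ j))"

lemma cnjv_cnjv [simp]: "cnjv (cnjv a) = a" by (simp add: cnjv_def vec_eq_iff)

lemma vanishing_eventually:
  assumes "vanishing S p h"
  shows "\<forall>\<^sub>F q in nhds p. vanishing S q h"
  using assms cxan_eventually[of h p] eventually_eventually[of "\<lambda>x. x \<in> S \<longrightarrow> h x = 0" p]
  unfolding vanishing_def by (auto elim: eventually_elim2)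

lemma complex_vec_expand: "v = (\<Sum>j\<in>UNIV. Re (v $ j) *\<^sub>R axis j 1 + Im (v $ j) *\<^sub>R axis j \<i>)"
  for v :: "complex ^ 'n"
proof -
  have "(\<Sum>j\<in>UNIV. Re (v $ j) *\<^sub>R axis j 1 + Im (v $ j) *\<^sub>R axis j \<i>) $ k = v $ k" for k
  proof -
    have "(\<Sum>j\<in>UNIV. Re (v $ j) *\<^sub>R axis j 1 + Im (v $ j) *\<^sub>R axis j \<i>) $ k =
        (\<Sum>j\<in>UNIV. if j = k then v $ k else 0)"
      unfolding sum_component by (rule sum.cong) (auto simp: axis_def complex_eq_iff)
    then show ?thesis by simp
  qed
  then show ?thesis by (simp add: vec_eq_iff)
qed

text \<open>The conjugate vector appears because \<open>a\<close> holds coefficients of the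
  conjugate derivatives: paired with them it gives half of the differential at
  \<open>v = cnjv a\<close> plus \<open>\<i>\<close> times the differential at
  \<open>\<i> *s v\<close>.\<close>

lemma dbar_sum:
  fixes r :: "complex ^ 'n \<Rightarrow> real"
  assumes lin: "linear (frechet_derivative r (at q))"
  shows "(\<Sum>j\<in>UNIV. a $ j * dbar r q j) =
    (of_real (frechet_derivative r (at q) (cnjv a)) + \<i> * of_real (frechet_derivative r (at q) (\<i> *s cnjv a))) / 2"
proof -
  define D where "D = frechet_derivative r (at q)"
  have D: "D v = (\<Sum>j\<in>UNIV. Re (v $ j) * D (axis j 1) + Im (v $ j) * D (axis j \<i>))" for v
    using lin unfolding D_def[symmetric]
    by (subst complex_vec_expand[of v]) (simp add: linear_sum linear_add linear_scale)
  have "(of_real (D (cnjv a)) + \<i> * of_real (D (\<i> *s cnjv a))) / 2 =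
      (\<Sum>j\<in>UNIV. (of_real (Re (cnjv a $ j) * D (axis j 1) + Im (cnjv a $ j) * D (axis j \<i>)) +
        \<i> * of_real (Re ((\<i> *s cnjv a) $ j) * D (axis j 1) + Im ((\<i> *s cnjv a) $ j) * D (axis j \<i>))) / 2)"
    unfolding D[of "cnjv a"] D[of "\<i> *s cnjv a"]
    by (simp only: of_real_sum sum_distrib_left sum.distrib[symmetric] sum_divide_distrib)
  also have "\<dots> = (\<Sum>j\<in>UNIV. a $ j * dbar r q j)"
    by (rule sum.cong) (auto simp: cnjv_def dbar_def D_def[symmetric] complex_eq_iff algebra_simps)
  finally show ?thesis by (simp add: D_def)
qed

text \<open>For real \<open>r\<close> the real and imaginary parts of the complex equation are the
  two real conditions at \<open>cnjv a\<close> and at its multiple by \<open>\<i>\<close>. Complex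
  members of the ideal are split into real and imaginary parts.\<close>

lemma T01_iff: "a \<in> T01 S q \<longleftrightarrow> cnjv a \<in> complex_tangent S q"
proof
  assume a: "a \<in> T01 S q"
  have real: "frechet_derivative r (at q) (cnjv a) = 0 \<and> frechet_derivative r (at q) (\<i> *s cnjv a) = 0"
    if r: "cxan (\<lambda>x. of_real (r x)) q" "\<forall>\<^sub>F x in nhds q. x \<in> S \<longrightarrow> r x = 0" for r
  proof -
    have "(\<Sum>j\<in>UNIV. a $ j * dbar r q j) = 0"
      using a r by (auto simp: T01_def real_analytic_at_iff)
    then show ?thesis
      unfolding dbar_sum[OF has_derivative_linear[OF frechet_derivative_of_real(1)[OF r(1)]]]
      by (simp add: complex_eq_iff)
  qed
  show "cnjv a \<in> complex_tangent S q"
    unfolding complex_tangent_def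
  proof (intro CollectI allI impI)
    fix h assume h: "vanishing S q h"
    then have c: "cxan (\<lambda>x. of_real (Re (h x))) q" "cxan (\<lambda>x. of_real (Im (h x))) q"
      by (auto simp: vanishing_def)
    have z: "\<forall>\<^sub>F x in nhds q. x \<in> S \<longrightarrow> Re (h x) = 0" "\<forall>\<^sub>F x in nhds q. x \<in> S \<longrightarrow> Im (h x) = 0"
      using h unfolding vanishing_def by (auto elim: eventually_mono)
    have "((\<lambda>x. of_real (Re (h x)) + \<i> * of_real (Im (h x))) has_derivative
      (\<lambda>v. of_real (frechet_derivative (\<lambda>x. Re (h x)) (at q) v) + \<i> * of_real (frechet_derivative (\<lambda>x. Im (h x)) (at q) v))) (at q)"
      by (intro derivative_intros frechet_derivative_of_real(1) c)
    from frechet_derivative_at[OF this]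
    have "frechet_derivative h (at q) = (\<lambda>v. of_real (frechet_derivative (\<lambda>x. Re (h x)) (at q) v) + \<i> * of_real (frechet_derivative (\<lambda>x. Im (h x)) (at q) v))"
      by (simp add: complex_eq[symmetric])
    then show "frechet_derivative h (at q) (cnjv a) = 0 \<and> frechet_derivative h (at q) (\<i> *s cnjv a) = 0"
      using real[OF c(1) z(1)] real[OF c(2) z(2)] by simp
  qed
next
  assume a: "cnjv a \<in> complex_tangent S q"
  show "a \<in> T01 S q"
    unfolding T01_def
  proof (intro CollectI allI impI)
    fix r assume r: "real_analytic_at r q \<and> (\<forall>\<^sub>F x in nhds q. x \<in> S \<longrightarrow> r x = 0)"
    then have c: "cxan (\<lambda>x. of_real (r x)) q" by (simp add: real_analytic_at_iff)
    have "vanishing S q (\<lambda>x. of_real (r x))" using r c by (simp add: vanishing_def)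
    with a have "frechet_derivative (\<lambda>x. of_real (r x) :: complex) (at q) (cnjv a) = 0"
      "frechet_derivative (\<lambda>x. of_real (r x) :: complex) (at q) (\<i> *s cnjv a) = 0"
      unfolding complex_tangent_def by blast+
    then show "(\<Sum>j\<in>UNIV. a $ j * dbar r q j) = 0"
      unfolding dbar_sum[OF has_derivative_linear[OF frechet_derivative_of_real(1)[OF c]]]
        frechet_derivative_of_real(2)[OF c] by simp
  qed
qed

lemma subspace_T01: "vec.subspace (T01 S q)"
  unfolding vec.subspace_def T01_def
  by (auto simp: algebra_simps sum.distrib sum_distrib_left[symmetric])

section \<open>Analytic frames of the complex tangent spaces\<close>

lemma cxan_dbar:
  assumes "cxan (\<lambda>x. of_real (r x)) p"
  shows "cxan (\<lambda>q. dbar r q j) p"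
proof (rule cxan_cong)
  show "cxan (\<lambda>q. (frechet_derivative (\<lambda>x. of_real (r x)) (at q) (axis j 1) +
      \<i> * frechet_derivative (\<lambda>x. of_real (r x)) (at q) (axis j \<i>)) * (1 / 2)) p"
    by (intro cxan_mult cxan_add cxan_const cxan_frechet_derivative assms)
  show "\<forall>\<^sub>F q in nhds p. (frechet_derivative (\<lambda>x. of_real (r x)) (at q) (axis j 1) +
      \<i> * frechet_derivative (\<lambda>x. of_real (r x)) (at q) (axis j \<i>)) * (1 / 2) = dbar r q j"
    using cxan_eventually[OF assms]
    by eventually_elim (simp add: dbar_def frechet_derivative_of_real(2))
qed

lemma cxan_det:
  fixes A :: "'a::euclidean_space \<Rightarrow> complex ^ 'n ^ 'n"
  assumes "\<And>i j. cxan (\<lambda>q. A q $ i $ j) p"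
  shows "cxan (\<lambda>q. det (A q)) p"
  unfolding det_def by (intro cxan_sum cxan_mult cxan_prod cxan_const assms)

lemma van_complex_vec:
  fixes V :: "'a::euclidean_space \<Rightarrow> complex ^ 'n"
  assumes "\<And>k. cxan (\<lambda>q. V q $ k) p"
  shows "van V p"
  unfolding van_def
proof
  fix b :: "complex ^ 'n" assume "b \<in> Basis"
  then obtain k u where b: "b = axis k u" "u \<in> Basis" by (auto simp: Basis_vec_def)
  have "u = 1 \<or> u = \<i>" using b(2) by (auto simp: Basis_complex_def)
  have "u = 1 \<Longrightarrow> V q \<bullet> b = Re (V q $ k)" "u = \<i> \<Longrightarrow> V q \<bullet> b = Im (V q $ k)" for q
    by (auto simp: b(1) inner_axis inner_complex_def)
  with \<open>u = 1 \<or> u = \<i>\<close> show "cxan (\<lambda>x. of_real (V x \<bullet> b)) p"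
    using cxan_Re[OF assms[of k]] cxan_Im[OF assms[of k]] by auto
qed

text \<open>
  Cramer's rule turns a maximal independent set of covectors at \<open>p\<close>, completed to a basis, into
  analytic fields; constancy of the CR dimension forces them to span at every nearby point of \<open>S\<close>.
\<close>
lemma complex_tangent_spanning_fields:
  fixes S :: "(complex ^ 'n) set"
  assumes p: "p \<in> S" and dim: "\<And>q. q \<in> S \<Longrightarrow> CR_dim_at S q = n"
  shows "\<exists>V :: 'n \<Rightarrow> complex ^ 'n \<Rightarrow> complex ^ 'n. (\<forall>l. van (V l) p) \<and>
    (\<forall>\<^sub>F q in nhds p. q \<in> S \<longrightarrow> (\<forall>l. V l q \<in> complex_tangent S q) \<and>
       (\<forall>v\<in>complex_tangent S q. \<exists>w. v = (\<Sum>l\<in>UNIV. w l *s V l q)))"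
proof -
  \<comment> \<open>All real analytic germs vanishing on \<open>S\<close>; a maximal independent set
    \<open>C\<close> of their conjugate differentials at \<open>p\<close> already cuts out
    \<open>T01 S p\<close>.\<close>
  define R where "R = {r. cxan (\<lambda>x. of_real (r x)) p \<and> (\<forall>\<^sub>F x in nhds p. x \<in> S \<longrightarrow> r x = 0)}"
  define cv where "cv r q = (\<chi> j. dbar r q j)" for r :: "complex ^ 'n \<Rightarrow> real" and q
  obtain C where C: "C \<subseteq> (\<lambda>r. cv r p) ` R" "vec.independent C" "(\<lambda>r. cv r p) ` R \<subseteq> vec.span C"
    using vec.maximal_independent_subset by metis
  obtain C' where C': "C \<subseteq> C'" "vec.independent C'" "vec.span C' = UNIV"
    using vec.extend_basis_superset[OF C(2)] vec.independent_extend_basis[OF C(2)] vec.span_extend_basis[OF C(2)]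
    by blast
  have finC': "finite C'" by (rule vec.finiteI_independent[OF C'(2)])
  have "card C' = CARD('n)"
    using vec.dim_eq_card[of C' UNIV] C' by (simp add: vec.dim_UNIV card_cart_basis)
  then obtain e :: "'n \<Rightarrow> complex ^ 'n" where e: "bij_betw e UNIV C'"
    using finite_same_card_bij[of "UNIV :: 'n set" C'] finC' by auto
  have "\<forall>i. \<exists>r. e i \<in> C \<longrightarrow> r \<in> R \<and> e i = cv r p" using C(1) by auto
  then obtain \<rho> where \<rho>: "\<And>i. e i \<in> C \<Longrightarrow> \<rho> i \<in> R" "\<And>i. e i \<in> C \<Longrightarrow> e i = cv (\<rho> i) p" by metis
  define I where "I = {i. e i \<in> C}"
  \<comment> \<open>The rows in \<open>I\<close> vary analytically with \<open>q\<close>; the others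
    are constant and complete the matrix to an invertible one.\<close>
  define M where "M q = (\<chi> i. if i \<in> I then cv (\<rho> i) q else e i)" for q
  have Mp: "M p $ i = e i" for i using \<rho>(2) by (simp add: M_def I_def)
  have Mvan: "cxan (\<lambda>q. M q $ i $ j) p" for i j
  proof (cases "i \<in> I")
    case True
    then have "cxan (\<lambda>q. dbar (\<rho> i) q j) p" using \<rho>(1) by (intro cxan_dbar) (auto simp: I_def R_def)
    then show ?thesis using True by (simp add: M_def cv_def)
  qed (simp add: M_def cxan_const)
  \<comment> \<open>The rows of \<open>M p\<close> span all covectors, so a vector killed by
    \<open>M p\<close> is killed by every covector.\<close>
  have detp: "det (M p) \<noteq> 0"
  proof -
    have "x = 0" if x: "M p *v x = 0" for x
    proof -
      have "(\<Sum>j\<in>UNIV. w $ j * x $ j) = 0" for w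
      proof -
        have "w \<in> vec.span C'" using C'(3) by simp
        then show ?thesis
        proof (induction rule: vec.span_induct)
          case base
          show ?case by (auto simp: vec.subspace_def algebra_simps sum.distrib sum_distrib_left[symmetric])
        next
          case (step w)
          then obtain i where "w = M p $ i" using e Mp by (auto simp: bij_betw_def)
          then show ?case using x by (auto simp: matrix_vector_mult_def vec_eq_iff)
        qed
      qed
      from this[of "axis k 1" for k] have "x $ k = 0" for k
        by (simp add: axis_def if_distrib[of "\<lambda>u. u * _"] cong: if_cong)
      then show ?thesis by (simp add: vec_eq_iff)
    qed
    then have "invertible (M p)"
      by (simp add: invertible_left_inverse matrix_left_invertible_ker)
    then show ?thesis by (simp add: invertible_det_nz)
  qed
  have cdet: "cxan (\<lambda>q. det (M q)) p" by (rule cxan_det[OF Mvan])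
  have detq: "\<forall>\<^sub>F q in nhds p. det (M q) \<noteq> 0"
    using isCont_nhds[OF cxan_isCont[OF cdet]] detp by (rule tendsto_imp_eventually_ne)
  \<comment> \<open>\<open>K q\<close> is cut out by the chosen differentials alone. It contains
    \<open>T01 S q\<close> for \<open>q\<close> in \<open>S\<close> near \<open>p\<close>, and
    \<open>M q\<close> maps it onto the fixed space \<open>Y\<close>, so its dimension is constant;
    constancy of the CR dimension turns the inclusion into equality.\<close>
  define K where "K q = {a. \<forall>i\<in>I. (M q *v a) $ i = 0}" for q
  have Kp: "T01 S p = K p"
  proof (intro equalityI subsetI)
    fix a assume a: "a \<in> T01 S p"
    show "a \<in> K p" unfolding K_def
    proof (intro CollectI ballI)
      fix i assume i: "i \<in> I"
      then have "\<rho> i \<in> R" using \<rho>(1) by (simp add: I_def)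
      then have "(\<Sum>j\<in>UNIV. a $ j * dbar (\<rho> i) p j) = 0"
        using a by (auto simp: T01_def R_def real_analytic_at_iff)
      then show "(M p *v a) $ i = 0"
        using i by (simp add: matrix_vector_mult_def M_def cv_def mult.commute)
    qed
  next
    fix a assume a: "a \<in> K p"
    have 1: "(\<Sum>j\<in>UNIV. a $ j * x $ j) = 0" if "x \<in> vec.span C" for x
      using that
    proof (induction rule: vec.span_induct)
      case base
      show ?case by (auto simp: vec.subspace_def algebra_simps sum.distrib sum_distrib_left[symmetric])
    next
      case (step x)
      then obtain i where i: "x = M p $ i" "i \<in> I"
        using C'(1) e Mp by (fastforce simp: bij_betw_def I_def)
      then have "(M p *v a) $ i = 0" using a by (auto simp: K_def)
      then show ?case using i by (simp add: matrix_vector_mult_def mult.commute)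
    qed
    show "a \<in> T01 S p"
      unfolding T01_def
    proof (intro CollectI allI impI)
      fix r assume "real_analytic_at r p \<and> (\<forall>\<^sub>F x in nhds p. x \<in> S \<longrightarrow> r x = 0)"
      then have "r \<in> R" by (simp add: R_def real_analytic_at_iff)
      then have "cv r p \<in> vec.span C" using C(3) by blast
      from 1[OF this] show "(\<Sum>j\<in>UNIV. a $ j * dbar r p j) = 0" by (simp add: cv_def)
    qed
  qed
  have subK: "vec.subspace (K q)" for q
    by (auto simp: K_def vec.subspace_def matrix_vector_right_distrib vector_scalar_commute)
  define Y where "Y = {y :: complex ^ 'n. \<forall>i\<in>I. y $ i = 0}"
  have subY: "vec.subspace Y" by (auto simp: Y_def vec.subspace_def)
  have dimK: "vec.dim (K q) = vec.dim Y" if q: "det (M q) \<noteq> 0" for q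
  proof -
    have inv: "invertible (M q)" using q by (simp add: invertible_det_nz)
    have inj: "inj ((*v) (M q))" by (rule inj_matrix_vector_mult[OF inv])
    have "(*v) (M q) ` K q = Y"
    proof (intro equalityI subsetI)
      fix y assume "y \<in> Y"
      moreover obtain N where "M q ** N = mat 1" using inv unfolding invertible_def by blast
      then have "M q *v (N *v y) = y" by (simp add: matrix_vector_mul_assoc)
      ultimately show "y \<in> (*v) (M q) ` K q"
        by (intro image_eqI[of _ _ "N *v y"]) (auto simp: K_def Y_def)
    qed (auto simp: K_def Y_def)
    moreover have "vec.dim ((*v) (M q) ` K q) = vec.dim (K q)"
      by (rule vec.dim_image_eq) (use inj in \<open>auto intro: inj_on_subset matrix_vector_mul_linear_gen\<close>)
    ultimately show ?thesis by simp
  qed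
  have dimp: "n = vec.dim Y" using dim[OF p] Kp dimK[OF detp] by (simp add: CR_dim_at_def)
  have Rev: "\<forall>\<^sub>F q in nhds p. \<forall>i\<in>I. real_analytic_at (\<rho> i) q \<and> (\<forall>\<^sub>F x in nhds q. x \<in> S \<longrightarrow> \<rho> i x = 0)"
  proof (rule eventually_ball_finite, simp, intro ballI)
    fix i assume "i \<in> I"
    then have "\<rho> i \<in> R" using \<rho>(1) by (simp add: I_def)
    then have "\<forall>\<^sub>F q in nhds p. cxan (\<lambda>x. of_real (\<rho> i x)) q" "\<forall>\<^sub>F q in nhds p. \<forall>\<^sub>F x in nhds q. x \<in> S \<longrightarrow> \<rho> i x = 0"
      unfolding R_def by (auto simp: eventually_eventually intro: cxan_eventually)
    then show "\<forall>\<^sub>F q in nhds p. real_analytic_at (\<rho> i) q \<and> (\<forall>\<^sub>F x in nhds q. x \<in> S \<longrightarrow> \<rho> i x = 0)"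
      by eventually_elim (simp add: real_analytic_at_iff)
  qed
  have T01K: "\<forall>\<^sub>F q in nhds p. q \<in> S \<longrightarrow> T01 S q = K q"
    using Rev detq
  proof (eventually_elim, intro impI)
    fix q assume H: "\<forall>i\<in>I. real_analytic_at (\<rho> i) q \<and> (\<forall>\<^sub>F x in nhds q. x \<in> S \<longrightarrow> \<rho> i x = 0)"
      and d: "det (M q) \<noteq> 0" and q: "q \<in> S"
    have "T01 S q \<subseteq> K q"
    proof
      fix a assume a: "a \<in> T01 S q"
      show "a \<in> K q" unfolding K_def
      proof (intro CollectI ballI)
        fix i assume i: "i \<in> I"
        then have "(\<Sum>j\<in>UNIV. a $ j * dbar (\<rho> i) q j) = 0"
          using a H by (auto simp: T01_def)
        then show "(M q *v a) $ i = 0"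
          using i by (simp add: matrix_vector_mult_def M_def cv_def mult.commute)
      qed
    qed
    then show "T01 S q = K q"
      by (rule vec.subspace_dim_equal[OF subspace_T01 subK]) (use dim[OF q] dimp dimK[OF d] in \<open>simp add: CR_dim_at_def\<close>)
  qed
  \<comment> \<open>Columns of the inverse of \<open>M q\<close> in Cramer form, hence quotients of
    analytic functions. The columns with index outside \<open>I\<close> span
    \<open>K q\<close>.\<close>
  define sol where "sol q l = (\<chi> k. det (\<chi> i j. if j = k then (axis l 1 :: complex ^ 'n) $ i else M q $ i $ j) / det (M q))" for q l
  have sol: "M q *v sol q l = axis l 1" if "det (M q) \<noteq> 0" for q l
    using cramer[OF that, of "sol q l" "axis l 1"] by (simp add: sol_def)
  have csol: "cxan (\<lambda>q. sol q l $ k) p" for l k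
  proof -
    have "cxan (\<lambda>q. det (\<chi> i j. if j = k then (axis l 1 :: complex ^ 'n) $ i else M q $ i $ j) * inverse (det (M q))) p"
    proof (intro cxan_mult[OF _ cxan_inverse[OF cdet detp]] cxan_det)
      fix i j
      show "cxan (\<lambda>q. (\<chi> i j. if j = k then (axis l 1 :: complex ^ 'n) $ i else M q $ i $ j) $ i $ j) p"
        by (cases "j = k") (simp_all add: Mvan cxan_const)
    qed
    then show ?thesis by (simp add: sol_def divide_inverse)
  qed
  \<comment> \<open>The family keeps the index type \<open>'n\<close>; indices in \<open>I\<close>
    contribute the zero field.\<close>
  define V where "V l q = (if l \<in> I then 0 else cnjv (sol q l))" for l q
  show ?thesis
  proof (intro exI[of _ V] conjI allI)
    show "van (V l) p" for l
    proof (cases "l \<in> I")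
      case False
      then show ?thesis
        using csol[of l] by (intro van_complex_vec) (auto simp: V_def cnjv_def)
    next
      case True
      then have "V l = (\<lambda>q. 0)" by (simp add: V_def fun_eq_iff)
      then show ?thesis by (simp add: van_intros)
    qed
    show "\<forall>\<^sub>F q in nhds p. q \<in> S \<longrightarrow> (\<forall>l. V l q \<in> complex_tangent S q) \<and>
       (\<forall>v\<in>complex_tangent S q. \<exists>w. v = (\<Sum>l\<in>UNIV. w l *s V l q))"
      using T01K detq
    proof (eventually_elim, intro impI)
      fix q assume "q \<in> S \<longrightarrow> T01 S q = K q" and d: "det (M q) \<noteq> 0" and q: "q \<in> S"
      then have TK: "T01 S q = K q" by simp
      show "(\<forall>l. V l q \<in> complex_tangent S q) \<and> (\<forall>v\<in>complex_tangent S q. \<exists>w. v = (\<Sum>l\<in>UNIV. w l *s V l q))"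
      proof (intro conjI allI ballI)
        fix l
        have "cnjv (V l q) \<in> K q"
          using sol[OF d, of l] by (auto simp: V_def K_def axis_def cnjv_def matrix_vector_mult_def vec_eq_iff)
        then show "V l q \<in> complex_tangent S q" using T01_iff[of "cnjv (V l q)" S q] TK by simp
      next
        fix v assume v: "v \<in> complex_tangent S q"
        define y where "y = M q *v cnjv v"
        have "cnjv v \<in> K q" using v T01_iff[of "cnjv v" S q] TK by simp
        then have y0: "y $ i = 0" if "i \<in> I" for i using that by (simp add: K_def y_def)
        have "M q *v (\<Sum>l\<in>UNIV. y $ l *s sol q l) = (\<Sum>l\<in>UNIV. y $ l *s axis l 1)"
          by (simp add: vec.linear_sum[OF matrix_vector_mul_linear_gen] vector_scalar_commute sol[OF d])
        also have "\<dots> = y" by (rule basis_expansion)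
        finally have eq: "M q *v (\<Sum>l\<in>UNIV. y $ l *s sol q l) = M q *v cnjv v" by (simp add: y_def)
        have "inj ((*v) (M q))"
          by (rule inj_matrix_vector_mult) (use d in \<open>simp add: invertible_det_nz\<close>)
        from injD[OF this eq] have "cnjv v = (\<Sum>l\<in>UNIV. y $ l *s sol q l)" by (rule sym)
        then have "v = cnjv (\<Sum>l\<in>UNIV. y $ l *s sol q l)" using cnjv_cnjv[of v] by simp
        also have "\<dots> = (\<Sum>l\<in>UNIV. cnj (y $ l) *s V l q)"
        proof -
          have e: "cnj (y $ l) * cnj (sol q l $ k) = cnj (y $ l) * V l q $ k" for l k
            using y0 by (simp add: V_def cnjv_def)
          have "cnjv (\<Sum>l\<in>UNIV. y $ l *s sol q l) $ k = (\<Sum>l\<in>UNIV. cnj (y $ l) * cnj (sol q l $ k))" for k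
            by (simp add: cnjv_def sum_component)
          then show ?thesis by (simp only: vec_eq_iff e sum_component vector_smult_component) simp
        qed
        finally show "\<exists>w. v = (\<Sum>l\<in>UNIV. w l *s V l q)" by (intro exI[where x = "\<lambda>l. cnj (y $ l)"])
      qed
    qed
  qed
qed

lemma frechet_derivative_cxan_product:
  assumes h: "cxan h q" and Y: "van Y q"
  shows "frechet_derivative (\<lambda>q. frechet_derivative h (at q) (Y q)) (at q) w =
    frechet_derivative h (at q) (frechet_derivative Y (at q) w) +
    frechet_derivative (\<lambda>x. frechet_derivative h (at x) w) (at q) (Y q)"
proof -
  have lin: "linear (frechet_derivative h (at q))"
    by (rule has_derivative_linear[OF cxan_has_derivative[OF h]])
  have lin2: "linear (frechet_derivative (\<lambda>x. frechet_derivative h (at x) w) (at q))"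
    by (rule has_derivative_linear[OF cxan_has_derivative[OF cxan_frechet_derivative[OF h]]])
  obtain N where N: "open N" "q \<in> N" "\<And>x. x \<in> N \<Longrightarrow> cxan h x"
    using cxan_eventually[OF h] unfolding eventually_nhds by blast
  have d: "((\<lambda>x. \<Sum>b\<in>Basis. (Y x \<bullet> b) *\<^sub>R frechet_derivative h (at x) b) has_derivative
    (\<lambda>w. \<Sum>b\<in>Basis. (Y q \<bullet> b) *\<^sub>R frechet_derivative (\<lambda>x. frechet_derivative h (at x) b) (at q) w
        + (frechet_derivative Y (at q) w \<bullet> b) *\<^sub>R frechet_derivative h (at q) b)) (at q)"
    by (intro derivative_intros cxan_has_derivative cxan_frechet_derivative h van_has_derivative Y)
  have "((\<lambda>x. frechet_derivative h (at x) (Y x)) has_derivative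
    (\<lambda>w. \<Sum>b\<in>Basis. (Y q \<bullet> b) *\<^sub>R frechet_derivative (\<lambda>x. frechet_derivative h (at x) b) (at q) w
        + (frechet_derivative Y (at q) w \<bullet> b) *\<^sub>R frechet_derivative h (at q) b)) (at q)"
  proof (rule has_derivative_transform_within_open[OF d N(1,2)])
    fix x assume "x \<in> N"
    show "(\<Sum>b\<in>Basis. (Y x \<bullet> b) *\<^sub>R frechet_derivative h (at x) b) = frechet_derivative h (at x) (Y x)"
      by (rule linear_expand[OF has_derivative_linear[OF cxan_has_derivative[OF N(3)[OF \<open>x \<in> N\<close>]]], symmetric])
  qed
  from fun_cong[OF frechet_derivative_at[OF this], of w]
  have "frechet_derivative (\<lambda>q. frechet_derivative h (at q) (Y q)) (at q) w =
    (\<Sum>b\<in>Basis. (Y q \<bullet> b) *\<^sub>R frechet_derivative (\<lambda>x. frechet_derivative h (at x) b) (at q) w) +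
    (\<Sum>b\<in>Basis. (frechet_derivative Y (at q) w \<bullet> b) *\<^sub>R frechet_derivative h (at q) b)"
    by (simp add: sum.distrib)
  also have "(\<Sum>b\<in>Basis. (Y q \<bullet> b) *\<^sub>R frechet_derivative (\<lambda>x. frechet_derivative h (at x) b) (at q) w)
      = (\<Sum>b\<in>Basis. (Y q \<bullet> b) *\<^sub>R frechet_derivative (\<lambda>x. frechet_derivative h (at x) w) (at q) b)"
    by (intro sum.cong refl arg_cong2[where f = scaleR] frechet_derivative_commute h)
  also have "\<dots> = frechet_derivative (\<lambda>x. frechet_derivative h (at x) w) (at q) (Y q)"
    by (rule linear_expand[OF lin2, symmetric])
  also have "(\<Sum>b\<in>Basis. (frechet_derivative Y (at q) w \<bullet> b) *\<^sub>R frechet_derivative h (at q) b)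
      = frechet_derivative h (at q) (frechet_derivative Y (at q) w)"
    by (rule linear_expand[OF lin, symmetric])
  finally show ?thesis by simp
qed

text \<open>In the commutator of the two derivations the second derivatives of \<open>h\<close>
  cancel by symmetry.\<close>

lemma lie_bracket_apply:
  assumes h: "cxan h q" and X: "van X q" and Y: "van Y q"
  shows "frechet_derivative h (at q) (lie_bracket X Y q) =
    frechet_derivative (\<lambda>q. frechet_derivative h (at q) (Y q)) (at q) (X q) -
    frechet_derivative (\<lambda>q. frechet_derivative h (at q) (X q)) (at q) (Y q)"
proof -
  have lin: "linear (frechet_derivative h (at q))"
    by (rule has_derivative_linear[OF cxan_has_derivative[OF h]])
  have "frechet_derivative (\<lambda>x. frechet_derivative h (at x) (X q)) (at q) (Y q) =
      frechet_derivative (\<lambda>x. frechet_derivative h (at x) (Y q)) (at q) (X q)"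
    by (rule frechet_derivative_commute[OF h])
  then show ?thesis
    unfolding frechet_derivative_cxan_product[OF h X] frechet_derivative_cxan_product[OF h Y]
    by (simp add: lie_bracket_def linear_diff[OF lin])
qed

text \<open>
  Vanishing of the Wronskian says that \<open>f / g\<close> is constant along \<open>X\<close>, without dividing by \<open>g\<close>,
  which may vanish at the base point.
\<close>
definition wronskian :: "('a::euclidean_space \<Rightarrow> complex) \<Rightarrow> ('a \<Rightarrow> complex) \<Rightarrow> ('a \<Rightarrow> 'a) \<Rightarrow> 'a \<Rightarrow> complex" where
  "wronskian f g X q = g q * frechet_derivative f (at q) (X q) - f q * frechet_derivative g (at q) (X q)"

text \<open>Tangency as invariance of the ideal of \<open>S\<close>. This form passes to brackets at
  once, and it keeps the Wronskian of one field in the ideal when another field differentiates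
  it.\<close>

definition tangent_fields :: "'a::euclidean_space set \<Rightarrow> ('a \<Rightarrow> complex) \<Rightarrow> ('a \<Rightarrow> complex) \<Rightarrow> 'a \<Rightarrow> ('a \<Rightarrow> 'a) set" where
  "tangent_fields S f g p = {X. van X p \<and>
     (\<forall>h. vanishing S p h \<longrightarrow> vanishing S p (\<lambda>q. frechet_derivative h (at q) (X q))) \<and>
     vanishing S p (wronskian f g X)}"

lemma cxan_wronskian: "cxan f p \<Longrightarrow> cxan g p \<Longrightarrow> van X p \<Longrightarrow> cxan (wronskian f g X) p"
  unfolding wronskian_def[abs_def] by (intro cxan_diff cxan_mult cxan_frechet_derivative_vec)

lemma vanishing_cong:
  assumes "\<forall>\<^sub>F q in nhds p. h q = h' q" "vanishing S p h"
  shows "vanishing S p h'"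
proof -
  have "cxan h' p" using assms cxan_cong by (auto simp: vanishing_def)
  moreover have "\<forall>\<^sub>F q in nhds p. q \<in> S \<longrightarrow> h q = 0" using assms(2) by (simp add: vanishing_def)
  with assms(1) have "\<forall>\<^sub>F q in nhds p. q \<in> S \<longrightarrow> h' q = 0" by eventually_elim simp
  ultimately show ?thesis by (simp add: vanishing_def)
qed

lemma vanishing_zero: "vanishing S p (\<lambda>_. 0)" by (auto simp: vanishing_def)

lemma vanishing_add: "vanishing S p h \<Longrightarrow> vanishing S p h' \<Longrightarrow> vanishing S p (\<lambda>q. h q + h' q)"
  unfolding vanishing_def by (auto elim: eventually_elim2)

lemma vanishing_mult: "cxan a p \<Longrightarrow> vanishing S p h \<Longrightarrow> vanishing S p (\<lambda>q. a q * h q)"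
  unfolding vanishing_def by (auto elim: eventually_mono)

text \<open>The substance is the Wronskian of a bracket. Differentiating each of the two Wronskians
  along the other field gives it on \<open>S\<close> the value
  \<open>2 * (Xf q * Yg q - Xg q * Yf q)\<close>, and this becomes zero after multiplication by
  \<open>g q\<close>. At zeros of \<open>g\<close> equality of moduli forces \<open>f q = 0\<close>,
  and the Wronskian vanishes outright.\<close>

lemma analytic_lie_tangent_fields:
  assumes f: "cxan f p" and g: "cxan g p"
    and mod: "\<forall>\<^sub>F q in nhds p. q \<in> S \<longrightarrow> cmod (f q) = cmod (g q)"
  shows "analytic_lie p (tangent_fields S f g p)"
proof
  have lin: "\<forall>\<^sub>F q in nhds p. linear (frechet_derivative h (at q))" if "cxan h p" for h
    using cxan_eventually[OF that] by eventually_elim (rule has_derivative_linear[OF cxan_has_derivative])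
  show van: "van X p" if "X \<in> tangent_fields S f g p" for X
    using that by (simp add: tangent_fields_def)
  show "(\<lambda>_. 0) \<in> tangent_fields S f g p"
    unfolding tangent_fields_def
  proof (intro CollectI conjI allI impI van_intros)
    fix h assume "vanishing S p h"
    then have "cxan h p" by (simp add: vanishing_def)
    from lin[OF this] have "\<forall>\<^sub>F q in nhds p. 0 = frechet_derivative h (at q) 0"
      by eventually_elim (simp add: linear_0)
    then show "vanishing S p (\<lambda>q. frechet_derivative h (at q) 0)" by (rule vanishing_cong[OF _ vanishing_zero])
  next
    have "\<forall>\<^sub>F q in nhds p. 0 = wronskian f g (\<lambda>_. 0) q"
      using lin[OF f] lin[OF g] by eventually_elim (simp add: wronskian_def linear_0)
    then show "vanishing S p (wronskian f g (\<lambda>_. 0))" by (rule vanishing_cong[OF _ vanishing_zero])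
  qed
  show "(\<lambda>q. X q + Y q) \<in> tangent_fields S f g p"
    if X: "X \<in> tangent_fields S f g p" and Y: "Y \<in> tangent_fields S f g p" for X Y
    unfolding tangent_fields_def
  proof (intro CollectI conjI allI impI van_add van X Y)
    fix h assume h: "vanishing S p h"
    then have "vanishing S p (\<lambda>q. frechet_derivative h (at q) (X q) + frechet_derivative h (at q) (Y q))"
      using X Y by (intro vanishing_add) (auto simp: tangent_fields_def)
    then show "vanishing S p (\<lambda>q. frechet_derivative h (at q) (X q + Y q))"
    proof (rule vanishing_cong[rotated])
      have "cxan h p" using h by (simp add: vanishing_def)
      from lin[OF this] show "\<forall>\<^sub>F q in nhds p. frechet_derivative h (at q) (X q) + frechet_derivative h (at q) (Y q)
          = frechet_derivative h (at q) (X q + Y q)"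
        by eventually_elim (simp add: linear_add)
    qed
  next
    have "vanishing S p (\<lambda>q. wronskian f g X q + wronskian f g Y q)"
      using X Y by (intro vanishing_add) (auto simp: tangent_fields_def)
    then show "vanishing S p (wronskian f g (\<lambda>q. X q + Y q))"
    proof (rule vanishing_cong[rotated])
      show "\<forall>\<^sub>F q in nhds p. wronskian f g X q + wronskian f g Y q = wronskian f g (\<lambda>q. X q + Y q) q"
        using lin[OF f] lin[OF g] by eventually_elim (simp add: wronskian_def linear_add algebra_simps)
    qed
  qed
  show "(\<lambda>q. a q *\<^sub>R X q) \<in> tangent_fields S f g p"
    if X: "X \<in> tangent_fields S f g p" and a: "cxan (\<lambda>q. of_real (a q)) p" for X a
    unfolding tangent_fields_def
  proof (intro CollectI conjI allI impI van_scaleR van X a)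
    fix h assume h: "vanishing S p h"
    then have "vanishing S p (\<lambda>q. of_real (a q) * frechet_derivative h (at q) (X q))"
      using X by (intro vanishing_mult a) (auto simp: tangent_fields_def)
    then show "vanishing S p (\<lambda>q. frechet_derivative h (at q) (a q *\<^sub>R X q))"
    proof (rule vanishing_cong[rotated])
      have "cxan h p" using h by (simp add: vanishing_def)
      from lin[OF this] show "\<forall>\<^sub>F q in nhds p. of_real (a q) * frechet_derivative h (at q) (X q)
          = frechet_derivative h (at q) (a q *\<^sub>R X q)"
        by eventually_elim (simp add: linear_scale scaleR_conv_of_real)
    qed
  next
    have "vanishing S p (\<lambda>q. of_real (a q) * wronskian f g X q)"
      using X by (intro vanishing_mult a) (auto simp: tangent_fields_def)
    then show "vanishing S p (wronskian f g (\<lambda>q. a q *\<^sub>R X q))"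
    proof (rule vanishing_cong[rotated])
      show "\<forall>\<^sub>F q in nhds p. of_real (a q) * wronskian f g X q = wronskian f g (\<lambda>q. a q *\<^sub>R X q) q"
        using lin[OF f] lin[OF g]
        by eventually_elim (simp add: wronskian_def linear_scale scaleR_conv_of_real algebra_simps)
    qed
  qed
  show "lie_bracket X Y \<in> tangent_fields S f g p"
    if X: "X \<in> tangent_fields S f g p" and Y: "Y \<in> tangent_fields S f g p" for X Y
    unfolding tangent_fields_def
  proof (intro CollectI conjI allI impI van_lie_bracket van X Y)
    have tX: "vanishing S p (\<lambda>q. frechet_derivative h (at q) (X q))" if "vanishing S p h" for h
      using X that by (simp add: tangent_fields_def)
    have tY: "vanishing S p (\<lambda>q. frechet_derivative h (at q) (Y q))" if "vanishing S p h" for h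
      using Y that by (simp add: tangent_fields_def)
    fix h assume h: "vanishing S p h"
    then have ch: "cxan h p" by (simp add: vanishing_def)
    have "vanishing S p (\<lambda>q. frechet_derivative (\<lambda>q. frechet_derivative h (at q) (Y q)) (at q) (X q) +
        (-1) * frechet_derivative (\<lambda>q. frechet_derivative h (at q) (X q)) (at q) (Y q))"
      by (intro vanishing_add vanishing_mult cxan_const tX[OF tY[OF h]] tY[OF tX[OF h]])
    then show "vanishing S p (\<lambda>q. frechet_derivative h (at q) (lie_bracket X Y q))"
    proof (rule vanishing_cong[rotated])
      show "\<forall>\<^sub>F q in nhds p. frechet_derivative (\<lambda>q. frechet_derivative h (at q) (Y q)) (at q) (X q) +
        (-1) * frechet_derivative (\<lambda>q. frechet_derivative h (at q) (X q)) (at q) (Y q)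
          = frechet_derivative h (at q) (lie_bracket X Y q)"
        using cxan_eventually[OF ch] van_eventually[OF van[OF X]] van_eventually[OF van[OF Y]]
        by eventually_elim (simp add: lie_bracket_apply)
    qed
  next
    have tX: "vanishing S p (\<lambda>q. frechet_derivative h (at q) (X q))" if "vanishing S p h" for h
      using X that by (simp add: tangent_fields_def)
    have tY: "vanishing S p (\<lambda>q. frechet_derivative h (at q) (Y q))" if "vanishing S p h" for h
      using Y that by (simp add: tangent_fields_def)
    have wX: "vanishing S p (wronskian f g X)" and wY: "vanishing S p (wronskian f g Y)"
      using X Y by (auto simp: tangent_fields_def)
    have "\<forall>\<^sub>F q in nhds p. q \<in> S \<longrightarrow> wronskian f g X q = 0" "\<forall>\<^sub>F q in nhds p. q \<in> S \<longrightarrow> wronskian f g Y q = 0"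
      "\<forall>\<^sub>F q in nhds p. q \<in> S \<longrightarrow> frechet_derivative (wronskian f g Y) (at q) (X q) = 0"
      "\<forall>\<^sub>F q in nhds p. q \<in> S \<longrightarrow> frechet_derivative (wronskian f g X) (at q) (Y q) = 0"
      using wX wY tX[OF wY] tY[OF wX] by (auto simp: vanishing_def)
    with mod cxan_eventually[OF f] cxan_eventually[OF g] van_eventually[OF van[OF X]] van_eventually[OF van[OF Y]]
    have "\<forall>\<^sub>F q in nhds p. q \<in> S \<longrightarrow> wronskian f g (lie_bracket X Y) q = 0"
    proof eventually_elim
      case (elim q)
      show ?case
      proof
      assume "q \<in> S"
      note elim = elim this
      define Xf where "Xf q = frechet_derivative f (at q) (X q)" for q
      define Xg where "Xg q = frechet_derivative g (at q) (X q)" for q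
      define Yf where "Yf q = frechet_derivative f (at q) (Y q)" for q
      define Yg where "Yg q = frechet_derivative g (at q) (Y q)" for q
      have c: "cxan Xf q" "cxan Xg q" "cxan Yf q" "cxan Yg q"
        unfolding Xf_def[abs_def] Xg_def[abs_def] Yf_def[abs_def] Yg_def[abs_def]
        by (intro cxan_frechet_derivative_vec elim(2-5))+
      have WX: "g q * Xf q = f q * Xg q" and WY: "g q * Yf q = f q * Yg q"
        using elim by (auto simp: wronskian_def Xf_def Xg_def Yf_def Yg_def)
      have "((\<lambda>q. g q * Yf q - f q * Yg q) has_derivative (\<lambda>w. (g q * frechet_derivative Yf (at q) w + frechet_derivative g (at q) w * Yf q)
          - (f q * frechet_derivative Yg (at q) w + frechet_derivative f (at q) w * Yg q))) (at q)"
        by (intro derivative_intros cxan_has_derivative c elim(2,3))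
      from fun_cong[OF frechet_derivative_at[OF this], of "X q"]
      have 1: "g q * frechet_derivative Yf (at q) (X q) + Xg q * Yf q = f q * frechet_derivative Yg (at q) (X q) + Xf q * Yg q"
        using elim by (simp add: wronskian_def[abs_def] Xf_def[symmetric] Xg_def[symmetric] Yf_def[symmetric, abs_def] Yg_def[symmetric, abs_def])
      have "((\<lambda>q. g q * Xf q - f q * Xg q) has_derivative (\<lambda>w. (g q * frechet_derivative Xf (at q) w + frechet_derivative g (at q) w * Xf q)
          - (f q * frechet_derivative Xg (at q) w + frechet_derivative f (at q) w * Xg q))) (at q)"
        by (intro derivative_intros cxan_has_derivative c elim(2,3))
      from fun_cong[OF frechet_derivative_at[OF this], of "Y q"]
      have 2: "g q * frechet_derivative Xf (at q) (Y q) + Yg q * Xf q = f q * frechet_derivative Xg (at q) (Y q) + Yf q * Xg q"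
        using elim by (simp add: wronskian_def[abs_def] Xf_def[symmetric, abs_def] Xg_def[symmetric, abs_def] Yf_def[symmetric] Yg_def[symmetric])
      have br: "frechet_derivative f (at q) (lie_bracket X Y q) = frechet_derivative Yf (at q) (X q) - frechet_derivative Xf (at q) (Y q)"
        "frechet_derivative g (at q) (lie_bracket X Y q) = frechet_derivative Yg (at q) (X q) - frechet_derivative Xg (at q) (Y q)"
        unfolding Xf_def[abs_def] Xg_def[abs_def] Yf_def[abs_def] Yg_def[abs_def]
        by (intro lie_bracket_apply elim(2-5))+
      have "wronskian f g (lie_bracket X Y) q = 2 * (Xf q * Yg q - Xg q * Yf q)"
        using 1 2 unfolding wronskian_def br by algebra
      moreover have "wronskian f g (lie_bracket X Y) q = 0" if "g q = 0"
        using elim that by (simp add: wronskian_def)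
      moreover have "g q * (Xf q * Yg q - Xg q * Yf q) = 0"
      proof -
        have "g q * (Xf q * Yg q - Xg q * Yf q) = (g q * Xf q) * Yg q - Xg q * (g q * Yf q)" by (simp add: algebra_simps)
        also have "\<dots> = 0" unfolding WX WY by simp
        finally show ?thesis .
      qed
      ultimately show "wronskian f g (lie_bracket X Y) q = 0" by auto
      qed
    qed
    then show "vanishing S p (wronskian f g (lie_bracket X Y))"
      using cxan_wronskian[OF f g van_lie_bracket[OF van[OF X] van[OF Y]]] by (simp add: vanishing_def)
  qed
qed

lemma holomorphic_frechet_derivative:
  assumes "holomorphic_cn_on f U" "q \<in> U"
  shows "frechet_derivative f (at q) (c *s v) = c * frechet_derivative f (at q) v"
proof -
  obtain D where D: "(f has_derivative D) (at q)" "\<forall>c v. D (c *s v) = c * D v"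
    using assms unfolding holomorphic_cn_on_def by blast
  then show ?thesis using frechet_derivative_at[OF D(1)] by metis
qed

text \<open>
  Differentiating \<open>f f-bar = g g-bar\<close> along \<open>v\<close> and \<open>\<i> v\<close> separates the holomorphic part, so
  \<open>f-bar df(v) = g-bar dg(v)\<close>.
\<close>
lemma complex_tangent_field_in_tangent_fields:
  fixes S :: "(complex ^ 'n) set"
  assumes f: "holomorphic_cn_on f U" and g: "holomorphic_cn_on g U" and U: "open U" "p \<in> U"
    and mod: "\<forall>q\<in>S \<inter> U. cmod (f q) = cmod (g q)"
    and V: "van V p" "\<forall>\<^sub>F q in nhds p. q \<in> S \<longrightarrow> V q \<in> complex_tangent S q"
  shows "V \<in> tangent_fields S f g p"
proof -
  have cf: "cxan f q" and cg: "cxan g q" if "q \<in> U" for q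
    using f g U(1) that cxan_holomorphic by blast+
  have evU: "\<forall>\<^sub>F q in nhds p. q \<in> U" by (rule eventually_nhds_in_open[OF U])
  show ?thesis unfolding tangent_fields_def
  proof (intro CollectI conjI allI impI V(1))
    fix h assume h: "vanishing S p h"
    have "\<forall>\<^sub>F q in nhds p. q \<in> S \<longrightarrow> frechet_derivative h (at q) (V q) = 0"
      using V(2) vanishing_eventually[OF h] by eventually_elim (auto simp: complex_tangent_def)
    then show "vanishing S p (\<lambda>q. frechet_derivative h (at q) (V q))"
      using h V(1) by (simp add: vanishing_def cxan_frechet_derivative_vec)
  next
    have "\<forall>\<^sub>F q in nhds p. q \<in> S \<longrightarrow> wronskian f g V q = 0"
      using V(2) evU
    proof eventually_elim
      case (elim q)
      show ?case
      proof
      assume "q \<in> S"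
      note elim = elim this
      define u where "u q = f q * cnj (f q) - g q * cnj (g q)" for q
      have cu: "cxan u q" unfolding u_def[abs_def] by (intro cxan_diff cxan_mult cxan_cnj cf cg elim)
      have "\<forall>\<^sub>F x in nhds q. x \<in> U" by (rule eventually_nhds_in_open[OF U(1) elim(2)])
      then have "\<forall>\<^sub>F x in nhds q. x \<in> S \<longrightarrow> u x = 0"
        by eventually_elim (use mod in \<open>auto simp: u_def complex_norm_square[symmetric]\<close>)
      then have uv: "vanishing S q u" using cu by (simp add: vanishing_def)
      have d: "(u has_derivative (\<lambda>v. (f q * cnj (frechet_derivative f (at q) v) + frechet_derivative f (at q) v * cnj (f q))
         - (g q * cnj (frechet_derivative g (at q) v) + frechet_derivative g (at q) v * cnj (g q)))) (at q)"
        unfolding u_def[abs_def]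
        by (intro has_derivative_diff has_derivative_mult bounded_linear.has_derivative[OF bounded_linear_cnj]
            cxan_has_derivative cf cg elim)
      have du: "frechet_derivative u (at q) v = (f q * cnj (frechet_derivative f (at q) v) + frechet_derivative f (at q) v * cnj (f q))
         - (g q * cnj (frechet_derivative g (at q) v) + frechet_derivative g (at q) v * cnj (g q))" for v
        by (rule fun_cong[OF frechet_derivative_at[OF d], symmetric])
      define a where "a = frechet_derivative f (at q) (V q)"
      define b where "b = frechet_derivative g (at q) (V q)"
      have "frechet_derivative u (at q) (V q) = 0" "frechet_derivative u (at q) (\<i> *s V q) = 0"
        using elim uv by (auto simp: complex_tangent_def)
      then have "(f q * cnj a + a * cnj (f q)) - (g q * cnj b + b * cnj (g q)) = 0"
        "(f q * cnj (\<i> * a) + \<i> * a * cnj (f q)) - (g q * cnj (\<i> * b) + \<i> * b * cnj (g q)) = 0"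
        unfolding du holomorphic_frechet_derivative[OF f elim(2)] holomorphic_frechet_derivative[OF g elim(2)]
          a_def[symmetric] b_def[symmetric] by simp_all
      then have "(f q * cnj a + a * cnj (f q)) - (g q * cnj b + b * cnj (g q)) = 0"
        "\<i> * ((a * cnj (f q) - f q * cnj a) - (b * cnj (g q) - g q * cnj b)) = 0"
        by (simp_all add: algebra_simps)
      then have "(f q * cnj a + a * cnj (f q)) - (g q * cnj b + b * cnj (g q)) = 0"
        "(a * cnj (f q) - f q * cnj a) - (b * cnj (g q) - g q * cnj b) = 0" by simp_all
      then have "((f q * cnj a + a * cnj (f q)) - (g q * cnj b + b * cnj (g q))) +
          ((a * cnj (f q) - f q * cnj a) - (b * cnj (g q) - g q * cnj b)) = 0" by simp
      then have ab: "a * cnj (f q) = b * cnj (g q)" by (simp add: algebra_simps)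
      have ff: "f q * cnj (f q) = g q * cnj (g q)"
        using elim mod by (simp add: complex_norm_square[symmetric])
      \<comment> \<open>Multiplication by \<open>cnj (f q)\<close> makes \<open>ab\<close> and
        \<open>ff\<close> applicable. Where \<open>f q = 0\<close>, equality of moduli gives
        \<open>g q = 0\<close>, and the Wronskian is zero anyway.\<close>
      have "cnj (f q) * (g q * a - f q * b) = g q * (a * cnj (f q)) - (f q * cnj (f q)) * b"
        by (simp add: algebra_simps)
      also have "\<dots> = 0" unfolding ab ff by (simp add: algebra_simps)
      finally have "f q = 0 \<or> g q * a - f q * b = 0" by simp
      moreover have "cmod (f q) = cmod (g q)" using elim mod by blast
      then have "f q = 0 \<Longrightarrow> g q = 0" by simp
      ultimately show "wronskian f g V q = 0" by (auto simp: wronskian_def a_def b_def)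
      qed
    qed
    then show "vanishing S p (wronskian f g V)"
      using cxan_wronskian[OF cf[OF U(2)] cg[OF U(2)] V(1)] by (simp add: vanishing_def)
  qed
qed

lemma isCont_frechet_derivative_real:
  fixes r :: "'a::euclidean_space \<Rightarrow> real"
  assumes "cxan (\<lambda>x. of_real (r x)) p"
  shows "isCont (\<lambda>x. frechet_derivative r (at x) b) p"
proof -
  have "cxan (\<lambda>x. of_real (frechet_derivative r (at x) b)) p"
  proof (rule cxan_cong[OF _ cxan_frechet_derivative[OF assms, of b]])
    show "\<forall>\<^sub>F x in nhds p. frechet_derivative (\<lambda>x. of_real (r x)) (at x) b = complex_of_real (frechet_derivative r (at x) b)"
      using cxan_eventually[OF assms] by eventually_elim (rule frechet_derivative_of_real(2))
  qed
  from cxan_isCont[OF this] have "isCont (\<lambda>x. Re (of_real (frechet_derivative r (at x) b))) p"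
    by (rule isCont_Re)
  then show ?thesis by simp
qed

lemma complex_scale_decompose:
  "c *s x = Re c *\<^sub>R x + Im c *\<^sub>R (\<i> *s x)" for x :: "complex ^ 'n"
  by (auto simp: vec_eq_iff complex_eq_iff)

text \<open>Independence of the functionals makes their gradients distinct and independent, and the
  common kernel is the orthogonal complement of the span of the gradients.\<close>

lemma gradient_dim:
  fixes \<phi> :: "nat \<Rightarrow> 'a::euclidean_space \<Rightarrow> real"
  assumes lin: "\<And>i. i < k \<Longrightarrow> linear (\<phi> i)"
    and indep: "\<And>t :: nat \<Rightarrow> real. (\<And>v. (\<Sum>i<k. t i * \<phi> i v) = 0) \<Longrightarrow> \<forall>i<k. t i = 0"
  shows "dim {v. \<forall>i<k. \<phi> i v = 0} + k = DIM('a)"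
proof -
  define gr where "gr i = (\<Sum>b\<in>Basis. \<phi> i b *\<^sub>R b)" for i
  have gr: "\<phi> i v = gr i \<bullet> v" if "i < k" for i v
    using linear_expand[OF lin[OF that], of v]
    by (simp add: gr_def inner_sum_left inner_commute[of v] mult.commute)
  have z: "\<forall>i<k. t i = 0" if "(\<Sum>i<k. t i *\<^sub>R gr i) = 0" for t :: "nat \<Rightarrow> real"
  proof (rule indep)
    fix v
    have "(\<Sum>i<k. t i * \<phi> i v) = (\<Sum>i<k. t i *\<^sub>R gr i) \<bullet> v"
      by (simp add: inner_sum_left gr)
    then show "(\<Sum>i<k. t i * \<phi> i v) = 0" using that by simp
  qed
  have inj: "inj_on gr {..<k}"
  proof (rule inj_onI, rule ccontr)
    fix i j assume ij: "i \<in> {..<k}" "j \<in> {..<k}" "gr i = gr j" "i \<noteq> j"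
    define t where "t l = (if l = i then 1 else if l = j then -1 else 0 :: real)" for l
    have "(\<Sum>l<k. t l *\<^sub>R gr l) = (\<Sum>l\<in>{i, j}. t l *\<^sub>R gr l)"
      by (rule sum.mono_neutral_right) (use ij in \<open>auto simp: t_def\<close>)
    also have "\<dots> = 0" using ij by (simp add: t_def)
    finally have "t i = 0" using z[of t] ij by blast
    then show False by (simp add: t_def)
  qed
  have ind: "independent (gr ` {..<k})"
    unfolding dependent_finite[OF finite_imageI[OF finite_lessThan]]
  proof (rule notI, elim exE conjE bexE)
    fix u v assume u: "v \<in> gr ` {..<k}" "u v \<noteq> 0" "(\<Sum>v\<in>gr ` {..<k}. u v *\<^sub>R v) = 0"
    then have "(\<Sum>i<k. u (gr i) *\<^sub>R gr i) = 0" by (simp add: sum.reindex[OF inj])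
    from z[OF this] u(1,2) show False by auto
  qed
  have "dim {y \<in> UNIV. \<forall>x\<in>span (gr ` {..<k}). orthogonal x y} + dim (span (gr ` {..<k})) = dim (UNIV :: 'a set)"
    by (rule dim_subspace_orthogonal_to_vectors) auto
  moreover have "{y \<in> UNIV. \<forall>x\<in>span (gr ` {..<k}). orthogonal x y} = {v. \<forall>i<k. \<phi> i v = 0}"
  proof (intro equalityI subsetI)
    fix y assume "y \<in> {y \<in> UNIV. \<forall>x\<in>span (gr ` {..<k}). orthogonal x y}"
    then show "y \<in> {v. \<forall>i<k. \<phi> i v = 0}" by (auto simp: gr orthogonal_def span_base)
  next
    fix y assume "y \<in> {v. \<forall>i<k. \<phi> i v = 0}"
    then have "orthogonal y x" if "x \<in> span (gr ` {..<k})" for x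
      by (intro orthogonal_to_span[OF that]) (auto simp: gr orthogonal_def inner_commute)
    then show "y \<in> {y \<in> UNIV. \<forall>x\<in>span (gr ` {..<k}). orthogonal x y}"
      by (simp add: orthogonal_commute)
  qed
  moreover have "dim (span (gr ` {..<k})) = k"
    using dim_eq_card_independent[OF ind] card_image[OF inj] by simp
  ultimately show ?thesis by simp
qed

text \<open>
  The leaf \<open>S'\<close> through \<open>p\<close> of the fields along which \<open>f / g\<close> is constant is a CR submanifold of \<open>S\<close>
  with the same CR dimension, so by minimality it is a neighbourhood of \<open>p\<close> in \<open>S\<close>.
\<close>
proposition constant_ratio_on_minimal_submanifold:
  fixes S :: "(complex ^ 'n) set"
  assumes S: "CR_submanifold m n S" and p: "p \<in> S"
    and U: "open U" "p \<in> U" and f: "holomorphic_cn_on f U" and g: "holomorphic_cn_on g U"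
    and mod: "\<forall>q\<in>S \<inter> U. cmod (f q) = cmod (g q)"
    and minimal: "\<And>m' S'. CR_submanifold m' n S' \<Longrightarrow> p \<in> S' \<Longrightarrow> S' \<subseteq> S \<Longrightarrow> m \<le> m'"
  shows "(\<forall>\<^sub>F q in nhds p. q \<in> S \<longrightarrow> g q = 0) \<or>
    (\<exists>c. cmod c = 1 \<and> (\<forall>\<^sub>F q in nhds p. q \<in> S \<longrightarrow> f q = c * g q))"
proof -
  define \<L> where "\<L> = tangent_fields S f g p"
  have cf: "cxan f q" and cg: "cxan g q" if "q \<in> U" for q
    using cxan_holomorphic[OF f U(1) that] cxan_holomorphic[OF g U(1) that] by auto
  have evU: "\<forall>\<^sub>F q in nhds p. q \<in> U" by (rule eventually_nhds_in_open[OF U])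
  have modev: "\<forall>\<^sub>F q in nhds p. q \<in> S \<longrightarrow> cmod (f q) = cmod (g q)"
    using evU by eventually_elim (use mod in auto)
  interpret analytic_lie p \<L>
    unfolding \<L>_def by (rule analytic_lie_tangent_fields[OF cf[OF U(2)] cg[OF U(2)] modev])
  obtain B X G \<delta> where "analytic_lie_flow p \<L> B X G \<delta>" using flow_exists by blast
  then interpret analytic_lie_flow p \<L> B X G \<delta> .
  have Sdim: "CR_dim_at S q = n" if "q \<in> S" for q using S that by (simp add: CR_submanifold_def)
  have "\<exists>V :: 'n \<Rightarrow> complex ^ 'n \<Rightarrow> complex ^ 'n. (\<forall>l. van (V l) p) \<and>
    (\<forall>\<^sub>F q in nhds p. q \<in> S \<longrightarrow> (\<forall>l. V l q \<in> complex_tangent S q) \<and>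
       (\<forall>v\<in>complex_tangent S q. \<exists>w. v = (\<Sum>l\<in>UNIV. w l *s V l q)))"
    by (rule complex_tangent_spanning_fields[OF p]) (rule Sdim)
  then obtain Vf :: "'n \<Rightarrow> complex ^ 'n \<Rightarrow> complex ^ 'n" where Vf: "\<And>l. van (Vf l) p"
    and Vspan: "\<forall>\<^sub>F q in nhds p. q \<in> S \<longrightarrow> (\<forall>l. Vf l q \<in> complex_tangent S q) \<and>
       (\<forall>v\<in>complex_tangent S q. \<exists>w. v = (\<Sum>l\<in>UNIV. w l *s Vf l q))"
    by blast
  have H_i: "\<i> *s v \<in> complex_tangent S q" if "v \<in> complex_tangent S q" for v q
    unfolding complex_tangent_def
  proof (intro CollectI allI impI conjI)
    fix h assume h: "vanishing S q h"
    then have lin: "linear (frechet_derivative h (at q))"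
      by (auto simp: vanishing_def intro: has_derivative_linear cxan_has_derivative)
    have "frechet_derivative h (at q) v = 0" "frechet_derivative h (at q) (\<i> *s v) = 0"
      using that h by (auto simp: complex_tangent_def)
    moreover have "\<i> *s (\<i> *s v) = - v" by (simp add: vec_eq_iff)
    ultimately show "frechet_derivative h (at q) (\<i> *s v) = 0" "frechet_derivative h (at q) (\<i> *s (\<i> *s v)) = 0"
      by (simp_all add: linear_neg[OF lin])
  qed
  \<comment> \<open>The Lie algebra is a module over real functions only, so \<open>V\<close> and
    its multiple by \<open>\<i>\<close> are placed in it separately; together they carry the whole
    complex tangent space to the leaf.\<close>
  have VL: "Vf l \<in> \<L>" for l
    unfolding \<L>_def
    by (rule complex_tangent_field_in_tangent_fields[OF f g U mod Vf])
      (use Vspan in eventually_elim, simp)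
  have "linear ((*s) \<i> :: complex ^ 'n \<Rightarrow> _)"
    by (rule linearI) (auto simp: vec_eq_iff algebra_simps)
  then have iVvan: "van (\<lambda>q. \<i> *s Vf l q) p" for l
    by (intro van_compose[OF Vf] van_linear)
  have iVL: "(\<lambda>q. \<i> *s Vf l q) \<in> \<L>" for l
    unfolding \<L>_def
    by (rule complex_tangent_field_in_tangent_fields[OF f g U mod iVvan])
      (use Vspan in eventually_elim, use H_i in simp)

  \<comment> \<open>Containment of the leaf in \<open>S\<close>\<close>
  have Gev: "\<forall>\<^sub>F s in nhds 0. P (G s)" if P: "\<forall>\<^sub>F q in nhds p. P q" for P
  proof -
    obtain r where "r > 0" "\<forall>s\<in>ball 0 r. P (G s)" using G_near[OF P] by blast
    then show ?thesis unfolding eventually_nhds_metric by (auto simp: dist_commute)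
  qed
  obtain V k \<rho> where V: "open V" "p \<in> V" and mk: "m + k = DIM(complex ^ 'n)"
    and \<rho>an: "\<forall>i<k. \<forall>q\<in>V. real_analytic_at (\<rho> i) q" and SV: "S \<inter> V = {q \<in> V. \<forall>i<k. \<rho> i q = 0}"
    and \<rho>ind: "\<forall>q\<in>S \<inter> V. \<forall>t :: nat \<Rightarrow> real.
           (\<forall>v. (\<Sum>i<k. t i * frechet_derivative (\<rho> i) (at q) v) = 0) \<longrightarrow> (\<forall>i<k. t i = 0)"
    using S p unfolding CR_submanifold_def real_analytic_submanifold_def by blast
  have evV: "\<forall>\<^sub>F q in nhds p. q \<in> V" by (rule eventually_nhds_in_open[OF V])
  have \<rho>c: "cxan (\<lambda>x. of_real (\<rho> i x)) q" if "i < k" "q \<in> V" for i q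
    using \<rho>an that by (auto simp: real_analytic_at_iff)
  have \<rho>lin: "linear (frechet_derivative (\<rho> i) (at q))" if "i < k" "q \<in> V" for i q
    by (rule has_derivative_linear[OF frechet_derivative_of_real(1)[OF \<rho>c[OF that]]])
  have \<rho>van: "vanishing S p (\<lambda>x. of_real (\<rho> i x))" if "i < k" for i
    unfolding vanishing_def using \<rho>c[OF that V(2)] evV SV that by (auto elim!: eventually_mono)
  have tang: "vanishing S p (\<lambda>q. frechet_derivative h (at q) (Y q))" if "vanishing S p h" "Y \<in> \<L>" for h Y
    using that by (simp add: \<L>_def tangent_fields_def)
  have vp: "h p = 0" if "vanishing S p h" for h
    using that p eventually_nhds_x_imp_x[of "\<lambda>x. x \<in> S \<longrightarrow> h x = 0" p] by (simp add: vanishing_def)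
  \<comment> \<open>The ideal of \<open>S\<close> at \<open>p\<close> is itself a family invariant
    under the fields \<open>Xs s\<close> whose members vanish at \<open>p\<close>.\<close>
  have leafI: "\<forall>\<^sub>F s in nhds 0. u (G s) = 0" if "vanishing S p u" for u
    by (rule vanishes_on_leaf_if_invariant[of "{h. vanishing S p h}"]) (use that tang vp Xs_L in \<open>auto simp: vanishing_def\<close>)
  have leafS: "\<forall>\<^sub>F s in nhds 0. G s \<in> S"
  proof -
    have "\<forall>\<^sub>F s in nhds 0. \<forall>i\<in>{..<k}. (of_real (\<rho> i (G s)) :: complex) = 0"
      by (rule eventually_ball_finite) (use leafI[OF \<rho>van] in auto)
    with Gev[OF evV] show ?thesis by eventually_elim (use SV in auto)
  qed

  \<comment> \<open>Orthogonal splitting along \<open>W\<close>\<close>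
  define \<pi> where "\<pi> v = (\<Sum>b\<in>B. (v \<bullet> b) *\<^sub>R b)" for v
  have \<pi>lin: "linear \<pi>"
    unfolding \<pi>_def by (rule linearI) (auto simp: inner_left_distrib scaleR_left_distrib sum.distrib scaleR_sum_right)
  have \<pi>b: "\<pi> v \<bullet> b = v \<bullet> b" if "b \<in> B" for v b
  proof -
    have "\<pi> v \<bullet> b = (\<Sum>b'\<in>B. if b' = b then v \<bullet> b else 0)"
      unfolding \<pi>_def inner_sum_left by (rule sum.cong) (use orth that in auto)
    then show ?thesis using B(1) that by simp
  qed
  have \<pi>W: "\<pi> v \<in> W" for v
    unfolding \<pi>_def B(2)[symmetric] by (intro span_sum span_scale span_base)
  have \<pi>id: "\<pi> w = w" if "w \<in> W" for w using W_expand[OF that] by (simp add: \<pi>_def)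
  have \<pi>norm: "norm (\<pi> v) \<le> norm v" for v
  proof -
    have "\<pi> v \<bullet> (v - \<pi> v) = (\<Sum>b\<in>B. (v \<bullet> b) * (b \<bullet> (v - \<pi> v)))"
      by (subst \<pi>_def) (simp add: inner_sum_left)
    also have "\<dots> = 0"
      by (intro sum.neutral ballI) (simp add: inner_diff_right inner_commute[of _ v] inner_commute[of _ "\<pi> v"] \<pi>b)
    finally have "(norm (\<pi> v + (v - \<pi> v)))\<^sup>2 = (norm (\<pi> v))\<^sup>2 + (norm (v - \<pi> v))\<^sup>2"
      by (intro norm_add_Pythagorean) (simp add: orthogonal_def)
    then have "(norm (\<pi> v))\<^sup>2 \<le> (norm v)\<^sup>2" by simp
    then show ?thesis by (rule power2_le_imp_le) simp
  qed
  \<comment> \<open>An orthonormal basis \<open>C\<close> of the orthogonal complement supplies the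
    equations of the leaf, as many as its codimension.\<close>
  define W' where "W' = {y \<in> UNIV. \<forall>x\<in>W. orthogonal x y}"
  have subW': "subspace W'"
    by (auto simp: W'_def subspace_def orthogonal_def inner_right_distrib)
  obtain C where C: "C \<subseteq> W'" "pairwise orthogonal C" "\<And>x. x \<in> C \<Longrightarrow> norm x = 1"
    "independent C" "card C = dim W'" "span C = W'"
    using orthonormal_basis_subspace[OF subW'] by metis
  have Corth: "c \<bullet> c' = (if c = c' then 1 else 0)" if "c \<in> C" "c' \<in> C" for c c'
    using C(2,3) that by (auto simp: pairwise_def orthogonal_def norm_eq_1)
  have Bind: "independent B"
  proof (rule pairwise_orthogonal_independent)
    show "pairwise orthogonal B" using orth by (simp add: pairwise_def orthogonal_def)
    show "0 \<notin> B" using orth[of 0 0] by auto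
  qed
  have dimW: "dim W = card B" using dim_eq_card_independent[OF Bind] B(2) dim_span by metis
  have cardC: "card B + card C = DIM(complex ^ 'n)"
    using dim_subspace_orthogonal_to_vectors[OF subspace_W subspace_UNIV] C(5) dimW by (simp add: W'_def)
  have zeroBC: "D = 0" if "\<forall>b\<in>B. D \<bullet> b = 0" "\<forall>c\<in>C. D \<bullet> c = 0" for D
  proof -
    have "orthogonal D x" if "x \<in> W" for x
      using orthogonal_to_span[of x B D] that B(2) \<open>\<forall>b\<in>B. D \<bullet> b = 0\<close> by (auto simp: orthogonal_def)
    then have "D \<in> span C" unfolding C(6) by (simp add: W'_def orthogonal_commute)
    then have "orthogonal D D"
      by (rule orthogonal_to_span) (use that(2) in \<open>simp add: orthogonal_def\<close>)
    then show ?thesis by (simp add: orthogonal_def)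
  qed
  have WC: "w \<bullet> c = 0" if "w \<in> W" "c \<in> C" for w c using C(1) that by (auto simp: W'_def orthogonal_def)

  \<comment> \<open>All facts known for \<open>s\<close> near 0 are collected, so that one radius
    \<open>r\<close> serves them all.\<close>
  define good where "good s \<longleftrightarrow> s \<in> ball 0 \<delta> \<and> G s \<in> S \<and> G s \<in> U \<and> (\<forall>v. frechet_derivative G (at s) v = Xs v (G s)) \<and>
      (\<forall>e\<in>B. (G s - p) \<bullet> e = s \<bullet> e) \<and>
      (\<forall>v\<in>complex_tangent S (G s). \<exists>w. v = (\<Sum>l\<in>UNIV. w l *s Vf l (G s))) \<and>
      (\<forall>l\<in>UNIV. Vf l (G s) = frechet_derivative G (at s) (\<pi> (Vf l (G s)))) \<and>
      (\<forall>l\<in>UNIV. \<i> *s Vf l (G s) = frechet_derivative G (at s) (\<pi> (\<i> *s Vf l (G s)))) \<and>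
      (\<forall>b\<in>B. wronskian f g (X b) (G s) = 0)" for s
  have "\<forall>\<^sub>F s in nhds 0. good s"
  proof -
    have e1: "\<forall>\<^sub>F s in nhds 0. s \<in> ball (0 :: complex ^ 'n) \<delta>" by (rule eventually_nhds_in_open) (use \<delta> in auto)
    have e2: "\<forall>\<^sub>F s in nhds 0. \<forall>l\<in>UNIV. Vf l (G s) = frechet_derivative G (at s) (\<pi> (Vf l (G s)))"
      unfolding \<pi>_def by (intro eventually_ball_finite ballI leaf_tangent_field VL) simp
    have e3: "\<forall>\<^sub>F s in nhds 0. \<forall>l\<in>UNIV. \<i> *s Vf l (G s) = frechet_derivative G (at s) (\<pi> (\<i> *s Vf l (G s)))"
      unfolding \<pi>_def by (intro eventually_ball_finite ballI leaf_tangent_field[OF iVL]) simp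
    have e4: "\<forall>\<^sub>F s in nhds 0. \<forall>b\<in>B. wronskian f g (X b) (G s) = 0"
      by (intro eventually_ball_finite B(1) ballI leafI) (use XL in \<open>auto simp: \<L>_def tangent_fields_def\<close>)
    show ?thesis
      using e1 e2 e3 e4 leafS leaf_tangent leaf_projection Gev[OF evU] Gev[OF Vspan]
      unfolding good_def by eventually_elim blast
  qed
  then obtain r where r: "r > 0" "\<And>s. s \<in> ball 0 r \<Longrightarrow> good s"
    unfolding eventually_nhds_metric by (auto simp: dist_commute)
  have \<pi>G: "\<pi> (G s - p) = s" if "s \<in> ball 0 r" "s \<in> W" for s
  proof -
    have "\<pi> (G s - p) = \<pi> s"
      unfolding \<pi>_def by (rule sum.cong) (use r(2)[OF that(1)] in \<open>auto simp: good_def\<close>)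
    then show ?thesis using \<pi>id[OF that(2)] by simp
  qed
  have \<pi>ball: "\<pi> (q - p) \<in> ball 0 r" if "q \<in> ball p r" for q
    using \<pi>norm[of "q - p"] that by (simp add: dist_norm norm_minus_commute)
  \<comment> \<open>The leaf as a graph over \<open>W\<close>. Only the components along
    \<open>C\<close> are imposed; those along \<open>B\<close> agree by
    \<open>leaf_projection\<close>.\<close>
  define S' where "S' = {q \<in> ball p r. \<forall>c\<in>C. (q - G (\<pi> (q - p))) \<bullet> c = 0}"
  have S'G: "q = G (\<pi> (q - p))" if "q \<in> S'" for q
  proof -
    have q: "q \<in> ball p r" using that by (simp add: S'_def)
    have "(q - G (\<pi> (q - p))) \<bullet> b = 0" if b: "b \<in> B" for b
    proof -
      have "(G (\<pi> (q - p)) - p) \<bullet> b = \<pi> (q - p) \<bullet> b" using r(2)[OF \<pi>ball[OF q]] b by (simp add: good_def)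
      also have "\<dots> = (q - p) \<bullet> b" by (rule \<pi>b[OF b])
      finally show ?thesis by (simp add: inner_diff_left)
    qed
    then have "q - G (\<pi> (q - p)) = 0" using that by (intro zeroBC) (auto simp: S'_def)
    then show ?thesis by simp
  qed
  have GS': "G s \<in> S'" if "s \<in> ball 0 r" "s \<in> W" "G s \<in> ball p r" for s
    using \<pi>G[OF that(1,2)] that(3) by (simp add: S'_def)
  have S'sub: "S' \<subseteq> S"
  proof
    fix q assume q: "q \<in> S'"
    then have "good (\<pi> (q - p))" using r(2)[OF \<pi>ball] by (simp add: S'_def)
    then show "q \<in> S" using S'G[OF q] by (simp add: good_def)
  qed
  have pS': "p \<in> S'"
    using GS'[of 0] r(1) subspace_0[OF subspace_W] by (simp add: G0)

  \<comment> \<open>The leaf as a CR submanifold with the CR dimension of \<open>S\<close>\<close>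
  define \<sigma> where "\<sigma> c q = (q - G (\<pi> (q - p))) \<bullet> c" for c q
  have vGpi: "van (\<lambda>q. G (\<pi> (q - p))) q" if "q \<in> ball p r" for q
  proof (rule van_compose[where g = "\<lambda>q. \<pi> (q - p)" and f = G])
    show "van (\<lambda>q. \<pi> (q - p)) q" by (intro van_compose[OF _ van_linear[OF \<pi>lin]] van_diff van_intros)
    show "van G (\<pi> (q - p))" using r(2)[OF \<pi>ball[OF that]] by (intro Gvan) (simp add: good_def)
  qed
  have \<sigma>an: "cxan (\<lambda>q. of_real (\<sigma> c q)) q" if "q \<in> ball p r" for c q
    unfolding \<sigma>_def by (intro van_inner van_diff van_intros vGpi that)
  have \<sigma>der: "frechet_derivative (\<sigma> c) (at q) v = (v - frechet_derivative G (at (\<pi> (q - p))) (\<pi> v)) \<bullet> c"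
    if "q \<in> ball p r" for c q v
  proof -
    have "van G (\<pi> (q - p))" using r(2)[OF \<pi>ball[OF that]] by (intro Gvan) (simp add: good_def)
    note dG = van_has_derivative[OF this]
    have "((\<lambda>q. q - p) has_derivative (\<lambda>v. v)) (at q)" by (auto intro!: derivative_eq_intros)
    from has_derivative_compose[OF this linear_imp_has_derivative[OF \<pi>lin]]
    have "((\<lambda>q. \<pi> (q - p)) has_derivative \<pi>) (at q)" .
    from has_derivative_compose[OF this dG]
    have "(\<sigma> c has_derivative (\<lambda>v. (v - frechet_derivative G (at (\<pi> (q - p))) (\<pi> v)) \<bullet> c)) (at q)"
      unfolding \<sigma>_def[abs_def]
      by (intro has_derivative_inner_left has_derivative_diff has_derivative_ident)
    from fun_cong[OF frechet_derivative_at[OF this], of v] show ?thesis by simp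
  qed
  have subm: "real_analytic_submanifold (card B) S'"
    unfolding real_analytic_submanifold_def
  proof
    fix p' assume p': "p' \<in> S'"
    have finC: "finite C" by (rule independent_imp_finite[OF C(4)])
    obtain c where c: "bij_betw c {0..<card C} C" using ex_bij_betw_nat_finite[OF finC] by blast
    have cC: "c i \<in> C" if "i < card C" for i using c that by (auto simp: bij_betw_def)
    show "\<exists>V k. \<exists>\<rho> :: nat \<Rightarrow> complex ^ 'n \<Rightarrow> real. open V \<and> p' \<in> V \<and> card B + k = DIM(complex ^ 'n) \<and>
        (\<forall>i<k. \<forall>q\<in>V. real_analytic_at (\<rho> i) q) \<and> S' \<inter> V = {q \<in> V. \<forall>i<k. \<rho> i q = 0} \<and>
        (\<forall>q\<in>S' \<inter> V. \<forall>t :: nat \<Rightarrow> real.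
           (\<forall>v. (\<Sum>i<k. t i * frechet_derivative (\<rho> i) (at q) v) = 0) \<longrightarrow> (\<forall>i<k. t i = 0))"
    proof (intro exI[of _ "ball p r"] exI[of _ "card C"] exI[of _ "\<lambda>i. \<sigma> (c i)"] conjI cardC open_ball allI impI ballI)
      show "p' \<in> ball p r" using p' by (simp add: S'_def)
      show "real_analytic_at (\<sigma> (c i)) q" if "q \<in> ball p r" for i q
        unfolding real_analytic_at_iff by (rule \<sigma>an[OF that])
      have "(\<forall>x\<in>C. P x) \<longleftrightarrow> (\<forall>i<card C. P (c i))" for P
        using c unfolding bij_betw_def by (metis (no_types, lifting) atLeastLessThan_iff cC image_iff zero_le)
      then show "S' \<inter> ball p r = {q \<in> ball p r. \<forall>i<card C. \<sigma> (c i) q = 0}"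
        by (auto simp: S'_def \<sigma>_def)
      fix q t i assume q: "q \<in> S' \<inter> ball p r" and i: "i < card C"
        and t: "\<forall>v. (\<Sum>i<card C. t i * frechet_derivative (\<sigma> (c i)) (at q) v) = 0"
      \<comment> \<open>Moving in the direction \<open>c i\<close> leaves the projection to
        \<open>W\<close> fixed, so the differentials of the equations are dual to the basis
        \<open>C\<close> and hence independent.\<close>
      have "c i \<bullet> b = 0" if "b \<in> B" for b
        using WC[of b "c i"] span_base[OF that] B(2) cC[OF i] by (simp add: inner_commute)
      then have "\<pi> (c i) = 0" by (simp add: \<pi>_def)
      moreover have "good (\<pi> (q - p))" using r(2)[OF \<pi>ball] q by simp
      then have "frechet_derivative G (at (\<pi> (q - p))) 0 = 0"
        by (intro linear_0 has_derivative_linear[OF van_has_derivative[OF Gvan]]) (simp add: good_def)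
      ultimately have "frechet_derivative (\<sigma> (c j)) (at q) (c i) = (if j = i then 1 else 0)" if "j < card C" for j
        using \<sigma>der[of q "c j" "c i"] q Corth[OF cC[OF i] cC[OF that]] c that i
        by (auto simp: bij_betw_def inj_on_def)
      then have "(\<Sum>j<card C. t j * frechet_derivative (\<sigma> (c j)) (at q) (c i)) = (\<Sum>j<card C. if j = i then t i else 0)"
        by (intro sum.cong) auto
      then show "t i = 0" using t i by simp
    qed
  qed
  have dimS': "CR_dim_at S' q = n" if q: "q \<in> S'" for q
  proof -
    define s where "s = \<pi> (q - p)"
    have qr: "q \<in> ball p r" using q by (simp add: S'_def)
    have s: "s \<in> ball 0 r" "s \<in> W" "q = G s"
      using \<pi>ball[OF qr] \<pi>W S'G[OF q] by (auto simp: s_def)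
    have gs: "good s" by (rule r(2)[OF s(1)])
    then have vG: "van G s" by (intro Gvan) (simp add: good_def)
    have sub1: "complex_tangent S' q \<subseteq> complex_tangent S q"
    proof -
      have "vanishing S' q h" if "vanishing S q h" for h
        using that S'sub by (auto simp: vanishing_def elim: eventually_mono)
      then show ?thesis by (auto simp: complex_tangent_def)
    qed
    \<comment> \<open>\<open>h\<close> vanishes along the curve
      \<open>G (s + t *\<^sub>R w)\<close>, which stays in the leaf for small \<open>t\<close>
      because \<open>s\<close> and \<open>w\<close> lie in \<open>W\<close>.\<close>
    have leaf_dir: "frechet_derivative h (at q) (frechet_derivative G (at s) w) = 0"
      if h: "vanishing S' q h" and w: "w \<in> W" for h w
    proof -
      have ch: "cxan h (G s)" using h s by (simp add: vanishing_def)
      have "((\<lambda>t. s + t *\<^sub>R w) has_derivative (\<lambda>t. t *\<^sub>R w)) (at (0::real))" by (auto intro!: derivative_eq_intros)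
      moreover have "(G has_derivative frechet_derivative G (at s)) (at (s + 0 *\<^sub>R w))" using van_has_derivative[OF vG] by simp
      ultimately have d1: "((\<lambda>t. G (s + t *\<^sub>R w)) has_derivative (\<lambda>t. frechet_derivative G (at s) (t *\<^sub>R w))) (at 0)"
        by (rule has_derivative_compose)
      moreover have "(h has_derivative frechet_derivative h (at q)) (at (G (s + 0 *\<^sub>R w)))"
        using cxan_has_derivative[OF ch] s(3) by simp
      ultimately have d2: "((\<lambda>t. h (G (s + t *\<^sub>R w))) has_derivative
          (\<lambda>t. frechet_derivative h (at q) (frechet_derivative G (at s) (t *\<^sub>R w)))) (at 0)"
        by (rule has_derivative_compose)
      have lt: "((\<lambda>t::real. s + t *\<^sub>R w) \<longlongrightarrow> s) (nhds 0)" by (auto intro!: tendsto_eq_intros filterlim_ident)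
      have "isCont (\<lambda>t. G (s + t *\<^sub>R w)) 0" using has_derivative_continuous[OF d1] by simp
      from isCont_nhds[OF this] have lG: "((\<lambda>t. G (s + t *\<^sub>R w)) \<longlongrightarrow> q) (nhds 0)" using s(3) by simp
      have "\<forall>\<^sub>F x in nhds q. x \<in> S' \<longrightarrow> h x = 0" using h by (simp add: vanishing_def)
      then have e1: "\<forall>\<^sub>F t in nhds (0::real). G (s + t *\<^sub>R w) \<in> S' \<longrightarrow> h (G (s + t *\<^sub>R w)) = 0"
        using lG unfolding filterlim_iff by blast
      have e2: "\<forall>\<^sub>F t in nhds (0::real). s + t *\<^sub>R w \<in> ball 0 r"
        by (rule topological_tendstoD[OF lt open_ball s(1)])
      have e3: "\<forall>\<^sub>F t in nhds (0::real). G (s + t *\<^sub>R w) \<in> ball p r"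
        by (rule topological_tendstoD[OF lG open_ball qr])
      have "\<forall>\<^sub>F t in nhds (0::real). h (G (s + t *\<^sub>R w)) = 0"
        using e1 e2 e3
      proof eventually_elim
        case (elim t)
        have "s + t *\<^sub>R w \<in> W" by (intro subspace_add[OF subspace_W] subspace_scale[OF subspace_W] s w)
        from GS'[OF elim(2) this elim(3)] elim(1) show ?case by simp
      qed
      then obtain N where N: "open N" "0 \<in> N" "\<And>t. t \<in> N \<Longrightarrow> h (G (s + t *\<^sub>R w)) = 0"
        unfolding eventually_nhds by blast
      have "((\<lambda>t. h (G (s + t *\<^sub>R w))) has_derivative (\<lambda>t. 0)) (at 0)"
        by (rule has_derivative_transform_within_open[OF has_derivative_const N(1,2)]) (simp add: N(3))
      from fun_cong[OF has_derivative_unique[OF d2 this], of 1] show ?thesis by simp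
    qed
    \<comment> \<open>On the leaf the spanning fields and their multiples by \<open>\<i>\<close> are
      images of vectors of \<open>W\<close> under the derivative of \<open>G\<close>, so
      \<open>leaf_dir\<close> applies to them.\<close>
    have sub2: "complex_tangent S q \<subseteq> complex_tangent S' q"
    proof
      fix v assume "v \<in> complex_tangent S q"
      then obtain w where w: "v = (\<Sum>l\<in>UNIV. w l *s Vf l q)" using gs s(3) by (auto simp: good_def)
      show "v \<in> complex_tangent S' q"
        unfolding complex_tangent_def
      proof (intro CollectI allI impI)
        fix h assume h: "vanishing S' q h"
        then have lin: "linear (frechet_derivative h (at q))"
          by (auto simp: vanishing_def intro: has_derivative_linear cxan_has_derivative)
        have "frechet_derivative h (at q) (Vf l q) = 0" "frechet_derivative h (at q) (\<i> *s Vf l q) = 0" for l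
          using leaf_dir[OF h \<pi>W[of "Vf l q"]] leaf_dir[OF h \<pi>W[of "\<i> *s Vf l q"]] gs s(3)
          by (auto simp: good_def)
        then have z: "frechet_derivative h (at q) (\<Sum>l\<in>UNIV. u l *s Vf l q) = 0" for u
          by (subst complex_scale_decompose) (simp add: linear_sum[OF lin] linear_add[OF lin] linear_scale[OF lin])
        have "\<i> *s v = (\<Sum>l\<in>UNIV. (\<i> * w l) *s Vf l q)"
          by (simp add: w vec_eq_iff sum_component sum_distrib_left mult.assoc)
        then show "frechet_derivative h (at q) v = 0 \<and> frechet_derivative h (at q) (\<i> *s v) = 0"
          using z w by metis
      qed
    qed
    have "T01 S' q = T01 S q" using sub1 sub2 T01_iff by blast
    then show ?thesis using Sdim S'sub q by (auto simp: CR_dim_at_def)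
  qed
  have "m \<le> card B"
    by (rule minimal[OF _ pS' S'sub]) (simp add: CR_submanifold_def subm dimS')

  \<comment> \<open>Openness of the leaf in \<open>S\<close>\<close>
  define K where "K = {v. \<forall>i<k. frechet_derivative (\<rho> i) (at p) v = 0}"
  have dimK: "dim K + k = DIM(complex ^ 'n)"
    unfolding K_def by (rule gradient_dim) (use \<rho>lin V(2) \<rho>ind p in auto)
  have subK: "subspace K"
    unfolding K_def subspace_def using linear_0[OF \<rho>lin[OF _ V(2)]] linear_add[OF \<rho>lin[OF _ V(2)]] linear_scale[OF \<rho>lin[OF _ V(2)]]
    by auto
  \<comment> \<open>\<open>K\<close> is the tangent space of \<open>S\<close> at \<open>p\<close>
    and has dimension \<open>m\<close>; with \<open>m \<le> card B\<close> from minimality the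
    inclusion becomes equality.\<close>
  have "W \<subseteq> K"
  proof
    fix w assume "w \<in> W"
    then obtain Y where Y: "Y \<in> \<L>" "w = Y p" by (auto simp: W_def)
    show "w \<in> K" unfolding K_def
    proof (intro CollectI allI impI)
      fix i assume i: "i < k"
      have "frechet_derivative (\<lambda>x. of_real (\<rho> i x) :: complex) (at p) (Y p) = 0"
        by (rule vp[OF tang[OF \<rho>van[OF i] Y(1)]])
      then show "frechet_derivative (\<rho> i) (at p) w = 0"
        using frechet_derivative_of_real(2)[OF \<rho>c[OF i V(2)]] Y(2) by simp
    qed
  qed
  then have WK: "W = K"
    by (rule subspace_dim_equal[OF subspace_W subK]) (use \<open>m \<le> card B\<close> dimW dimK mk in simp)

  define gr where "gr i = (\<Sum>b\<in>Basis. frechet_derivative (\<rho> i) (at p) b *\<^sub>R b)" for i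
  have gr: "frechet_derivative (\<rho> i) (at p) v = gr i \<bullet> v" if "i < k" for i v
    using linear_expand[OF \<rho>lin[OF that V(2)], of v] by (simp add: gr_def inner_sum_left inner_commute[of v] mult.commute)
  \<comment> \<open>Projection to \<open>W\<close> together with the defining functions, packed into
    one vector by their gradients. Pairing the second component of the derivative at
    \<open>p\<close> with \<open>v\<close> gives a sum of squares, so the kernel lies in
    \<open>K = W\<close>, where \<open>\<pi>\<close> is the identity; hence it is trivial.\<close>
  define \<Psi> where "\<Psi> q = (\<pi> q, \<Sum>i<k. \<rho> i q *\<^sub>R gr i)" for q
  define \<Psi>' where "\<Psi>' q v = (\<pi> v, \<Sum>i<k. frechet_derivative (\<rho> i) (at q) v *\<^sub>R gr i)" for q v
  have d\<Psi>: "(\<Psi> has_derivative \<Psi>' q) (at q)" if "q \<in> V" for q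
    unfolding \<Psi>_def[abs_def] \<Psi>'_def[abs_def]
    by (intro has_derivative_Pair linear_imp_has_derivative \<pi>lin has_derivative_sum has_derivative_scaleR_left
        frechet_derivative_of_real(1) \<rho>c that) auto
  have inj\<Psi>: "inj (\<Psi>' p)"
    unfolding linear_injective_0[OF has_derivative_linear[OF d\<Psi>[OF V(2)]]]
  proof (intro allI impI)
    fix v assume v: "\<Psi>' p v = 0"
    then have "(\<Sum>i<k. frechet_derivative (\<rho> i) (at p) v *\<^sub>R gr i) \<bullet> v = 0" by (simp add: \<Psi>'_def zero_prod_def)
    then have "(\<Sum>i<k. (frechet_derivative (\<rho> i) (at p) v)\<^sup>2) = 0"
      by (simp add: inner_sum_left gr power2_eq_square)
    then have "\<forall>i\<in>{..<k}. (frechet_derivative (\<rho> i) (at p) v)\<^sup>2 = 0"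
      by (subst (asm) sum_nonneg_eq_0_iff) auto
    then have "v \<in> K" by (simp add: K_def)
    then have "\<pi> v = v" using WK \<pi>id by simp
    then show "v = 0" using v by (simp add: \<Psi>'_def zero_prod_def)
  qed
  obtain L' where L': "linear L'" "L' \<circ> \<Psi>' p = id"
    using linear_injective_left_inverse[OF has_derivative_linear[OF d\<Psi>[OF V(2)]] inj\<Psi>] by blast
  obtain r' where r': "r' > 0" "ball p r' \<subseteq> V" "inj_on \<Psi> (ball p r')"
  proof (rule has_derivative_locally_injective[OF V(2,1) linear_conv_bounded_linear[THEN iffD1, OF L'(1)] L'(2) d\<Psi>])
    fix e :: real assume e: "e > 0"
    \<comment> \<open>A continuous bound, zero at \<open>p\<close>, for the operator norm of the
      change in \<open>\<Psi>'\<close>; it gives the continuity of the derivative that local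
      injectivity requires.\<close>
    define \<eta> where "\<eta> x = (\<Sum>i<k. \<Sum>b\<in>Basis. \<bar>frechet_derivative (\<rho> i) (at x) b - frechet_derivative (\<rho> i) (at p) b\<bar> * norm (gr i))" for x
    have "isCont \<eta> p"
      unfolding \<eta>_def by (intro continuous_intros isCont_frechet_derivative_real \<rho>c V(2)) auto
    from order_tendstoD(2)[OF isCont_nhds[OF this], of e] e
    have "\<forall>\<^sub>F x in nhds p. \<eta> x < e" by (simp add: \<eta>_def)
    from eventually_conj[OF this evV] obtain d where d: "d > 0" "\<And>x. dist x p < d \<Longrightarrow> \<eta> x < e \<and> x \<in> V"
      unfolding eventually_nhds_metric by blast
    show "\<exists>d>0. \<forall>x. dist p x < d \<longrightarrow> onorm (\<lambda>v. \<Psi>' x v - \<Psi>' p v) < e"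
    proof (intro exI[of _ d] conjI d allI impI)
      fix x assume "dist p x < d"
      then have x: "\<eta> x < e" "x \<in> V" using d(2) by (auto simp: dist_commute)
      have "onorm (\<lambda>v. \<Psi>' x v - \<Psi>' p v) \<le> \<eta> x"
      proof (rule onorm_bound)
        show "0 \<le> \<eta> x" unfolding \<eta>_def by (intro sum_nonneg) auto
        fix v
        have "\<Psi>' x v - \<Psi>' p v = (0, \<Sum>i<k. (frechet_derivative (\<rho> i) (at x) v - frechet_derivative (\<rho> i) (at p) v) *\<^sub>R gr i)"
          by (simp add: \<Psi>'_def sum_subtractf scaleR_diff_left)
        then have "norm (\<Psi>' x v - \<Psi>' p v) = norm (\<Sum>i<k. (frechet_derivative (\<rho> i) (at x) v - frechet_derivative (\<rho> i) (at p) v) *\<^sub>R gr i)"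
          by simp
        also have "\<dots> \<le> (\<Sum>i<k. (\<Sum>b\<in>Basis. \<bar>frechet_derivative (\<rho> i) (at x) b - frechet_derivative (\<rho> i) (at p) b\<bar> * norm (gr i)) * norm v)"
        proof (rule sum_norm_le)
          fix i assume "i \<in> {..<k}"
          then have i: "i < k" by simp
          have "frechet_derivative (\<rho> i) (at x) v - frechet_derivative (\<rho> i) (at p) v =
              (\<Sum>b\<in>Basis. (v \<bullet> b) * (frechet_derivative (\<rho> i) (at x) b - frechet_derivative (\<rho> i) (at p) b))"
            using linear_expand[OF \<rho>lin[OF i x(2)], of v] linear_expand[OF \<rho>lin[OF i V(2)], of v]
            by (simp add: sum_subtractf[symmetric] algebra_simps)
          also have "\<bar>\<dots>\<bar> \<le> (\<Sum>b\<in>Basis. norm v * \<bar>frechet_derivative (\<rho> i) (at x) b - frechet_derivative (\<rho> i) (at p) b\<bar>)"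
            by (rule order_trans[OF sum_abs], intro sum_mono) (auto simp: abs_mult Basis_le_norm intro!: mult_right_mono)
          finally have "\<bar>frechet_derivative (\<rho> i) (at x) v - frechet_derivative (\<rho> i) (at p) v\<bar> * norm (gr i) \<le>
              (\<Sum>b\<in>Basis. norm v * \<bar>frechet_derivative (\<rho> i) (at x) b - frechet_derivative (\<rho> i) (at p) b\<bar>) * norm (gr i)"
            by (rule mult_right_mono) simp
          then show "norm ((frechet_derivative (\<rho> i) (at x) v - frechet_derivative (\<rho> i) (at p) v) *\<^sub>R gr i)
            \<le> (\<Sum>b\<in>Basis. \<bar>frechet_derivative (\<rho> i) (at x) b - frechet_derivative (\<rho> i) (at p) b\<bar> * norm (gr i)) * norm v"
            by (simp add: sum_distrib_right sum_distrib_left mult_ac)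
        qed
        also have "\<dots> = \<eta> x * norm v" by (simp add: \<eta>_def sum_distrib_right)
        finally show "norm (\<Psi>' x v - \<Psi>' p v) \<le> \<eta> x * norm v" .
      qed
      then show "onorm (\<lambda>v. \<Psi>' x v - \<Psi>' p v) < e" using x(1) by simp
    qed
  qed
  have \<pi>ev: "\<forall>\<^sub>F q in nhds p. P (\<pi> (q - p))" if "\<forall>\<^sub>F s in nhds 0. P s" for P
  proof -
    have "isCont (\<lambda>q. \<pi> (q - p)) p"
      by (intro van_isCont van_compose[OF _ van_linear[OF \<pi>lin]] van_diff van_intros)
    from isCont_nhds[OF this] have "((\<lambda>q. \<pi> (q - p)) \<longlongrightarrow> 0) (nhds p)" by (simp add: linear_0[OF \<pi>lin])
    then show ?thesis using that unfolding filterlim_iff by blast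
  qed
  \<comment> \<open>For \<open>q\<close> in \<open>S\<close> near \<open>p\<close>, the points
    \<open>q\<close> and \<open>G (\<pi> (q - p))\<close> have the same projection to
    \<open>W\<close> and are both zeros of all \<open>\<rho> i\<close>; injectivity of
    \<open>\<Psi>\<close> makes them equal.\<close>
  have leaf_open: "\<forall>\<^sub>F q in nhds p. q \<in> S \<longrightarrow> \<pi> (q - p) \<in> ball 0 r \<and> q = G (\<pi> (q - p))"
  proof -
    have 1: "\<forall>\<^sub>F q in nhds p. q \<in> ball p r'" by (rule eventually_nhds_in_open) (use r' in auto)
    have 2: "\<forall>\<^sub>F q in nhds p. \<pi> (q - p) \<in> ball 0 r" by (rule \<pi>ev, rule eventually_nhds_in_open) (use r in auto)
    from 1 2 \<pi>ev[OF Gev[OF 1]] show ?thesis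
    proof (eventually_elim)
      case (elim q)
      show ?case
      proof (intro impI conjI elim)
        assume qS: "q \<in> S"
        define s where "s = \<pi> (q - p)"
        have gs: "good s" using r(2) elim(2) by (simp add: s_def)
        have "\<pi> (G s) = \<pi> (G s - p) + \<pi> p" by (simp add: linear_diff[OF \<pi>lin])
        also have "\<pi> (G s - p) = \<pi> (q - p)"
          using \<pi>G[of s] elim(2) \<pi>W[of "q - p"] by (simp add: s_def)
        also have "\<pi> (q - p) + \<pi> p = \<pi> q" by (simp add: linear_diff[OF \<pi>lin])
        finally have "\<pi> (G s) = \<pi> q" .
        moreover have "\<rho> i (G s) = 0" "\<rho> i q = 0" if "i < k" for i
        proof -
          have "G s \<in> S \<inter> V" "q \<in> S \<inter> V" using gs elim r'(2) qS by (auto simp: good_def s_def)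
          then show "\<rho> i (G s) = 0" "\<rho> i q = 0" unfolding SV using that by auto
        qed
        ultimately have "\<Psi> q = \<Psi> (G s)" by (simp add: \<Psi>_def)
        then have "q = G s" using r'(3) elim by (auto simp: inj_on_def s_def)
        then show "q = G (\<pi> (q - p))" by (simp add: s_def)
      qed
    qed
  qed

  \<comment> \<open>Constancy of the ratio on the leaf\<close>
  show ?thesis
  proof (cases "\<forall>s\<in>ball 0 r. g (G s) = 0")
    case True
    have "\<forall>\<^sub>F q in nhds p. q \<in> S \<longrightarrow> g q = 0"
      using leaf_open by eventually_elim (use True in metis)
    then show ?thesis by blast
  next
    case False
    \<comment> \<open>\<open>g\<close> may vanish at \<open>p\<close>, so the constant is taken at a
      leaf point where \<open>g\<close> is nonzero.\<close>
    then obtain s0 where s0: "s0 \<in> ball 0 r" "g (G s0) \<noteq> 0" by blast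
    define c where "c = f (G s0) / g (G s0)"
    have "cmod (f (G s0)) = cmod (g (G s0))" using r(2)[OF s0(1)] mod by (auto simp: good_def)
    then have c1: "cmod c = 1" using s0(2) by (simp add: c_def norm_divide)
    \<comment> \<open>On the segment from \<open>s0\<close> to \<open>s1\<close> the quotient can be
      differentiated only away from zeros of \<open>g\<close>, so it is shown constant near
      \<open>s0\<close>. There the analytic function \<open>f - c * g\<close> vanishes, and
      therefore it vanishes along the whole segment.\<close>
    have "f (G s1) = c * g (G s1)" if s1: "s1 \<in> ball 0 r" for s1
    proof -
      define v where "v = s1 - s0"
      define l where "l t = s0 + t *\<^sub>R v" for t :: real
      have lmem: "l t \<in> ball 0 r" if "t \<in> {0..1}" for t
      proof -
        have "l t = (1 - t) *\<^sub>R s0 + t *\<^sub>R s1" by (simp add: l_def v_def algebra_simps)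
        then show ?thesis using convexD[OF convex_ball s0(1) s1, of "1 - t" t] that by auto
      qed
      have lvan: "van l t" for t
        unfolding l_def[abs_def] by (intro van_add van_intros van_linear) (simp add: linearI scaleR_left_distrib)
      have GL: "van (\<lambda>t. G (l t)) t" if "l t \<in> ball 0 r" for t
        by (rule van_compose[OF lvan]) (use r(2)[OF that] Gvan in \<open>simp add: good_def\<close>)
      have cfl: "cxan (\<lambda>t. f (G (l t))) t" and cgl: "cxan (\<lambda>t. g (G (l t))) t" if "l t \<in> ball 0 r" for t
        using cxan_compose[OF GL[OF that]] cf cg r(2)[OF that] by (auto simp: good_def)
      have lt: "(l \<longlongrightarrow> s0) (nhds 0)"
        unfolding l_def[abs_def] by (auto intro!: tendsto_eq_intros filterlim_ident)
      have e1: "\<forall>\<^sub>F t in nhds 0. l t \<in> ball 0 r" by (rule topological_tendstoD[OF lt open_ball s0(1)])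
      have l0: "l 0 = s0" by (simp add: l_def)
      have "isCont (\<lambda>t. g (G (l t))) 0" by (rule cxan_isCont[OF cgl]) (use s0(1) in \<open>simp add: l0\<close>)
      from tendsto_imp_eventually_ne[OF isCont_nhds[OF this], of 0]
      have e2: "\<forall>\<^sub>F t in nhds 0. g (G (l t)) \<noteq> 0" using s0(2) l0 by simp
      obtain \<epsilon> where \<epsilon>: "\<epsilon> > 0" "\<And>t. t \<in> ball 0 \<epsilon> \<Longrightarrow> l t \<in> ball 0 r \<and> g (G (l t)) \<noteq> 0"
        using eventually_conj[OF e1 e2] unfolding eventually_nhds_metric by (auto simp: dist_commute)
      have der: "((\<lambda>t. f (G (l t)) / g (G (l t))) has_derivative (\<lambda>h. 0)) (at t within ball 0 \<epsilon>)" if t: "t \<in> ball 0 \<epsilon>" for t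
      proof -
        have lr: "l t \<in> ball 0 r" and nz: "g (G (l t)) \<noteq> 0" using \<epsilon>(2)[OF t] by auto
        have gd: "good (l t)" by (rule r(2)[OF lr])
        have dl: "(l has_derivative (\<lambda>h. h *\<^sub>R v)) (at t)"
          unfolding l_def[abs_def] by (auto intro!: derivative_eq_intros)
        have vG: "van G (l t)" using gd by (intro Gvan) (simp add: good_def)
        have GU: "G (l t) \<in> U" using gd by (simp add: good_def)
        have dG: "frechet_derivative G (at (l t)) (h *\<^sub>R v) = Xs (h *\<^sub>R v) (G (l t))" for h
          using gd by (simp add: good_def)
        have dGl: "((\<lambda>t. G (l t)) has_derivative (\<lambda>h. Xs (h *\<^sub>R v) (G (l t)))) (at t)"
          using has_derivative_compose[OF dl van_has_derivative[OF vG]] by (simp add: dG)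
        have df: "((\<lambda>t. f (G (l t))) has_derivative (\<lambda>h. frechet_derivative f (at (G (l t))) (Xs (h *\<^sub>R v) (G (l t))))) (at t)"
          by (rule has_derivative_compose[OF dGl cxan_has_derivative[OF cf[OF GU]]])
        have dg: "((\<lambda>t. g (G (l t))) has_derivative (\<lambda>h. frechet_derivative g (at (G (l t))) (Xs (h *\<^sub>R v) (G (l t))))) (at t)"
          by (rule has_derivative_compose[OF dGl cxan_has_derivative[OF cg[OF GU]]])
        have lf: "linear (frechet_derivative f (at (G (l t))))" and lg: "linear (frechet_derivative g (at (G (l t))))"
          using has_derivative_linear[OF cxan_has_derivative[OF cf[OF GU]]]
            has_derivative_linear[OF cxan_has_derivative[OF cg[OF GU]]] by auto
        have wr: "g (G (l t)) * frechet_derivative f (at (G (l t))) (Xs u (G (l t))) =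
            f (G (l t)) * frechet_derivative g (at (G (l t))) (Xs u (G (l t)))" for u
        proof -
          have "g (G (l t)) * frechet_derivative f (at (G (l t))) (Xs u (G (l t))) - f (G (l t)) * frechet_derivative g (at (G (l t))) (Xs u (G (l t)))
            = (\<Sum>b\<in>B. of_real (u \<bullet> b) * wronskian f g (X b) (G (l t)))"
            unfolding Xs_def linear_sum[OF lf] linear_sum[OF lg] linear_scale[OF lf] linear_scale[OF lg]
            by (simp add: wronskian_def scaleR_conv_of_real sum_distrib_left sum_subtractf algebra_simps)
          also have "\<dots> = 0" using gd by (intro sum.neutral) (simp add: good_def)
          finally show ?thesis by simp
        qed
        have "((\<lambda>t. f (G (l t)) / g (G (l t))) has_derivative
           (\<lambda>h. - f (G (l t)) * (inverse (g (G (l t))) * frechet_derivative g (at (G (l t))) (Xs (h *\<^sub>R v) (G (l t))) * inverse (g (G (l t)))) +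
              frechet_derivative f (at (G (l t))) (Xs (h *\<^sub>R v) (G (l t))) / g (G (l t)))) (at t)"
          by (rule has_derivative_divide[OF df dg nz])
        moreover have "- f (G (l t)) * (inverse (g (G (l t))) * frechet_derivative g (at (G (l t))) (Xs u (G (l t))) * inverse (g (G (l t)))) +
              frechet_derivative f (at (G (l t))) (Xs u (G (l t))) / g (G (l t)) = 0" for u
          using wr[of u] nz by (simp add: field_simps)
        ultimately show ?thesis by (simp add: has_derivative_at_withinI)
      qed
      obtain c' where c': "\<And>t. t \<in> ball 0 \<epsilon> \<Longrightarrow> f (G (l t)) / g (G (l t)) = c'"
        using has_derivative_zero_constant[OF convex_ball der] by blast
      have "c' = c" using c'[of 0] \<epsilon>(1) l0 by (simp add: c_def)
      then have "f (G (l t)) - c * g (G (l t)) = 0" if "t \<in> ball 0 \<epsilon>" for t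
        using c'[OF that] \<epsilon>(2)[OF that] by (simp add: field_simps)
      moreover have "\<forall>\<^sub>F t in nhds 0. t \<in> ball (0::real) \<epsilon>" by (rule eventually_nhds_in_open) (use \<epsilon> in auto)
      ultimately have z: "\<forall>\<^sub>F t in nhds 0. f (G (l t)) - c * g (G (l t)) = 0" by (auto elim: eventually_mono)
      have "f (G (l 1)) - c * g (G (l 1)) = 0"
        by (rule cxan_zero_on_interval[where a = 0 and b = 1 and ?t0.0 = 0, OF _ _ z])
          (use cfl cgl lmem in \<open>auto intro!: cxan_diff cxan_mult cxan_const\<close>)
      then show ?thesis by (simp add: l_def v_def)
    qed
    then have "\<forall>\<^sub>F q in nhds p. q \<in> S \<longrightarrow> f q = c * g q"
      using leaf_open by (elim eventually_mono) metis
    then show ?thesis using c1 by blast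
  qed
qed

lemma holomorphic_cn_on_diff_scale:
  assumes "holomorphic_cn_on f U" "holomorphic_cn_on g U"
  shows "holomorphic_cn_on (\<lambda>z. f z - c * g z) U"
  unfolding holomorphic_cn_on_def
proof
  fix z assume "z \<in> U"
  then obtain D E where "(f has_derivative D) (at z)" "\<forall>c v. D (c *s v) = c * D v"
    "(g has_derivative E) (at z)" "\<forall>c v. E (c *s v) = c * E v"
    using assms unfolding holomorphic_cn_on_def by meson
  then show "\<exists>D. ((\<lambda>z. f z - c * g z) has_derivative D) (at z) \<and> (\<forall>c v. D (c *s v) = c * D v)"
    by (intro exI[of _ "\<lambda>v. D v - c * E v"]) (auto intro!: derivative_eq_intros simp: algebra_simps)
qed

lemma analytic_subvariety_zero_set:
  assumes "open U" "holomorphic_cn_on f U"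
  shows "analytic_subvariety U {z \<in> U. f z = 0}"
  unfolding analytic_subvariety_def
proof (intro conjI ballI)
  fix z assume "z \<in> U"
  then show "\<exists>V F. open V \<and> z \<in> V \<and> V \<subseteq> U \<and> finite F \<and> (\<forall>f\<in>F. holomorphic_cn_on f V) \<and>
      {z \<in> U. f z = 0} \<inter> V = {w \<in> V. \<forall>f\<in>F. f w = 0}"
    using assms by (intro exI[of _ U] exI[of _ "{f}"]) auto
qed auto

theorem corollary5p3:
  fixes M :: "(complex ^ 'n) set" and m :: nat
  assumes "connected M"
    and "generic_submanifold m M"
    and "m + 2 = 2 * CARD('n)"
    and "0 \<in> M"
    and "almost_minimal_at M 0"
  shows "modulus_uniqueness_at M 0"
  unfolding modulus_uniqueness_at_def
proof (intro allI impI, elim conjE)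
  fix U f g
  assume U: "open U" "connected U" "0 \<in> U" and f: "holomorphic_cn_on f U" and g: "holomorphic_cn_on g U"
    and mod: "\<forall>z\<in>M \<inter> U. cmod (f z) = cmod (g z)"
  obtain p S where p: "p \<in> M" "p \<in> U" and S: "CR_orbit M p S"
    and notin: "\<not> (\<exists>A. proper_analytic_subvariety U A \<and> (\<forall>\<^sub>F q in nhds p. q \<in> S \<longrightarrow> q \<in> A))"
    using assms(5) U unfolding almost_minimal_at_def by blast
  have evU: "\<forall>\<^sub>F q in nhds p. q \<in> U" by (rule eventually_nhds_in_open[OF U(1) p(2)])
  \<comment> \<open>The zeros of \<open>h\<close> form a subvariety of \<open>U\<close> containing
    \<open>S\<close> near \<open>p\<close>; by the choice of \<open>p\<close> it cannot be
    proper.\<close>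
  have ident: "h z = 0" if h: "holomorphic_cn_on h U" "\<forall>\<^sub>F q in nhds p. q \<in> S \<longrightarrow> h q = 0" and z: "z \<in> U" for h z
  proof -
    have "\<forall>\<^sub>F q in nhds p. q \<in> S \<longrightarrow> q \<in> {z \<in> U. h z = 0}"
      using h(2) evU by eventually_elim auto
    then have "{z \<in> U. h z = 0} = U"
      using notin analytic_subvariety_zero_set[OF U(1) h(1)] unfolding proper_analytic_subvariety_def by blast
    then show ?thesis using z by blast
  qed
  obtain m0 where m0: "CR_submanifold m0 (CR_dim_at M p) S" "p \<in> S" "S \<subseteq> M"
    "\<And>m' S'. CR_submanifold m' (CR_dim_at M p) S' \<Longrightarrow> p \<in> S' \<Longrightarrow> S' \<subseteq> M \<Longrightarrow> m0 \<le> m'"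
    using S unfolding CR_orbit_def by blast
  have modS: "\<forall>q\<in>S \<inter> U. cmod (f q) = cmod (g q)" using mod m0(3) by blast
  \<comment> \<open>The orbit is minimal among the submanifolds of \<open>M\<close>, in particular
    among those inside \<open>S\<close>.\<close>
  have min: "m0 \<le> m'" if "CR_submanifold m' (CR_dim_at M p) S'" "p \<in> S'" "S' \<subseteq> S" for m' S'
    using m0(4)[OF that(1,2)] that(3) m0(3) by blast
  have "(\<forall>\<^sub>F q in nhds p. q \<in> S \<longrightarrow> g q = 0) \<or>
    (\<exists>c. cmod c = 1 \<and> (\<forall>\<^sub>F q in nhds p. q \<in> S \<longrightarrow> f q = c * g q))"
    by (rule constant_ratio_on_minimal_submanifold[OF m0(1,2) U(1) p(2) f g modS]) (rule min; assumption)
  then show "\<exists>c. cmod c = 1 \<and> (\<forall>z\<in>U. f z = c * g z)"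
  proof (elim disjE exE conjE)
    \<comment> \<open>Here \<open>f\<close> and \<open>g\<close> both vanish on \<open>U\<close>,
      and the constant 1 is as good as any other.\<close>
    assume g0: "\<forall>\<^sub>F q in nhds p. q \<in> S \<longrightarrow> g q = 0"
    have "\<forall>\<^sub>F q in nhds p. q \<in> S \<longrightarrow> f q = 0"
      using g0 evU
    proof eventually_elim
      case (elim q)
      show ?case
      proof
        assume "q \<in> S"
        then have "cmod (f q) = cmod (g q)" "g q = 0" using elim modS by auto
        then show "f q = 0" by simp
      qed
    qed
    then have "f z = 1 * g z" if "z \<in> U" for z using ident[OF f _ that] ident[OF g g0 that] by simp
    then show ?thesis by (intro exI[of _ 1]) simp
  next
    fix c assume c: "cmod c = 1" and eq: "\<forall>\<^sub>F q in nhds p. q \<in> S \<longrightarrow> f q = c * g q"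
    have "\<forall>\<^sub>F q in nhds p. q \<in> S \<longrightarrow> f q - c * g q = 0" using eq by eventually_elim simp
    from ident[OF holomorphic_cn_on_diff_scale[OF f g] this] have "f z = c * g z" if "z \<in> U" for z using that by fastforce
    with c show ?thesis by blast
  qed
qed

end
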